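(* Let $p\ge2$ and let $\lambda$ be a partition with $p$-core $\bar\lambda$ and $p$-quotient $\mu\in\mathbb{Y}^p$. Write $R_\lambda(x)=\sum_{j=0}^{|\mu|}r_{\lambda,j}x^{|\mu|-j}$. Then for $j=0,1,\dots,|\mu|$, $$r_{\lambda,j}=(-1)^j\binom{|\mu|}{j}\sum_{\tilde\mu<_j\mu}(-1)^{\mathrm{ht}_p(\lambda/\tilde\lambda)}\frac{F^{(p)}_{\tilde\mu}F^{(p)}_{\mu/\tilde\mu}}{F^{(p)}_\mu}\,\frac{H_{\text{non-}p\text{-fold}}(\lambda)}{H_{\text{non-}p\text{-fold}}(\tilde\lambda)},$$ where $\tilde\lambda$ is the partition with $p$-quotient $\tilde\mu$ and the same $p$-core as $\lambda$.
   Context: Fix $p\ge2$. $q_n$ are defined by $\sum_{n\ge0}q_n(x)t^n/n!=\exp(tx-t^p/p)$; for a partition $\lambda$ with degree vector $n_i=\lambda_i+\ell(\lambda)-i$, $q_\lambda=\mathrm{Wr}[q_{n_1},\dots,q_{n_{\ell(\lambda)}}]/\prod_{i<j}(n_j-n_i)$. Border strips of size $p$: connected skew Young diagrams of $p$ boxes without a $2\times2$ square, whose removal leaves a Young diagram; height = number of rows minus one. The $p$-core $\bar\lambda$ is obtained by removing such strips as long as possible. The $p$-quotient: for the Maya diagram $M=\{m+t:m\in M_\lambda\}$, $M_\lambda=\{n<0\}\cup\{n_i\}$, $t\ge0$, let $\mu^i$ ($0\le i<p$) be the partition of the Maya diagram $\{m:pm+i\in M\}$ (the partition of a Maya diagram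 $N$ has as parts the positive values of $\#\{n\notin N:n<m\}$, $m\in N$); $\mu=(\mu^0,\dots,\mu^{p-1})\in\mathbb{Y}^p$, $|\mu|=\sum|\mu^i|$. Conversely, with the same $p$-core and the same labelling convention, each $\tilde\mu\in\mathbb{Y}^p$ determines a unique partition $\tilde\lambda$; if $\tilde\mu\le\mu$ componentwise (inclusion of Young diagrams), then $\tilde\lambda$ is obtained from $\lambda$ by successively removing $|\mu|-|\tilde\mu|$ border strips of size $p$, and $\mathrm{ht}_p(\lambda/\tilde\lambda)$ is the sum of their heights (its parity is independent of choices). $\tilde\mu<_j\mu$ means $\tilde\mu\le\mu$ and $|\tilde\mu|+j=|\mu|$. $R_\lambda$ is the monic polynomial of degree $|\mu|$ with $q_\lambda(x)=x^{|\bar\lambda|}R_\lambda(x^p)$. $H_{\text{non-}p\text{-fold}}(\lambda)$ is the product of the hook lengths of $\lambda$ not divisible by $p$. $F_{\alpha/\beta}$ is the number of saturated chains from $\beta$ to $\alpha$ in the Young lattice; for $\nu\le\mu$ in $\mathbb{Y}^p$, $F^{(p)}_{\mu/\nu}=\binom{|\mu|-|\nu|}{|\mu^0|-|\nu^0|,\dots,|\mu^{p-1}|-|\nu^{p-1}|}\prod_iF_{\mu^i/\nu^i}$ and $F^{(p)}_\mu=F^{(p)}_{\mu/(\emptyset,\dots,\emptyset)}$. *)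

theory Defs
  imports "HOL-Analysis.Derivative" "HOL-Computational_Algebra.Formal_Power_Series"
    "HOL-Computational_Algebra.Polynomial" "Jordan_Normal_Form.Determinant"
begin

definition partition :: "nat list \<Rightarrow> bool" where
  "partition lam \<longleftrightarrow> sorted_wrt (\<ge>) lam \<and> 0 \<notin> set lam"

definition psize :: "nat list \<Rightarrow> nat" where
  "psize lam = sum_list lam"

definition diagram :: "nat list \<Rightarrow> (nat \<times> nat) set" where
  "diagram lam = {(i, j). i < length lam \<and> j < lam ! i}"

definition yd_le :: "nat list \<Rightarrow> nat list \<Rightarrow> bool" where
  "yd_le a b \<longleftrightarrow> length a \<le> length b \<and> (\<forall>i < length a. a ! i \<le> b ! i)"

definition conj_part :: "nat list \<Rightarrow> nat \<Rightarrow> nat" where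
  "conj_part lam j = card {i. i < length lam \<and> j < lam ! i}"

definition hook :: "nat list \<Rightarrow> nat \<times> nat \<Rightarrow> nat" where
  "hook lam b = (lam ! fst b - snd b) + (conj_part lam (snd b) - fst b) - 1"

definition H_nonpfold :: "nat \<Rightarrow> nat list \<Rightarrow> real" where
  "H_nonpfold p lam = (\<Prod>b \<in> {b \<in> diagram lam. \<not> p dvd hook lam b}. real (hook lam b))"

definition qn :: "nat \<Rightarrow> nat \<Rightarrow> real \<Rightarrow> real" where
  "qn p n x = fact n * fps_nth (fps_exp x * (fps_exp (- 1 / real p) oo fps_X ^ p)) n"

text \<open>Degree vector n_i = lam_i + l - i (i = 1..l), stored 0-indexed.\<close>
definition degvec :: "nat list \<Rightarrow> nat list" where
  "degvec lam = map (\<lambda>i. lam ! i + length lam - Suc i) [0..<length lam]"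

definition wronskian :: "(real \<Rightarrow> real) list \<Rightarrow> real \<Rightarrow> real" where
  "wronskian fs x = det (mat (length fs) (length fs) (\<lambda>(i, j). (deriv ^^ i) (fs ! j) x))"

definition q_lam :: "nat \<Rightarrow> nat list \<Rightarrow> real \<Rightarrow> real" where
  "q_lam p lam x =
     (let ns = degvec lam; l = length lam in
      wronskian (map (qn p) ns) x /
      (\<Prod>i<l. \<Prod>j\<in>{i<..<l}. (real (ns ! j) - real (ns ! i))))"

definition box_adj :: "nat \<times> nat \<Rightarrow> nat \<times> nat \<Rightarrow> bool" where
  "box_adj a b \<longleftrightarrow>
     (fst a = fst b \<and> (snd a = Suc (snd b) \<or> snd b = Suc (snd a))) \<or>
     (snd a = snd b \<and> (fst a = Suc (fst b) \<or> fst b = Suc (fst a)))"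

definition connected_boxes :: "(nat \<times> nat) set \<Rightarrow> bool" where
  "connected_boxes S \<longleftrightarrow>
     (\<forall>a\<in>S. \<forall>b\<in>S. (\<lambda>x y. x \<in> S \<and> y \<in> S \<and> box_adj x y)\<^sup>*\<^sup>* a b)"

definition no_square :: "(nat \<times> nat) set \<Rightarrow> bool" where
  "no_square S \<longleftrightarrow> \<not> (\<exists>i j. (i, j) \<in> S \<and> (Suc i, j) \<in> S \<and> (i, Suc j) \<in> S \<and> (Suc i, Suc j) \<in> S)"

definition border_strip :: "nat \<Rightarrow> nat list \<Rightarrow> nat list \<Rightarrow> nat \<Rightarrow> bool" where
  "border_strip p lam nu h \<longleftrightarrow> partition nu \<and> yd_le nu lam \<and>
     (let S = diagram lam - diagram nu in
        card S = p \<and> S \<noteq> {} \<and> connected_boxes S \<and> no_square S \<and> h = card (fst ` S) - 1)"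

inductive strip_chain :: "nat \<Rightarrow> nat list \<Rightarrow> nat list \<Rightarrow> nat \<Rightarrow> nat \<Rightarrow> bool" for p where
  refl: "strip_chain p lam lam 0 0"
| step: "border_strip p lam kap h1 \<Longrightarrow> strip_chain p kap nu k h2 \<Longrightarrow>
         strip_chain p lam nu (Suc k) (h1 + h2)"

definition p_core :: "nat \<Rightarrow> nat list \<Rightarrow> nat list" where
  "p_core p lam = (THE nu. (\<exists>k h. strip_chain p lam nu k h) \<and> \<not> (\<exists>kap h. border_strip p nu kap h))"

text \<open>ht_p(lam/nu): total height of some sequence of border-strip removals from lam to nu
  (only its parity is used; it is independent of the choice).\<close>
definition ht_p :: "nat \<Rightarrow> nat list \<Rightarrow> nat list \<Rightarrow> nat" where
  "ht_p p lam nu = (SOME h. \<exists>k. strip_chain p lam nu k h)"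

definition holes_below :: "int set \<Rightarrow> int \<Rightarrow> nat" where
  "holes_below N m = card {n. n \<notin> N \<and> n < m}"

definition maya_partition :: "int set \<Rightarrow> nat list" where
  "maya_partition N =
     rev (sort (map (holes_below N) (sorted_list_of_set {m \<in> N. holes_below N m > 0})))"

definition maya_lam :: "nat list \<Rightarrow> int set" where
  "maya_lam lam = {n. n < 0} \<union> {int (degvec lam ! i) | i. i < length lam}"

definition maya_shift :: "nat \<Rightarrow> nat list \<Rightarrow> int set" where
  "maya_shift t lam = (\<lambda>m. m + int t) ` maya_lam lam"

definition maya_comp :: "nat \<Rightarrow> int set \<Rightarrow> nat \<Rightarrow> int set" where
  "maya_comp p M i = {m. int p * m + int i \<in> M}"

definition p_quotient :: "nat \<Rightarrow> nat \<Rightarrow> nat list \<Rightarrow> nat \<Rightarrow> nat list" where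
  "p_quotient p t lam i = (if i < p then maya_partition (maya_comp p (maya_shift t lam) i) else [])"

definition charge :: "int set \<Rightarrow> int" where
  "charge N = int (card {n \<in> N. n \<ge> 0}) - int (card {n. n \<notin> N \<and> n < 0})"

text \<open>The Maya diagram of charge c whose partition is nu.\<close>
definition maya_of :: "nat list \<Rightarrow> int \<Rightarrow> int set" where
  "maya_of nu c = range (\<lambda>i::nat. (if i < length nu then int (nu ! i) else 0) - int i - 1 + c)"

text \<open>The partition with the same p-core as lam and p-quotient mt (same labelling
  convention): the components of the Maya diagram of lam are replaced, keeping their
  charges, by the Maya diagrams of the mt i.\<close>
definition lam_tilde :: "nat \<Rightarrow> nat \<Rightarrow> nat list \<Rightarrow> (nat \<Rightarrow> nat list) \<Rightarrow> nat list" where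
  "lam_tilde p t lam mt = maya_partition
     {int p * m + int i | i m. i < p \<and>
        m \<in> maya_of (mt i) (charge (maya_comp p (maya_shift t lam) i))}"

definition is_ptuple :: "nat \<Rightarrow> (nat \<Rightarrow> nat list) \<Rightarrow> bool" where
  "is_ptuple p mu \<longleftrightarrow> (\<forall>i<p. partition (mu i)) \<and> (\<forall>i\<ge>p. mu i = [])"

definition qsize :: "nat \<Rightarrow> (nat \<Rightarrow> nat list) \<Rightarrow> nat" where
  "qsize p mu = (\<Sum>i<p. psize (mu i))"

definition qle :: "nat \<Rightarrow> (nat \<Rightarrow> nat list) \<Rightarrow> (nat \<Rightarrow> nat list) \<Rightarrow> bool" where
  "qle p a b \<longleftrightarrow> (\<forall>i<p. yd_le (a i) (b i))"

definition F_chains :: "nat list \<Rightarrow> nat list \<Rightarrow> nat" where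
  "F_chains alpha beta = card {ks. ks \<noteq> [] \<and> hd ks = beta \<and> last ks = alpha \<and>
      (\<forall>k\<in>set ks. partition k) \<and>
      (\<forall>i. Suc i < length ks \<longrightarrow> yd_le (ks ! i) (ks ! Suc i) \<and>
                                    psize (ks ! Suc i) = Suc (psize (ks ! i)))}"

definition Fp :: "nat \<Rightarrow> (nat \<Rightarrow> nat list) \<Rightarrow> (nat \<Rightarrow> nat list) \<Rightarrow> real" where
  "Fp p mu nu =
     (fact (qsize p mu - qsize p nu) / (\<Prod>i<p. fact (psize (mu i) - psize (nu i)))) *
     (\<Prod>i<p. real (F_chains (mu i) (nu i)))"

definition Fp_full :: "nat \<Rightarrow> (nat \<Rightarrow> nat list) \<Rightarrow> real" where
  "Fp_full p mu = Fp p mu (\<lambda>_. [])"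

definition R_lam :: "nat \<Rightarrow> nat list \<Rightarrow> real poly" where
  "R_lam p lam = (THE R. \<forall>x. q_lam p lam x = x ^ psize (p_core p lam) * poly R (x ^ p))"

end

theory Submission
  imports Defs
begin

text \<open>
  Everything is read off Maya diagrams: removing a border strip of size \<open>p\<close> moves one bead from \<open>m\<close> to
  \<open>m - p\<close>, the height being the number of beads jumped over, and the hooks are the pairs of a bead
  and a smaller gap. The polynomials \<open>u\<^sub>n = q\<^sub>n / n!\<close> satisfy \<open>u\<^sub>n' = u\<^sub>n\<^sub>-\<^sub>1\<close> and
  \<open>x u\<^sub>n' = n u\<^sub>n + u\<^sub>n\<^sub>-\<^sub>p\<close>. The Wronskian is the determinant of the \<open>u\<close> with index \<open>n\<^sub>j - i\<close>, and
  applying the Euler operator to it row by row gives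
  \<open>x q\<^sub>\<lambda>' = |\<lambda>| q\<^sub>\<lambda> + \<Sum> (-1)\<^sup>h (H(\<lambda>) / H(\<kappa>)) q\<^sub>\<kappa>\<close>, the sum over all ways to remove from \<open>\<lambda>\<close> a strip of
  height \<open>h\<close>, leaving \<open>\<kappa>\<close>; here \<open>H\<close> is the product of all hook lengths, which enters through the
  Vandermonde determinant.
  Comparing coefficients is a recursion for the \<open>r\<^sub>\<lambda>\<^sub>,\<^sub>j\<close>, and \<open>(-p)\<^sup>j j! r\<^sub>\<lambda>\<^sub>,\<^sub>j\<close> becomes a sum over chains of \<open>j\<close> strip
  removals. These are counted by \<open>F\<^sup>(\<^sup>p\<^sup>)\<close>, and their signs depend only on the two ends because the
  parity of the number of residue inversions between beads changes by the height. The same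
  recursion for the leading terms with \<open>p = 1\<close> is the hook length formula, which converts \<open>H\<close>
  into \<open>F\<^sup>(\<^sup>p\<^sup>)\<close> and the product of the hook lengths not divisible by \<open>p\<close>.
\<close>

section \<open>Partitions and Maya diagrams\<close>

text \<open>In the differential identity the coefficient at \<open>x^d\<close> carries the factor
  \<open>d - |\<lambda>|\<close>. Below the top degree it is nonzero, so every coefficient is
  determined by the top one, which is 1. For \<open>d = |\<lambda>| - p j\<close> the factor is
  \<open>- p j\<close>; multiplied over the steps of a chain these factors give
  \<open>(-p)^j j!\<close>. The weights \<open>H(\<lambda>) / H(\<kappa>)\<close> telescope along a
  chain, so that only a sign and a number of chains remain to be understood. One obstacle shapes the
  set-up: removing a strip can shorten a partition, whereas all determinants of one identity have
  the same size. Hence a partition is represented by \<open>l\<close> beads for any \<open>l\<close>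
  that is at least its length, and \<open>l\<close> stays fixed along a chain. Determinants for
  different \<open>l\<close> are never compared: the recursion and the top coefficient 1 hold for
  each \<open>l\<close> separately. A core and a labelling of the quotient are encoded as the
  charges of the \<open>p\<close> runners. With these fixed, partitions and tuples are two names for
  the same bead set, and the recursion over strips becomes a recursion over tuples with one box
  less.\<close>

definition part :: "nat list \<Rightarrow> nat \<Rightarrow> nat" where
  "part nu i = (if i < length nu then nu ! i else 0)"

text \<open>The strictly decreasing enumeration of the beads. The \<open>- 1\<close> makes the empty
  partition of charge 0 the set of negative integers; the charge is a translation.\<close>

definition beta :: "nat list \<Rightarrow> int \<Rightarrow> nat \<Rightarrow> int" where
  "beta nu c i = int (part nu i) - int i - 1 + c"

lemma maya_of_eq: "maya_of nu c = range (beta nu c)"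
  unfolding maya_of_def beta_def part_def by (intro arg_cong[where f = range] ext) auto

lemma part_antimono:
  assumes "partition nu" "i \<le> j"
  shows "part nu j \<le> part nu i"
proof (cases "i = j \<or> j \<ge> length nu")
  case False
  with assms show ?thesis
    by (auto simp: part_def partition_def sorted_wrt_iff_nth_less)
qed (auto simp: part_def)

lemma part_eq_0_iff: "partition nu \<Longrightarrow> part nu i = 0 \<longleftrightarrow> length nu \<le> i"
  by (cases "i < length nu") (simp_all add: part_def partition_def not_le, metis nth_mem neq0_conv)

lemma partition_Nil [simp]: "partition []"
  by (simp add: partition_def)

lemma part_Nil [simp]: "part [] i = 0"
  by (simp add: part_def)

lemma partition_eqI:
  assumes "partition a" "partition b" "\<And>i. part a i = part b i"
  shows "a = b"
proof (rule nth_equalityI)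
  show l: "length a = length b"
    using part_eq_0_iff[OF assms(1)] part_eq_0_iff[OF assms(2)] assms(3)
    by (metis le_antisym order_refl)
  show "a ! i = b ! i" if "i < length a" for i
    using assms(3)[of i] that l by (simp add: part_def)
qed

text \<open>Converse of the zero padding: the list is cut at the least index where \<open>f\<close>
  vanishes, since a partition has no zero parts.\<close>

lemma exists_partition:
  assumes f: "\<And>i. f (Suc i) \<le> f i" and K: "f K = (0::nat)"
  shows "\<exists>nu. partition nu \<and> part nu = f"
proof -
  have anti: "f j \<le> f i" if "i \<le> j" for i j
    using f that by (rule lift_Suc_antimono_le)
  define l where "l = (LEAST k. f k = 0)"
  have l0: "f l = 0" unfolding l_def by (rule LeastI[of _ K]) (rule K)
  have lpos: "f i \<noteq> 0" if "i < l" for i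
    using not_less_Least[of i "\<lambda>k. f k = 0"] that unfolding l_def by blast
  let ?nu = "map f [0..<l]"
  have "partition ?nu"
    using lpos anti by (force simp: partition_def sorted_wrt_iff_nth_less)
  moreover have "part ?nu = f"
  proof
    fix i show "part ?nu i = f i"
      using anti[of l i] l0 by (auto simp: part_def)
  qed
  ultimately show ?thesis by blast
qed

lemma diagram_eq: "diagram nu = {(i, j). j < part nu i}"
  by (auto simp: diagram_def part_def split: if_splits)

lemma yd_le_iff:
  assumes "partition a"
  shows "yd_le a b \<longleftrightarrow> (\<forall>i. part a i \<le> part b i)"
proof
  assume "yd_le a b"
  then show "\<forall>i. part a i \<le> part b i" by (auto simp: yd_le_def part_def)
next
  assume h: "\<forall>i. part a i \<le> part b i"
  have "length a \<le> length b"
  proof (rule ccontr)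
    assume "\<not> length a \<le> length b"
    then have "part b (length b) = 0" "part a (length b) \<noteq> 0"
      using part_eq_0_iff[OF assms, of "length b"] by (auto simp: part_def)
    then show False using h by (metis le_zero_eq)
  qed
  moreover have "a ! i \<le> b ! i" if "i < length a" for i
    using h[rule_format, of i] that calculation by (simp add: part_def)
  ultimately show "yd_le a b" by (simp add: yd_le_def)
qed

lemma diagram_Sigma:
  "length nu \<le> K \<Longrightarrow> diagram nu = Sigma {..<K} (\<lambda>i. {..<part nu i})"
  by (auto simp: diagram_eq part_def split: if_splits)

lemma finite_diagram [simp]: "finite (diagram nu)"
  by (subst diagram_Sigma[OF order_refl]) auto

lemma card_diagram: "length nu \<le> K \<Longrightarrow> card (diagram nu) = (\<Sum>i<K. part nu i)"
  by (simp add: diagram_Sigma)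

lemma psize_eq_card: "psize nu = card (diagram nu)"
  by (simp add: card_diagram[OF order_refl] psize_def sum_list_sum_nth part_def lessThan_atLeast0)

lemma psize_Nil [simp]: "psize [] = 0"
  by (simp add: psize_def)

lemma psize_eq_0_iff: "partition nu \<Longrightarrow> psize nu = 0 \<longleftrightarrow> nu = []"
  by (cases nu) (auto simp: psize_def partition_def)

lemma diagram_subset_iff:
  "diagram a \<subseteq> diagram b \<longleftrightarrow> (\<forall>i. part a i \<le> part b i)"
proof
  assume h: "diagram a \<subseteq> diagram b"
  show "\<forall>i. part a i \<le> part b i"
  proof (rule allI, rule ccontr)
    fix i assume "\<not> part a i \<le> part b i"
    then have "(i, part b i) \<in> diagram a" by (simp add: diagram_eq)
    then show False using h by (auto simp: diagram_eq)
  qed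
next
  assume "\<forall>i. part a i \<le> part b i"
  then show "diagram a \<subseteq> diagram b" by (auto simp: diagram_eq intro: less_le_trans)
qed

lemma partition_diagram_inject:
  "partition a \<Longrightarrow> partition b \<Longrightarrow> diagram a = diagram b \<Longrightarrow> a = b"
  by (rule partition_eqI) (auto simp: set_eq_subset diagram_subset_iff intro: antisym)

lemma psize_mono:
  assumes "partition a" "yd_le a b"
  shows "psize a \<le> psize b"
  unfolding psize_eq_card using assms by (intro card_mono) (auto simp: diagram_subset_iff yd_le_iff)

lemma yd_le_psize_eq:
  assumes "partition a" "partition b" "yd_le a b" "psize a = psize b"
  shows "a = b"
proof -
  have "diagram a = diagram b"
    using assms by (intro card_subset_eq) (auto simp: diagram_subset_iff yd_le_iff psize_eq_card)
  then show ?thesis using assms partition_diagram_inject by blast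
qed

lemma yd_le_refl [simp]: "yd_le a a" by (simp add: yd_le_def)

section \<open>The beads of a partition\<close>

lemma beta_less: 
  assumes "partition nu" "i < j"
  shows "beta nu c j < beta nu c i"
  using part_antimono[OF assms(1), of i j] assms(2) by (simp add: beta_def)

lemma beta_le_iff:
  assumes "partition nu"
  shows "beta nu c i \<le> beta nu c j \<longleftrightarrow> j \<le> i"
  using beta_less[OF assms, of i j c] beta_less[OF assms, of j i c]
  by (cases i j rule: linorder_cases) auto

lemma beta_less_iff:
  assumes "partition nu"
  shows "beta nu c i < beta nu c j \<longleftrightarrow> j < i"
  using beta_le_iff[OF assms] by (meson not_le)

lemma inj_beta: "partition nu \<Longrightarrow> inj (beta nu c)"
  by (rule injI) (metis beta_le_iff antisym order_refl)

lemma beta_ge_length: "length nu \<le> i \<Longrightarrow> beta nu c i = c - int i - 1"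
  by (simp add: beta_def part_def)

lemma lower_maya_of: "{..< c - int (length nu)} \<subseteq> maya_of nu c"
proof
  fix x assume x: "x \<in> {..<c - int (length nu)}"
  have "beta nu c (nat (c - 1 - x)) = x"
    by (subst beta_ge_length) (use x in auto)
  then show "x \<in> maya_of nu c" unfolding maya_of_eq by (metis rangeI)
qed

lemma upper_maya_of:
  assumes "partition nu"
  shows "maya_of nu c \<subseteq> {..beta nu c 0}"
  using beta_le_iff[OF assms] by (auto simp: maya_of_eq)

text \<open>Full far below and empty far above. This makes the charge and the hole counts finite,
  and it characterises the sets \<open>maya_of nu c\<close>.\<close>

definition mayaset :: "int set \<Rightarrow> bool" where
  "mayaset M \<longleftrightarrow> (\<exists>a. {..<a} \<subseteq> M) \<and> (\<exists>b. M \<subseteq> {..b})"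

lemma mayaset_maya_of: "partition nu \<Longrightarrow> mayaset (maya_of nu c)"
  unfolding mayaset_def using lower_maya_of upper_maya_of by blast

lemma mayaset_finite_above: "mayaset M \<Longrightarrow> finite (M \<inter> {a..})"
  unfolding mayaset_def
  by (elim conjE exE) (rule finite_subset[of _ "{a..b}" for b], auto)

lemma mayaset_finite_holes: "mayaset M \<Longrightarrow> finite {n. n \<notin> M \<and> n < b}"
proof -
  assume "mayaset M"
  then obtain a where "{..<a} \<subseteq> M" by (auto simp: mayaset_def)
  then have "{n. n \<notin> M \<and> n < b} \<subseteq> {a..<b}" by (auto simp: subset_iff not_less[symmetric])
  then show ?thesis by (rule finite_subset) simp
qed

text \<open>The \<open>- a\<close> places from \<open>a\<close> to \<open>- 1\<close> are beads or
  holes, so counting beads from \<open>a\<close> upwards trades the hole count for beads. The count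
  of a single finite set is easier to follow under bead moves.\<close>

lemma charge_eq:
  assumes M: "mayaset M" and a: "{..<a} \<subseteq> M" "a \<le> 0"
  shows "charge M = int (card (M \<inter> {a..})) + a"
proof -
  have 1: "M \<inter> {a..} = {n\<in>M. n \<ge> 0} \<union> ({a..<0} - {n. n \<notin> M \<and> n < 0})" using a by auto
  have sub: "{n. n \<notin> M \<and> n < 0} \<subseteq> {a..<0}" using a by force
  have f: "finite {n\<in>M. n \<ge> 0}" using mayaset_finite_above[OF M, of 0]
    by (rule rev_finite_subset) auto
  have "card (M \<inter> {a..}) = card {n\<in>M. n \<ge> 0} + card ({a..<0} - {n. n \<notin> M \<and> n < 0})"
    unfolding 1 by (rule card_Un_disjoint) (use f in auto)
  also have "card ({a..<0} - {n. n \<notin> M \<and> n < 0}) = nat (- a) - card {n. n \<notin> M \<and> n < 0}"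
    using sub by (subst card_Diff_subset) (auto intro: finite_subset)
  finally show ?thesis using card_mono[OF _ sub] a(2) by (simp add: charge_def)
qed

lemma maya_of_above_beta:
  assumes "partition nu"
  shows "maya_of nu c \<inter> {beta nu c K..} = beta nu c ` {..K}"
  using beta_le_iff[OF assms] by (auto simp: maya_of_eq)

lemma lower_maya_of_beta:
  assumes "length nu \<le> K" shows "{..<beta nu c K} \<subseteq> maya_of nu c"
  using lower_maya_of[of c nu] assms by (auto simp: beta_ge_length)

lemma charge_maya_of [simp]:
  assumes nu: "partition nu"
  shows "charge (maya_of nu c) = c"
proof -
  define K where "K = max (length nu) (nat c)"
  have K: "length nu \<le> K" "c \<le> int K" by (auto simp: K_def)
  have "charge (maya_of nu c) = int (card (maya_of nu c \<inter> {beta nu c K..})) + beta nu c K"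
    by (rule charge_eq[OF mayaset_maya_of[OF nu] lower_maya_of_beta])
       (use K in \<open>auto simp: beta_ge_length\<close>)
  also have "card (maya_of nu c \<inter> {beta nu c K..}) = Suc K"
    unfolding maya_of_above_beta[OF nu]
    by (subst card_image) (use inj_beta[OF nu] in \<open>auto intro: inj_on_subset\<close>)
  finally show ?thesis using K by (simp add: beta_ge_length)
qed

text \<open>Between the \<open>K\<close>-th and the \<open>i\<close>-th bead lie exactly the beads
  with index between them; with \<open>K\<close> at least the length, no hole is lower than the
  \<open>K\<close>-th bead.\<close>

lemma holes_below_beta:
  assumes nu: "partition nu"
  shows "holes_below (maya_of nu c) (beta nu c i) = part nu i"
proof -
  define K where "K = max (length nu) i"
  have K: "length nu \<le> K" "i \<le> K" by (auto simp: K_def)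
  have eq: "{n. n \<notin> maya_of nu c \<and> n < beta nu c i} = {beta nu c K..<beta nu c i} - beta nu c ` {i<..K}"
    (is "?A = ?B")
  proof
    show "?A \<subseteq> ?B" using lower_maya_of_beta[OF K(1), of c] by (force simp: maya_of_eq)
    show "?B \<subseteq> ?A"
    proof
      fix n assume n: "n \<in> ?B"
      have "n \<notin> maya_of nu c"
      proof
        assume "n \<in> maya_of nu c"
        then obtain k where "n = beta nu c k" by (auto simp: maya_of_eq)
        with n show False using beta_le_iff[OF nu, of c] beta_less_iff[OF nu, of c] by auto
      qed
      with n show "n \<in> ?A" by auto
    qed
  qed
  have sub: "beta nu c ` {i<..K} \<subseteq> {beta nu c K..<beta nu c i}"
    using beta_le_iff[OF nu, of c] beta_less_iff[OF nu, of c] by auto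
  have "card (beta nu c ` {i<..K}) = K - i"
    by (subst card_image) (use inj_beta[OF nu] in \<open>auto intro: inj_on_subset\<close>)
  then have "holes_below (maya_of nu c) (beta nu c i) = nat (beta nu c i - beta nu c K) - (K - i)"
    unfolding holes_below_def eq using sub by (subst card_Diff_subset) auto
  also have "\<dots> = part nu i" using K by (simp add: beta_ge_length) (simp add: beta_def)
  finally show ?thesis .
qed

lemma maya_partition_maya_of [simp]:
  assumes nu: "partition nu"
  shows "maya_partition (maya_of nu c) = nu"
proof -
  let ?M = "maya_of nu c" and ?l = "length nu"
  let ?xs = "map (beta nu c) [0..<?l]"
  have S: "{m \<in> ?M. holes_below ?M m > 0} = set ?xs"
  proof -
    have "{m \<in> ?M. holes_below ?M m > 0} = beta nu c ` {i. part nu i > 0}"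
      using holes_below_beta[OF nu, of c] by (auto simp: maya_of_eq)
    also have "{i. part nu i > 0} = {..<?l}"
      using part_eq_0_iff[OF nu] by (auto simp: not_le[symmetric] simp del: not_le)
    finally show ?thesis by (simp add: lessThan_atLeast0)
  qed
  have sorted: "sorted (rev ?xs)"
    unfolding sorted_wrt_rev using beta_le_iff[OF nu]
    by (simp add: sorted_wrt_iff_nth_less)
  have "distinct (rev ?xs)"
    using inj_beta[OF nu] by (auto simp: distinct_map intro: inj_on_subset)
  then have "sorted_list_of_set {m \<in> ?M. holes_below ?M m > 0} = rev ?xs"
    unfolding S using sorted sorted_list_of_set.idem_if_sorted_distinct[of "rev ?xs"] by auto
  moreover have "map (holes_below ?M) (rev ?xs) = rev nu"
    unfolding rev_map[symmetric] map_map
    by (rule arg_cong[where f = rev], rule nth_equalityI)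
       (auto simp: holes_below_beta[OF nu] part_def)
  moreover have "sort (rev nu) = rev nu"
    by (rule sorted_sort_id) (use nu in \<open>auto simp: sorted_wrt_rev partition_def\<close>)
  ultimately show ?thesis by (simp add: maya_partition_def)
qed

lemma maya_of_inject:
  "partition a \<Longrightarrow> partition b \<Longrightarrow> maya_of a c = maya_of b c \<Longrightarrow> a = b"
  by (metis maya_partition_maya_of)

section \<open>Every Maya diagram comes from a partition\<close>

lemma decreasing_enumeration:
  assumes M: "mayaset M"
  obtains e where "\<And>i. e (Suc i) < e i" "range e = (M :: int set)"
proof -
  obtain a b where ab: "{..<a} \<subseteq> M" "M \<subseteq> {..b}" using M by (auto simp: mayaset_def)
  define S where "S = {k::nat. b - int k \<in> M}"
  have "{nat (b - a + 1)..} \<subseteq> S" using ab by (auto simp: S_def)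
  then have inf: "infinite S" using infinite_Ici finite_subset by blast
  define e where "e i = b - int (enumerate S i)" for i
  have "e (Suc i) < e i" for i using enumerate_mono[of i "Suc i", OF _ inf] by (simp add: e_def)
  moreover have "range e = M"
  proof -
    have "range e = (\<lambda>k. b - int k) ` S"
      using range_enumerate[OF inf] unfolding e_def by (metis image_image)
    also have "\<dots> = M"
    proof
      show "M \<subseteq> (\<lambda>k. b - int k) ` S"
      proof
        fix x assume x: "x \<in> M"
        then have "nat (b - x) \<in> S" "x = b - int (nat (b - x))" using ab by (auto simp: S_def)
        then show "x \<in> (\<lambda>k. b - int k) ` S" by blast
      qed
    qed (auto simp: S_def)
    finally show ?thesis .
  qed
  ultimately show ?thesis using that by blast
qed

text \<open>For the decreasing enumeration \<open>e\<close>, the sequence \<open>e i + i + 1\<close>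
  is weakly decreasing. Below the filled level each step of \<open>e\<close> is exactly one, so the
  sequence becomes constant; the constant is the charge, and the excess over it is the
  partition.\<close>

lemma mayaset_imp_maya_of:
  assumes M: "mayaset M"
  shows "\<exists>nu. partition nu \<and> M = maya_of nu (charge M)"
proof -
  obtain a where a: "{..<a} \<subseteq> M" using M by (auto simp: mayaset_def)
  obtain e where e: "\<And>i. e (Suc i) < e i" "range e = M"
    using decreasing_enumeration[OF M] by blast
  have mono: "e j < e i" if "i < j" for i j
  proof -
    have "e j \<le> e (Suc i)"
      by (rule lift_Suc_antimono_le[of e]) (use e(1) that in \<open>auto intro: less_imp_le\<close>)
    then show ?thesis using e(1)[of i] by simp
  qed
  obtain K where K: "e K = a - 1" 
  proof -
    have "a - 1 \<in> range e" using a e(2) by auto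
    then show ?thesis using that by force
  qed
  have step: "e (Suc i) = e i - 1" if "e i < a" for i
  proof -
    have "e i - 1 \<in> range e" using a that e(2) by auto
    then obtain k where k: "e k = e i - 1" by force
    then have "i < k" using mono[of k i] by (cases i k rule: linorder_cases) auto
    then have "e k \<le> e (Suc i)" using mono[of "Suc i" k] by (cases "k = Suc i") auto
    then show ?thesis using k e(1)[of i] by simp
  qed
  have tail: "e (K + i) = e K - int i" for i
  proof (induction i)
    case (Suc i)
    then show ?case using step[of "K + i"] K by simp
  qed simp
  define c where "c = e K + int K + 1"
  define g where "g i = e i + int i + 1 - c" for i
  have g_anti: "g (Suc i) \<le> g i" for i using e(1)[of i] by (simp add: g_def)
  have g_tail: "g (K + i) = 0" for i using tail[of i] by (simp add: g_def c_def)
  have g0: "g i \<ge> 0" for i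
  proof -
    have "g (K + i) \<le> g i" by (rule lift_Suc_antimono_le[of g]) (use g_anti in auto)
    then show ?thesis using g_tail[of i] by simp
  qed
  obtain nu where nu: "partition nu" "part nu = (\<lambda>i. nat (g i))"
    using exists_partition[of "\<lambda>i. nat (g i)" K] g_anti g_tail[of 0] by (auto intro: nat_mono)
  have "beta nu c i = e i" for i
    using g0[of i] by (simp add: beta_def nu(2)) (simp add: g_def)
  then have "M = maya_of nu c" unfolding maya_of_eq e(2)[symmetric] by (intro image_cong) auto
  with nu show ?thesis by auto
qed

lemma
  assumes M: "mayaset M"
  shows partition_maya_partition: "partition (maya_partition M)"
    and maya_of_maya_partition: "maya_of (maya_partition M) (charge M) = M"
proof -
  obtain nu where nu: "partition nu" "M = maya_of nu (charge M)"
    using mayaset_imp_maya_of[OF M] by blast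
  then have "maya_partition M = nu" by (metis maya_partition_maya_of)
  with nu show "partition (maya_partition M)" "maya_of (maya_partition M) (charge M) = M" by simp_all
qed

section \<open>Moving one bead by \<open>p\<close>\<close>

definition mv :: "nat \<Rightarrow> int \<Rightarrow> int set \<Rightarrow> int set" where
  "mv p m M = insert (m - int p) (M - {m})"

definition movable :: "nat \<Rightarrow> int set \<Rightarrow> int set" where
  "movable p M = {m \<in> M. m - int p \<notin> M}"

text \<open>The target of a move is empty, hence not below \<open>a\<close>. So one filled level
  \<open>a\<close> serves for a whole chain of moves.\<close>

lemma lower_mv: "{..<a} \<subseteq> M \<Longrightarrow> m \<in> movable p M \<Longrightarrow> {..<a} \<subseteq> mv p m M \<and> a \<le> m - int p \<and> a \<le> m"

proof -
  assume a: "{..<a} \<subseteq> M" and m: "m \<in> movable p M"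
  have 1: "a \<le> m - int p" using a m by (force simp: movable_def)
  then have "a \<le> m" by simp
  with 1 show ?thesis using a by (auto simp: mv_def)
qed

lemma mayaset_mv: "mayaset M \<Longrightarrow> m \<in> movable p M \<Longrightarrow> mayaset (mv p m M)"
proof -
  assume M: "mayaset M" and m: "m \<in> movable p M"
  obtain a b where ab: "{..<a} \<subseteq> M" "M \<subseteq> {..b}" using M by (auto simp: mayaset_def)
  have "mv p m M \<subseteq> {..b}" using ab m by (auto simp: mv_def movable_def)
  then show ?thesis unfolding mayaset_def using lower_mv[OF ab(1) m] by blast
qed

lemma charge_mv: 
  assumes M: "mayaset M" and m: "m \<in> movable p M"
  shows "charge (mv p m M) = charge M"
proof -
  obtain a where a: "{..<a} \<subseteq> M" "a \<le> 0" 
  proof -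
    obtain a where "{..<a} \<subseteq> M" using M by (auto simp: mayaset_def)
    then have "{..<min a 0} \<subseteq> M" "min a 0 \<le> 0" by auto
    then show ?thesis by (rule that)
  qed
  note l = lower_mv[OF a(1) m]
  have "mv p m M \<inter> {a..} = insert (m - int p) (M \<inter> {a..} - {m})"
    using l by (auto simp: mv_def)
  moreover have "card \<dots> = Suc (card (M \<inter> {a..} - {m}))"
    using m mayaset_finite_above[OF M, of a]
    by (intro card_insert_disjoint) (auto simp: movable_def)
  moreover have "\<dots> = card (M \<inter> {a..})"
    using l m mayaset_finite_above[OF M, of a]
    by (intro card_Suc_Diff1) (auto simp: movable_def)
  ultimately show ?thesis
    using charge_eq[OF M a] charge_eq[OF mayaset_mv[OF M m] _ a(2)] l by simp
qed

section \<open>Border strips as bead moves\<close>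

text \<open>Border strips in terms of row lengths. The strip occupies rows \<open>r..s\<close>;
  connectedness and the absence of squares together say that neighbouring rows of the strip overlap
  in exactly one column. The last equation is the size, telescoped over the rows.\<close>

definition strip_shape :: "nat \<Rightarrow> nat list \<Rightarrow> nat list \<Rightarrow> nat \<Rightarrow> nat \<Rightarrow> bool" where
  "strip_shape p lam nu r s \<longleftrightarrow> r \<le> s \<and> part nu s < part lam s \<and>
     (\<forall>i. i < r \<or> s < i \<longrightarrow> part nu i = part lam i) \<and>
     (\<forall>i. r \<le> i \<and> i < s \<longrightarrow> Suc (part nu i) = part lam (Suc i)) \<and>
     part lam r + s = part nu s + r + p"

text \<open>The condition on the inner rows reads \<open>beta nu i = beta lam (Suc i)\<close>: the
  beads of rows \<open>r+1..s\<close> are renumbered but stay in place. So the bead sets differ in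
  one bead only, and the renumbered beads are those jumped over.\<close>

lemma strip_shape_move:
  fixes c :: int
  assumes lam: "partition lam" and nu: "partition nu" and sh: "strip_shape p lam nu r s"
  defines "M \<equiv> maya_of lam c"
  shows "beta lam c r \<in> movable p M" "maya_of nu c = mv p (beta lam c r) M"
    "card {x \<in> M. beta lam c r - int p < x \<and> x < beta lam c r} = s - r"
proof -
  let ?b = "beta lam c" and ?b' = "beta nu c"
  have rs: "r \<le> s" and lt: "part nu s < part lam s"
    and outer: "\<And>i. i < r \<or> s < i \<Longrightarrow> ?b' i = ?b i"
    and inner: "\<And>i. r \<le> i \<Longrightarrow> i < s \<Longrightarrow> ?b' i = ?b (Suc i)"
    and bs: "?b' s = ?b r - int p"
    using sh by (auto simp: strip_shape_def beta_def)
  have lt1: "?b' s < ?b s" using lt by (simp add: beta_def)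
  have lt2: "?b (Suc s) < ?b' s" using outer[of "Suc s"] beta_less[OF nu, of s "Suc s" c] by simp
  have gap: "i \<le> s" if "?b' s \<le> ?b i" for i
    using that lt2 beta_le_iff[OF lam, of c i "Suc s"] by (meson leD leI less_le_trans not_less_eq_eq less_imp_le order_trans)
  have notin: "?b' s \<noteq> ?b i" for i
    using gap[of i] lt1 beta_le_iff[OF lam, of c s i] by force
  show "?b r \<in> movable p M"
    using notin bs by (auto simp: movable_def M_def maya_of_eq) 
  have "?b' ` UNIV = ?b' ` ({..<r} \<union> {r..<s} \<union> {s} \<union> {s<..})"
    using rs by (intro arg_cong[where f = "image _"]) auto
  also have "\<dots> = ?b ` {..<r} \<union> ?b ` Suc ` {r..<s} \<union> {?b' s} \<union> ?b ` {s<..}"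
    unfolding image_Un image_image using outer inner by (auto simp: image_iff intro!: bexI)
  also have "\<dots> = insert (?b' s) (?b ` ({..<r} \<union> {r<..s} \<union> {s<..}))"
    by (auto simp: image_Un image_Suc_atLeastLessThan atLeastSucAtMost_greaterThanAtMost[symmetric] atLeastLessThanSuc_atLeastAtMost)
  also have "{..<r} \<union> {r<..s} \<union> {s<..} = UNIV - {r}" using rs by auto
  also have "?b ` (UNIV - {r}) = M - {?b r}"
    using inj_beta[OF lam, of c] by (simp add: image_set_diff M_def maya_of_eq)
  finally show "maya_of nu c = mv p (?b r) M" by (simp add: mv_def maya_of_eq bs)
  have "{x \<in> M. ?b r - int p < x \<and> x < ?b r} = ?b ` {r<..s}"
  proof -
    have "?b' s < ?b i \<and> ?b i < ?b r \<longleftrightarrow> r < i \<and> i \<le> s" for i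
    proof -
      have "?b' s < ?b i \<longleftrightarrow> i \<le> s"
        using gap[of i] lt1 beta_le_iff[OF lam, of c s i] by linarith
      then show ?thesis by (simp add: beta_less_iff[OF lam] conj_commute)
    qed
    then have "{i. ?b' s < ?b i \<and> ?b i < ?b r} = {r<..s}"
      unfolding greaterThanAtMost_def greaterThan_def atMost_def Int_def by (rule Collect_cong[OF trans]) simp
    moreover have "{x \<in> M. ?b r - int p < x \<and> x < ?b r} = ?b ` {i. ?b' s < ?b i \<and> ?b i < ?b r}"
      by (auto simp: M_def maya_of_eq bs)
    ultimately show ?thesis by simp
  qed
  then show "card {x \<in> M. ?b r - int p < x \<and> x < ?b r} = s - r"
    using inj_beta[OF lam, of c] by (simp add: card_image inj_on_subset)
qed

lemma move_strip_shape:
  assumes lam: "partition lam" and m: "m \<in> movable p (maya_of lam c)"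
  obtains nu r s where "partition nu" "strip_shape p lam nu r s" "m = beta lam c r"
proof -
  let ?b = "beta lam c"
  obtain r where r: "m = ?b r" using m by (auto simp: movable_def maya_of_eq)
  have notin: "?b i \<noteq> m - int p" for i using m unfolding movable_def maya_of_eq by (metis (no_types, lifting) mem_Collect_eq rangeI)
  have p: "p \<noteq> 0" using m by (cases "p = 0") (auto simp: movable_def)
  define A where "A = {i. ?b i > m - int p}"
  have "i < length lam + nat (c - m + int p)" if "i \<in> A" for i
    using that beta_ge_length[of lam i c] by (cases "i < length lam") (auto simp: A_def)
  then have finA: "finite A" by (intro finite_subset[OF _ finite_lessThan]) auto
  have rA: "r \<in> A" using p r by (simp add: A_def)
  define s where "s = Max A"
  have s: "s \<in> A" "Suc s \<notin> A" "r \<le> s"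
    using Max_in[OF finA] Max_ge[OF finA] rA unfolding s_def by fastforce+
  have s1: "?b (Suc s) < m - int p" using s(2) notin[of "Suc s"] by (auto simp: A_def)
  have s2: "m - int p < ?b s" using s(1) by (auto simp: A_def)
  \<comment> \<open>The new bead set, sorted again: \<open>s\<close> is the index of the last bead
    above the target \<open>m - p\<close>, the beads after \<open>r\<close> up to \<open>s\<close>
    move up by one index, and the target takes place \<open>s\<close>.\<close>
  define e where "e i = (if i < r \<or> s < i then ?b i else if i < s then ?b (Suc i) else m - int p)" for i
  have e: "e (Suc i) < e i" for i
    using beta_less[OF lam, of i "Suc i" c] beta_less[OF lam, of "Suc i" "Suc (Suc i)" c] 
      beta_less[OF lam, of i "Suc (Suc i)" c] s1 s2 s(3)
      beta_le_iff[OF lam, of c s "Suc i"]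
    by (auto simp: e_def not_less)
  define f where "f i = nat (e i + int i + 1 - c)" for i
  have tail: "e i = c - int i - 1" if "i > s" "length lam \<le> i" for i
    using that by (simp add: e_def beta_ge_length)
  have mono: "e j + int j \<le> e i + int i" if "i \<le> j" for i j
  proof -
    have "e (Suc n) + int (Suc n) \<le> e n + int n" for n using e[of n] by simp
    then show ?thesis by (rule lift_Suc_antimono_le[of "\<lambda>i. e i + int i", OF _ that])
  qed
  have f_int: "int (f i) = e i + int i + 1 - c" for i
    using mono[of i "i + length lam + Suc s"] tail[of "i + length lam + Suc s"] by (simp add: f_def)
  have f_le: "f (Suc i) \<le> f i" for i using f_int[of i] f_int[of "Suc i"] e[of i] by linarith
  have f0: "f (length lam + Suc s) = 0" using tail by (simp add: f_def)
  obtain nu where nu: "partition nu" "part nu = f"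
    using exists_partition[of f, OF f_le f0] by blast
  have be: "int (part nu i) = e i + int i + 1 - c" for i using f_int[of i] nu(2) by simp
  have bl: "int (part lam i) = ?b i + int i + 1 - c" for i by (simp add: beta_def)
  have "part nu s < part lam s" using be[of s] bl[of s] s2 s(3) by (simp add: e_def)
  moreover have "part nu i = part lam i" if "i < r \<or> s < i" for i
    using be[of i] bl[of i] that by (simp add: e_def)
  moreover have "Suc (part nu i) = part lam (Suc i)" if "r \<le> i" "i < s" for i
    using be[of i] bl[of "Suc i"] that by (simp add: e_def)
  moreover have "part lam r + s = part nu s + r + p"
    using be[of s] bl[of r] s(3) r by (simp add: e_def)
  ultimately have "strip_shape p lam nu r s" using s(3) by (auto simp: strip_shape_def)
  with nu(1) r that show ?thesis by blast
qed

lemma skew_eq: "diagram lam - diagram nu = {(i, j). part nu i \<le> j \<and> j < part lam i}"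
  by (auto simp: diagram_eq)

text \<open>The relation between neighbouring rows makes the row lengths telescope, which leaves
  only the first row of \<open>lam\<close> and the last row of \<open>nu\<close>.\<close>

lemma card_skew_strip:
  assumes le: "\<And>i. part nu i \<le> part lam i" and rs: "r \<le> s"
    and outer: "\<And>i. i < r \<or> s < i \<Longrightarrow> part nu i = part lam i"
    and inner: "\<And>i. r \<le> i \<Longrightarrow> i < s \<Longrightarrow> Suc (part nu i) = part lam (Suc i)"
  shows "card (diagram lam - diagram nu) + part nu s + r = part lam r + s"
proof -
  have "diagram lam - diagram nu = Sigma {r..s} (\<lambda>i. {part nu i..<part lam i})"
      proof -
    have "r \<le> i \<and> i \<le> s" if "part nu i \<le> j" "j < part lam i" for i j
      using outer[of i] that by force
    then show ?thesis unfolding skew_eq by auto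
  qed
  then have "int (card (diagram lam - diagram nu)) = (\<Sum>i=r..s. int (part lam i) - int (part nu i))"
    using le by (simp add: of_nat_diff)
  also have "{r..s} = insert s {r..<s}" using rs by auto
  also have "(\<Sum>i\<in>insert s {r..<s}. int (part lam i) - int (part nu i)) = 
    int (part lam s) - int (part nu s) + (\<Sum>i=r..<s. int (part lam i) - int (part nu i))" by simp
  also have "(\<Sum>i=r..<s. int (part lam i) - int (part nu i)) = 
    (\<Sum>i=r..<s. (int i + 1 - int (part lam (Suc i))) - (int i - int (part lam i)))"
    by (intro sum.cong) (use inner[symmetric] in auto)
  also have "\<dots> = (int s - int (part lam s)) - (int r - int (part lam r))"
    using sum_Suc_diff'[of r s "\<lambda>i. int i - int (part lam i)"] rs by (simp add: algebra_simps)
  finally show ?thesis by linarith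
qed

lemma box_adj_commute: "box_adj a b \<longleftrightarrow> box_adj b a"
  by (auto simp: box_adj_def)

text \<open>For connectedness, walk from any box left to the start of its row and then one row down,
  which is possible because the start of the row is the shared column. The walk ends at the first
  box of row \<open>s\<close>.\<close>

lemma strip_shape_border_strip:
  assumes lam: "partition lam" and nu: "partition nu" and p: "p \<ge> 1" and sh: "strip_shape p lam nu r s"
  shows "border_strip p lam nu (s - r)"
proof -
  define S where "S = diagram lam - diagram nu"
  have rs: "r \<le> s" and lt: "part nu s < part lam s"
    and outer: "\<And>i. i < r \<or> s < i \<Longrightarrow> part nu i = part lam i"
    and inner: "\<And>i. r \<le> i \<Longrightarrow> i < s \<Longrightarrow> Suc (part nu i) = part lam (Suc i)"
    and bs: "part lam r + s = part nu s + r + p"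
    using sh by (auto simp: strip_shape_def)
  have row: "part nu i < part lam i" if "r \<le> i" "i \<le> s" for i
    using inner[of i] part_antimono[OF lam, of i "Suc i"] lt that by (cases "i = s") auto
  have le: "part nu i \<le> part lam i" for i
    using outer[of i] row[of i] by (cases "i < r \<or> s < i") (auto intro: less_imp_le)
  have S: "(i, j) \<in> S \<longleftrightarrow> part nu i \<le> j \<and> j < part lam i" for i j
    by (simp add: S_def skew_eq)
  have S_rows: "r \<le> i \<and> i \<le> s" if "(i, j) \<in> S" for i j
    using that outer[of i] by (auto simp: S not_less[symmetric])
  have cardS: "card S = p" using card_skew_strip[OF le rs outer inner] bs by (simp add: S_def)
  have rowsS: "fst ` S = {r..s}"
  proof
    show "fst ` S \<subseteq> {r..s}" using S_rows by auto
    show "{r..s} \<subseteq> fst ` S"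
    proof
      fix i assume "i \<in> {r..s}"
      then have "(i, part nu i) \<in> S" using row[of i] by (simp add: S)
      then show "i \<in> fst ` S" by force
    qed
  qed
  let ?R = "\<lambda>x y. x \<in> S \<and> y \<in> S \<and> box_adj x y"
  have zS: "(s, part nu s) \<in> S" using lt by (simp add: S)
  have conn: "?R\<^sup>*\<^sup>* (i, j) (s, part nu s)" if "(i, j) \<in> S" for i j
    using that
  proof (induction "(s - i) + j" arbitrary: i j rule: less_induct)
    case less
    note ij = S_rows[OF less.prems]
    show ?case
    proof (cases "j = part nu i")
      case False
      then have "(i, j - 1) \<in> S" "j \<ge> 1" using less.prems by (auto simp: S)
      then have "?R (i, j) (i, j - 1)" using less.prems by (auto simp: box_adj_def)
      moreover have "?R\<^sup>*\<^sup>* (i, j - 1) (s, part nu s)"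
        by (rule less.hyps) (use \<open>(i, j - 1) \<in> S\<close> \<open>j \<ge> 1\<close> in auto)
      ultimately show ?thesis by (rule converse_rtranclp_into_rtranclp)
    next
      case True
      show ?thesis
      proof (cases "i = s")
        case False
        then have "(Suc i, j) \<in> S"
          using True ij inner[of i] part_antimono[OF nu, of i "Suc i"] by (auto simp: S)
        then have "?R (i, j) (Suc i, j)" using less.prems by (auto simp: box_adj_def)
        moreover have "?R\<^sup>*\<^sup>* (Suc i, j) (s, part nu s)"
          by (rule less.hyps) (use \<open>(Suc i, j) \<in> S\<close> ij False in auto)
        ultimately show ?thesis by (rule converse_rtranclp_into_rtranclp)
      qed (use True in auto)
    qed
  qed
  have sym: "symp ?R" by (auto intro!: sympI simp: box_adj_commute)
  have "connected_boxes S" unfolding connected_boxes_def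
  proof (intro ballI)
    fix a b assume "a \<in> S" "b \<in> S"
    then have "?R\<^sup>*\<^sup>* a (s, part nu s)" "?R\<^sup>*\<^sup>* b (s, part nu s)"
      using conn[of "fst a" "snd a"] conn[of "fst b" "snd b"] by auto
    then show "?R\<^sup>*\<^sup>* a b"
      using symp_rtranclp[OF sym] by (meson rtranclp_trans sympD)
  qed
  moreover have "no_square S" unfolding no_square_def
  proof (intro notI, elim exE conjE)
    fix i j assume h: "(i, j) \<in> S" "(Suc i, Suc j) \<in> S"
    then have "r \<le> i" "i < s" using S_rows by fastforce+
    from inner[OF this] h show False by (auto simp: S)
  qed
  moreover have "yd_le nu lam" using le by (simp add: yd_le_iff[OF nu])
  ultimately show ?thesis
    unfolding border_strip_def Let_def S_def[symmetric] using nu cardS zS rowsS p rs by auto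
qed

lemma rtranclp_crossing:
  assumes "R\<^sup>*\<^sup>* a b" "\<not> P a" "P b"
  shows "\<exists>x y. R x y \<and> \<not> P x \<and> P y"
  using assms by (induction rule: rtranclp_induct) blast+

text \<open>A path from the top row to the bottom row crosses from row \<open>i\<close> to row
  \<open>i + 1\<close> by a vertical step, so these rows share a column; a second shared column
  would produce a square.\<close>

lemma border_strip_strip_shape:
  assumes lam: "partition lam" and bs: "border_strip p lam nu h"
  shows "\<exists>r s. strip_shape p lam nu r s \<and> h = s - r"
proof -
  define S where "S = diagram lam - diagram nu"
  have nu: "partition nu" and le: "\<And>i. part nu i \<le> part lam i" 
    and cardS: "card S = p" and ne: "S \<noteq> {}" and conn: "connected_boxes S" and sq: "no_square S"
    and h: "h = card (fst ` S) - 1"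
    using bs yd_le_iff by (auto simp: border_strip_def S_def Let_def)
  have S: "(i, j) \<in> S \<longleftrightarrow> part nu i \<le> j \<and> j < part lam i" for i j
    by (simp add: S_def skew_eq)
  have finS: "finite (fst ` S)" by (simp add: S_def)
  define r where "r = Min (fst ` S)"
  define s where "s = Max (fst ` S)"
  have rin: "r \<in> fst ` S" and sin: "s \<in> fst ` S"
    unfolding r_def s_def using finS ne by (auto intro: Min_in Max_in)
  have rows: "r \<le> i \<and> i \<le> s" if "i \<in> fst ` S" for i
    unfolding r_def s_def using finS that by auto
  have row_iff: "i \<in> fst ` S \<longleftrightarrow> part nu i < part lam i" for i
  proof -
    have "i \<in> fst ` S \<longleftrightarrow> (\<exists>j. (i, j) \<in> S)" by force
    also have "\<dots> \<longleftrightarrow> part nu i < part lam i" unfolding S by (meson le_less_trans order_refl)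
    finally show ?thesis .
  qed
  have rs: "r \<le> s" using rows[OF rin] by simp
  have outer: "part nu i = part lam i" if "i < r \<or> s < i" for i
    using rows[of i] row_iff[of i] le[of i] that by force
  have inner: "Suc (part nu i) = part lam (Suc i)" if i: "r \<le> i" "i < s" for i
  proof -
    obtain a b where ab: "a \<in> S" "b \<in> S" "fst a = r" "fst b = s" using rin sin by auto
    then have "(\<lambda>x y. x \<in> S \<and> y \<in> S \<and> box_adj x y)\<^sup>*\<^sup>* a b" using conn by (auto simp: connected_boxes_def)
    from rtranclp_crossing[OF this, of "\<lambda>x. i < fst x"] ab i
    obtain x y where xy: "x \<in> S" "y \<in> S" "box_adj x y" "fst x \<le> i" "i < fst y" by auto
    then have "fst x = i" "fst y = Suc i" "snd x = snd y" by (auto simp: box_adj_def)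
    with xy have ge: "part nu i < part lam (Suc i)" by (cases x; cases y) (auto simp: S)
    have "\<not> Suc (part nu i) < part lam (Suc i)"
    proof
      assume "Suc (part nu i) < part lam (Suc i)"
      then have "(i, part nu i) \<in> S \<and> (Suc i, part nu i) \<in> S \<and> (i, Suc (part nu i)) \<in> S \<and> (Suc i, Suc (part nu i)) \<in> S"
        using part_antimono[OF lam, of i "Suc i"] part_antimono[OF nu, of i "Suc i"] by (auto simp: S)
      with sq show False by (auto simp: no_square_def)
    qed
    with ge show ?thesis by simp
  qed
  have lt: "part nu s < part lam s" using sin row_iff by simp
  have "strip_shape p lam nu r s"
    using rs lt outer inner card_skew_strip[OF le rs outer inner] cardS
    by (auto simp: strip_shape_def S_def)
  moreover have "fst ` S = {r..s}"
  proof
    show "{r..s} \<subseteq> fst ` S"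
    proof
      fix i assume "i \<in> {r..s}"
      then show "i \<in> fst ` S"
        using inner[of i] part_antimono[OF lam, of i "Suc i"] lt unfolding row_iff by (cases "i = s") auto
    qed
  next
    show "fst ` S \<subseteq> {r..s}" using rows by (meson atLeastAtMost_iff subsetI)
  qed
  ultimately show ?thesis using h by (intro exI conjI) auto
qed

text \<open>The charge is left free because three choices occur: the number of beads of a
  determinant, the total charge \<open>C\<close> of a family of runners, and the charge of one
  runner with \<open>p = 1\<close>.\<close>

lemma border_strip_iff_move:
  assumes lam: "partition lam" and p: "p \<ge> 1"
  shows "border_strip p lam nu h \<longleftrightarrow> partition nu \<and> (\<exists>m \<in> movable p (maya_of lam c).
     maya_of nu c = mv p m (maya_of lam c) \<and> h = card {x \<in> maya_of lam c. m - int p < x \<and> x < m})"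
    (is "?L \<longleftrightarrow> ?R")
proof
  assume L: ?L
  then have nu: "partition nu" by (simp add: border_strip_def)
  obtain r s where sh: "strip_shape p lam nu r s" "h = s - r"
    using border_strip_strip_shape[OF lam L] by blast
  show ?R using nu sh(2) strip_shape_move[OF lam nu sh(1), of c] by auto
next
  assume R: ?R
  then obtain m where m: "m \<in> movable p (maya_of lam c)" "maya_of nu c = mv p m (maya_of lam c)"
    "h = card {x \<in> maya_of lam c. m - int p < x \<and> x < m}" and nu: "partition nu" by blast
  obtain nu' r s where nu': "partition nu'" "strip_shape p lam nu' r s" "m = beta lam c r"
    using move_strip_shape[OF lam m(1)] by blast
  note sm = strip_shape_move[OF lam nu'(1,2), of c]
  have "nu = nu'" using sm(2) m(2) nu'(1,3) nu maya_of_inject by metis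
  moreover have "h = s - r" using sm(3) m(3) nu'(3) by simp
  ultimately show ?L using strip_shape_border_strip[OF lam nu'(1) p nu'(2)] by simp
qed

section \<open>Hooks as pairs of beads and gaps\<close>

definition bead_gaps :: "int set \<Rightarrow> (int \<times> int) set" where
  "bead_gaps M = {(m, h). m \<in> M \<and> h \<notin> M \<and> h < m}"

definition hook_prod :: "int set \<Rightarrow> real" where
  "hook_prod M = (\<Prod>(m, h)\<in>bead_gaps M. real_of_int (m - h))"

definition hook_prod_nonp :: "nat \<Rightarrow> int set \<Rightarrow> real" where
  "hook_prod_nonp p M =
    (\<Prod>x\<in>{x \<in> bead_gaps M. \<not> int p dvd fst x - snd x}. real_of_int (fst x - snd x))"

lemma conj_part_eq: "conj_part lam j = card {i. j < part lam i}"
  unfolding conj_part_def by (rule arg_cong[where f = card]) (auto simp: part_def split: if_splits)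

lemma less_conj_part_iff:
  assumes lam: "partition lam"
  shows "i < conj_part lam j \<longleftrightarrow> j < part lam i"
proof -
  define k where "k = (LEAST i. part lam i \<le> j)"
  have "part lam (length lam) \<le> j" by (simp add: part_def)
  then have "part lam k \<le> j" unfolding k_def by (rule LeastI)
  moreover have "j < part lam i" if "i < k" for i
    using not_less_Least[of i "\<lambda>i. part lam i \<le> j"] that by (simp add: k_def)
  ultimately have iff: "j < part lam i \<longleftrightarrow> i < k" for i
    using part_antimono[OF lam, of k i] by (meson leD leI le_trans)
  then have "conj_part lam j = k" unfolding conj_part_eq by (simp add: lessThan_def[symmetric])
  with iff show ?thesis by simp
qed

text \<open>The hole that belongs to column \<open>j\<close>, dual to \<open>beta\<close>: along the
  boundary path of the diagram, rows are beads and columns are gaps.\<close>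

definition gap :: "nat list \<Rightarrow> int \<Rightarrow> nat \<Rightarrow> int" where
  "gap lam c j = int j - int (conj_part lam j) + c"

lemma gap_less_beta_iff:
  assumes "partition lam"
  shows "gap lam c j < beta lam c i \<longleftrightarrow> j < part lam i"
  using less_conj_part_iff[OF assms, of i j] by (auto simp: gap_def beta_def)

lemma gap_notin:
  assumes "partition lam"
  shows "gap lam c j \<notin> maya_of lam c"
proof -
  have "gap lam c j \<noteq> beta lam c i" for i
    using less_conj_part_iff[OF assms, of i j] by (auto simp: gap_def beta_def)
  then show ?thesis by (auto simp: maya_of_eq)
qed

lemma gap_strict_mono:
  assumes lam: "partition lam" and ij: "i < j"
  shows "gap lam c i < gap lam c j"
proof -
  have "k < conj_part lam i" if "k < conj_part lam j" for k
    using that ij less_conj_part_iff[OF lam] by (meson less_trans)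
  then have "conj_part lam j \<le> conj_part lam i" by (meson leI less_irrefl)
  with ij show ?thesis by (simp add: gap_def)
qed

lemma inj_gap: "partition lam \<Longrightarrow> inj (gap lam c)"
  by (rule injI) (metis gap_strict_mono less_irrefl nat_neq_iff)

text \<open>Counting replaces surjectivity: both sides have \<open>part lam i\<close> elements, by
  \<open>holes_below_beta\<close>.\<close>

lemma gaps_below_beta:
  assumes lam: "partition lam"
  shows "gap lam c ` {..<part lam i} = {n. n \<notin> maya_of lam c \<and> n < beta lam c i}"
proof (rule card_subset_eq)
  show "finite {n. n \<notin> maya_of lam c \<and> n < beta lam c i}"
    by (rule mayaset_finite_holes[OF mayaset_maya_of[OF lam]])
  show "gap lam c ` {..<part lam i} \<subseteq> {n. n \<notin> maya_of lam c \<and> n < beta lam c i}"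
    using gap_notin[OF lam] gap_less_beta_iff[OF lam] by auto
  show "card (gap lam c ` {..<part lam i}) = card {n. n \<notin> maya_of lam c \<and> n < beta lam c i}"
    using holes_below_beta[OF lam, of c i] inj_gap[OF lam, of c]
    by (simp add: holes_below_def card_image inj_on_subset)
qed

lemma bij_betw_diagram_bead_gaps:
  assumes lam: "partition lam"
  shows "bij_betw (\<lambda>(i, j). (beta lam c i, gap lam c j)) (diagram lam) (bead_gaps (maya_of lam c))"
proof (rule bij_betw_imageI)
  show "inj_on (\<lambda>(i, j). (beta lam c i, gap lam c j)) (diagram lam)"
    using inj_beta[OF lam, of c] inj_gap[OF lam, of c] by (auto simp: inj_on_def)
  show "(\<lambda>(i, j). (beta lam c i, gap lam c j)) ` diagram lam = bead_gaps (maya_of lam c)"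
  proof
    show "(\<lambda>(i, j). (beta lam c i, gap lam c j)) ` diagram lam \<subseteq> bead_gaps (maya_of lam c)"
      using gap_notin[OF lam, of c] gap_less_beta_iff[OF lam, of c]
      by (auto simp: bead_gaps_def diagram_eq maya_of_eq)
    show "bead_gaps (maya_of lam c) \<subseteq> (\<lambda>(i, j). (beta lam c i, gap lam c j)) ` diagram lam"
    proof
      fix x assume x: "x \<in> bead_gaps (maya_of lam c)"
      then obtain i where i: "fst x = beta lam c i" by (auto simp: bead_gaps_def maya_of_eq)
      with x have "snd x \<in> {n. n \<notin> maya_of lam c \<and> n < beta lam c i}" by (auto simp: bead_gaps_def)
      then obtain j where j: "j < part lam i" "snd x = gap lam c j"
        unfolding gaps_below_beta[OF lam, symmetric] by auto
      have "x = (\<lambda>(i, j). (beta lam c i, gap lam c j)) (i, j)"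
        using i j by (auto simp: prod_eq_iff)
      moreover have "(i, j) \<in> diagram lam" using j by (simp add: diagram_eq)
      ultimately show "x \<in> (\<lambda>(i, j). (beta lam c i, gap lam c j)) ` diagram lam" by blast
    qed
  qed
qed

lemma hook_eq:
  assumes lam: "partition lam" and ij: "(i, j) \<in> diagram lam"
  shows "int (hook lam (i, j)) = beta lam c i - gap lam c j"
proof -
  have j: "j < part lam i" using ij by (simp add: diagram_eq)
  then have "i < conj_part lam j" using less_conj_part_iff[OF lam] by blast
  moreover have "lam ! i = part lam i" using j by (auto simp: part_def split: if_splits)
  ultimately show ?thesis using j by (simp add: hook_def beta_def gap_def)
qed

lemma finite_bead_gaps_maya_of: "partition lam \<Longrightarrow> finite (bead_gaps (maya_of lam c))"
  using bij_betw_finite[OF bij_betw_diagram_bead_gaps] by simp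

lemma finite_bead_gaps: "mayaset M \<Longrightarrow> finite (bead_gaps M)"
  using finite_bead_gaps_maya_of[OF partition_maya_partition, of M] maya_of_maya_partition by metis

lemma psize_eq_card_bead_gaps: "partition lam \<Longrightarrow> psize lam = card (bead_gaps (maya_of lam c))"
  using bij_betw_same_card[OF bij_betw_diagram_bead_gaps] by (simp add: psize_eq_card)

lemma hook_prod_pos: "hook_prod M > 0"
  unfolding hook_prod_def by (rule prod_pos) (auto simp: bead_gaps_def)

lemma H_nonpfold_eq:
  assumes lam: "partition lam"
  shows "H_nonpfold p lam = hook_prod_nonp p (maya_of lam c)"
proof -
  let ?f = "\<lambda>(i, j). (beta lam c i, gap lam c j)"
  have bij: "bij_betw ?f {b \<in> diagram lam. \<not> p dvd hook lam b}
      {x \<in> bead_gaps (maya_of lam c). \<not> int p dvd fst x - snd x}"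
  proof (rule bij_betw_imageI)
    note b = bij_betw_diagram_bead_gaps[OF lam, of c]
    show "inj_on ?f {b \<in> diagram lam. \<not> p dvd hook lam b}"
      using b by (auto simp: bij_betw_def intro: inj_on_subset)
    have "int p dvd fst (?f x) - snd (?f x) \<longleftrightarrow> p dvd hook lam x" if "x \<in> diagram lam" for x
      using hook_eq[OF lam, of "fst x" "snd x" c] that by (cases x) (simp flip: int_dvd_int_iff)
    then show "?f ` {b \<in> diagram lam. \<not> p dvd hook lam b} =
      {x \<in> bead_gaps (maya_of lam c). \<not> int p dvd fst x - snd x}"
      unfolding bij_betw_imp_surj_on[OF b, symmetric] by (auto simp del: split_paired_All split_beta)
  qed
  have "H_nonpfold p lam = (\<Prod>b \<in> {b \<in> diagram lam. \<not> p dvd hook lam b}. 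
      real_of_int (fst (?f b) - snd (?f b)))"
    unfolding H_nonpfold_def
  proof (rule prod.cong[OF HOL.refl])
    fix b assume "b \<in> {b \<in> diagram lam. \<not> p dvd hook lam b}"
    then have "int (hook lam b) = fst (?f b) - snd (?f b)"
      using hook_eq[OF lam, of "fst b" "snd b" c] by (cases b) simp
    then show "real (hook lam b) = real_of_int (fst (?f b) - snd (?f b))"
      by (metis of_int_of_nat_eq)
  qed
  also have "\<dots> = (\<Prod>x\<in>{x \<in> bead_gaps (maya_of lam c). \<not> int p dvd fst x - snd x}. real_of_int (fst x - snd x))"
    by (rule prod.reindex_bij_betw[OF bij])
  finally show ?thesis by (simp add: hook_prod_nonp_def)
qed

section \<open>Splitting a bead set into its \<open>p\<close> runners\<close>

lemma bij_betw_residues: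
  assumes "p \<ge> 1"
  shows "bij_betw (\<lambda>(i, m). int p * m + int i) (Sigma {..<p} (maya_comp p X)) X"
proof (rule bij_betwI[where g = "\<lambda>n. (nat (n mod int p), n div int p)"])
  show "(\<lambda>(i, m). int p * m + int i) \<in> Sigma {..<p} (maya_comp p X) \<rightarrow> X"
    by (auto simp: maya_comp_def)
  show "(\<lambda>n. (nat (n mod int p), n div int p)) \<in> X \<rightarrow> Sigma {..<p} (maya_comp p X)"
    using assms by (auto simp: maya_comp_def nat_less_iff)
qed (use assms in \<open>auto simp: maya_comp_def\<close>)

lemma card_residues:
  assumes "p \<ge> 1" "finite X"
  shows "card X = (\<Sum>i<p. card (maya_comp p X i))"
proof -
  note b = bij_betw_residues[OF assms(1), of X]
  have "finite (Sigma {..<p} (maya_comp p X))" using bij_betw_finite[OF b] assms by simp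
  moreover have "finite (maya_comp p X i)" if "i < p" for i
  proof -
    have "maya_comp p X i = snd ` (Sigma {..<p} (maya_comp p X) \<inter> {i} \<times> UNIV)"
      using that by force
    then show ?thesis using calculation by (metis finite_Int finite_imageI)
  qed
  ultimately show ?thesis using bij_betw_same_card[OF b] by (simp add: card_SigmaI)
qed

definition combine :: "nat \<Rightarrow> (nat \<Rightarrow> int set) \<Rightarrow> int set" where
  "combine p N = {int p * m + int i | i m. i < p \<and> m \<in> N i}"

lemma residue_unique:
  assumes "int p * m + int i = int p * m' + int i'" "i < p" "i' < p"
  shows "m = m' \<and> i = i'"
proof -
  have "int i = (int p * m + int i) mod int p" using assms(2) by simp
  also have "\<dots> = int i'" unfolding assms(1) using assms(3) by simp
  finally have "i = i'" by simp
  then show ?thesis using assms by auto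
qed

lemma maya_comp_combine [simp]: "i < p \<Longrightarrow> maya_comp p (combine p N) i = N i"
  using residue_unique by (fastforce simp: maya_comp_def combine_def)

lemma ex_residue: "p \<ge> 1 \<Longrightarrow> \<exists>i m. i < p \<and> (n::int) = int p * m + int i"
  by (intro exI[of _ "nat (n mod int p)"] exI[of _ "n div int p"]) (auto simp: nat_less_iff)

lemma maya_comp_eqI:
  assumes "p \<ge> 1" "\<And>i. i < p \<Longrightarrow> maya_comp p X i = maya_comp p Y i"
  shows "X = Y"
proof (rule Set.set_eqI)
  fix n
  obtain i m where im: "i < p" "n = int p * m + int i" using ex_residue[OF assms(1)] by blast
  have "m \<in> maya_comp p X i \<longleftrightarrow> m \<in> maya_comp p Y i" using assms(2) im by simp
  then show "n \<in> X \<longleftrightarrow> n \<in> Y" using im by (simp add: maya_comp_def)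
qed

lemma mayaset_maya_comp:
  assumes p: "p \<ge> 1" and M: "mayaset M"
  shows "mayaset (maya_comp p M i)"
proof -
  obtain a b where ab: "{..<a} \<subseteq> M" "M \<subseteq> {..b}" using M by (auto simp: mayaset_def)
  have "m \<in> maya_comp p M i" if "m < - \<bar>a\<bar> - int i" for m
  proof -
    have "int p * m \<le> 1 * m" using that p by (intro mult_right_mono_neg) auto
    then have "int p * m + int i < a" using that by linarith
    then show ?thesis using ab by (auto simp: maya_comp_def)
  qed
  moreover have "m \<le> \<bar>b\<bar>" if "m \<in> maya_comp p M i" for m
  proof (cases "m \<ge> 0")
    case True
    then have "1 * m \<le> int p * m" using p by (intro mult_right_mono) auto
    moreover have "int p * m + int i \<le> b" using that ab by (auto simp: maya_comp_def)
    ultimately show ?thesis by linarith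
  qed auto
  ultimately show ?thesis unfolding mayaset_def by (meson atMost_iff lessThan_iff subsetI)
qed

lemma mayaset_combine:
  assumes p: "p \<ge> 1" and N: "\<And>i. i < p \<Longrightarrow> mayaset (N i)"
  shows "mayaset (combine p N)"
proof -
  have "\<forall>i. \<exists>a b. i < p \<longrightarrow> {..<a} \<subseteq> N i \<and> N i \<subseteq> {..b}" using N by (auto simp: mayaset_def)
  then obtain a b where ab: "\<And>i. i < p \<Longrightarrow> {..<a i} \<subseteq> N i \<and> N i \<subseteq> {..b i}" by metis
  define a0 where "a0 = Min (a ` {..<p})"
  define b0 where "b0 = Max (b ` {..<p})"
  have a0: "a0 \<le> a i" and b0: "b i \<le> b0" if "i < p" for i using that by (auto simp: a0_def b0_def)
  have "n \<in> combine p N" if "n < int p * a0" for n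
  proof -
    obtain i m where im: "i < p" "n = int p * m + int i" using ex_residue[OF p] by blast
    with that have "int p * m < int p * a0" by linarith
    then have "m < a0" using p by (simp add: mult_less_cancel_left_pos)
    then have "m \<in> N i" using ab[OF im(1)] a0[OF im(1)] by (auto simp: subset_iff)
    then show ?thesis using im by (auto simp: combine_def)
  qed
  moreover have "n \<le> int p * b0 + int p" if "n \<in> combine p N" for n
  proof -
    obtain i m where im: "i < p" "n = int p * m + int i" "m \<in> N i" using \<open>n \<in> combine p N\<close> by (auto simp: combine_def)
    then have "m \<le> b0" using ab[OF im(1)] b0[OF im(1)] by fastforce
    then have "int p * m \<le> int p * b0" by (intro mult_left_mono) auto
    then show ?thesis using im by linarith
  qed
  ultimately show ?thesis unfolding mayaset_def by (meson atMost_iff lessThan_iff subsetI)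
qed

text \<open>For \<open>i < p\<close> the place \<open>p m + i\<close> is nonnegative exactly when
  \<open>m\<close> is, so both counts in the charge split over the runners.\<close>

lemma charge_residues:
  assumes p: "p \<ge> 1" and M: "mayaset M"
  shows "charge M = (\<Sum>i<p. charge (maya_comp p M i))"
proof -
  have nonneg: "int p * m + int i \<ge> 0 \<longleftrightarrow> m \<ge> 0" if "i < p" for m i
  proof (cases "m \<ge> 0")
    case False
    then have "int p * m \<le> int p * (-1)" by (intro mult_left_mono) auto
    with False that show ?thesis by auto
  qed auto
  have "card {n \<in> M. n \<ge> 0} = (\<Sum>i<p. card (maya_comp p {n \<in> M. n \<ge> 0} i))"
    by (rule card_residues[OF p]) (use mayaset_finite_above[OF M, of 0] in \<open>simp add: Int_def atLeast_def\<close>)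
  moreover have "card {n. n \<notin> M \<and> n < 0} = (\<Sum>i<p. card (maya_comp p {n. n \<notin> M \<and> n < 0} i))"
    by (rule card_residues[OF p]) (rule mayaset_finite_holes[OF M])
  moreover have "maya_comp p {n \<in> M. n \<ge> 0} i = {m \<in> maya_comp p M i. m \<ge> 0}"
    "maya_comp p {n. n \<notin> M \<and> n < 0} i = {m. m \<notin> maya_comp p M i \<and> m < 0}" if "i < p" for i
    using nonneg[OF that] by (auto simp: maya_comp_def not_le[symmetric])
  ultimately show ?thesis by (simp add: charge_def sum_subtractf)
qed

lemma movable_residue: "int p * a + int i \<in> movable p M \<longleftrightarrow> a \<in> movable 1 (maya_comp p M i)"
  by (simp add: movable_def maya_comp_def algebra_simps)

lemma maya_comp_mv:
  assumes "i < p" "k < p"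
  shows "maya_comp p (mv p (int p * a + int i) M) k =
    (if k = i then mv 1 a (maya_comp p M i) else maya_comp p M k)"
proof -
  have 1: "int p * x + int k = int p * a + int i \<longleftrightarrow> x = a \<and> k = i" for x
    using residue_unique[of p x k a i] assms by auto
  have 2: "int p * x + int k = int p * a + int i - int p \<longleftrightarrow> x = a - 1 \<and> k = i" for x
    using residue_unique[of p x k "a - 1" i] assms by (auto simp: algebra_simps)
  show ?thesis by (auto simp: maya_comp_def mv_def 1 2)
qed

text \<open>A bead and a gap at a distance divisible by \<open>p\<close> lie on the same runner,
  where their distance is divided by \<open>p\<close>. So the hook lengths divisible by
  \<open>p\<close> are \<open>p\<close> times the hook lengths of the quotient.\<close>

lemma hook_prod_residues:
  assumes p: "p \<ge> 1" and M: "mayaset M"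
  shows "hook_prod M = hook_prod_nonp p M *
    (\<Prod>i<p. real p ^ card (bead_gaps (maya_comp p M i)) * hook_prod (maya_comp p M i))"
proof -
  let ?g = "\<lambda>x::int\<times>int. real_of_int (fst x - snd x)"
  let ?A = "{x\<in>bead_gaps M. \<not> int p dvd fst x - snd x}" and ?B = "{x\<in>bead_gaps M. int p dvd fst x - snd x}"
  have fin: "finite (bead_gaps M)" by (rule finite_bead_gaps[OF M])
  have "hook_prod M = prod ?g (?A \<union> ?B)"
    by (simp add: hook_prod_def case_prod_beta) (rule prod.cong, auto)
  also have "\<dots> = prod ?g ?A * prod ?g ?B"
    by (rule prod.union_disjoint) (use fin in auto)
  also have "prod ?g ?B = (\<Prod>(i, x)\<in>Sigma {..<p} (\<lambda>i. bead_gaps (maya_comp p M i)). real p * ?g x)"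
  proof -
    let ?f = "\<lambda>(i, x). (int p * fst x + int i, int p * snd x + int i)"
    have bij: "bij_betw ?f (Sigma {..<p} (\<lambda>i. bead_gaps (maya_comp p M i))) ?B"
    proof (rule bij_betwI[where g = "\<lambda>x. (nat (fst x mod int p), (fst x div int p, snd x div int p))"])
      show "?f \<in> Sigma {..<p} (\<lambda>i. bead_gaps (maya_comp p M i)) \<rightarrow> ?B"
        using p by (auto simp: bead_gaps_def maya_comp_def algebra_simps simp flip: right_diff_distrib)
    next
      show "(\<lambda>x. (nat (fst x mod int p), (fst x div int p, snd x div int p))) \<in> ?B \<rightarrow>
        Sigma {..<p} (\<lambda>i. bead_gaps (maya_comp p M i))"
      proof
        fix x assume x: "x \<in> ?B"
        then have mod: "fst x mod int p = snd x mod int p" by (simp add: mod_eq_dvd_iff)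
        have "fst x div int p > snd x div int p"
        proof -
          have "int p * (fst x div int p) + fst x mod int p > int p * (snd x div int p) + snd x mod int p"
            using x by (simp add: bead_gaps_def case_prod_beta)
          then have "int p * (fst x div int p) > int p * (snd x div int p)" using mod by linarith
          then show ?thesis using p by (simp add: mult_less_cancel_left_pos)
        qed
        moreover have "int p * (fst x div int p) + fst x mod int p = fst x"
          "int p * (snd x div int p) + fst x mod int p = snd x" by simp (simp add: mod)
        ultimately show "(nat (fst x mod int p), (fst x div int p, snd x div int p)) \<in>
          Sigma {..<p} (\<lambda>i. bead_gaps (maya_comp p M i))"
          using x p by (auto simp: bead_gaps_def maya_comp_def nat_less_iff case_prod_beta)
      qed
    next
      fix x assume "x \<in> ?B"
      then have mod: "fst x mod int p = snd x mod int p" by (simp add: mod_eq_dvd_iff)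
      then show "?f (nat (fst x mod int p), (fst x div int p, snd x div int p)) = x"
        using p by (simp add: prod_eq_iff) (metis mod mult_div_mod_eq)
    qed (use p in auto)
    have "prod ?g ?B = (\<Prod>y\<in>Sigma {..<p} (\<lambda>i. bead_gaps (maya_comp p M i)). ?g (?f y))"
      by (rule prod.reindex_bij_betw[OF bij, symmetric])
    also have "\<dots> = (\<Prod>(i, x)\<in>Sigma {..<p} (\<lambda>i. bead_gaps (maya_comp p M i)). real p * ?g x)"
      by (rule prod.cong) (auto simp: algebra_simps)
    finally show ?thesis .
  qed
  also have "\<dots> = (\<Prod>i<p. \<Prod>x\<in>bead_gaps (maya_comp p M i). real p * ?g x)"
    by (rule prod.Sigma[symmetric]) (use finite_bead_gaps[OF mayaset_maya_comp[OF p M]] in auto)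
  also have "\<dots> = (\<Prod>i<p. real p ^ card (bead_gaps (maya_comp p M i)) * hook_prod (maya_comp p M i))"
    by (simp add: prod.distrib hook_prod_def case_prod_beta)
  finally show ?thesis by (simp add: hook_prod_nonp_def)
qed

section \<open>Determinants\<close>

text \<open>Rows will be degrees and columns derivative orders. This is the transpose of
  \<open>wronskian\<close>; it makes a bead move a change of one row.\<close>

abbreviation det_fun :: "nat \<Rightarrow> (nat \<Rightarrow> nat \<Rightarrow> 'a :: comm_ring_1) \<Rightarrow> 'a" where
  "det_fun l A \<equiv> det (mat l l (\<lambda>(j, i). A j i))"

lemma det_fun_def:
  "det_fun l A = (\<Sum>\<sigma> | \<sigma> permutes {0..<l}. signof \<sigma> * (\<Prod>j<l. A j (\<sigma> j)))"
proof -
  have "det_fun l A = (\<Sum>\<sigma> | \<sigma> permutes {0..<l}. signof \<sigma> *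
      (\<Prod>j=0..<l. mat l l (\<lambda>(j, i). A j i) $$ (j, \<sigma> j)))"
    by (rule det_def') simp
  also have "\<dots> = (\<Sum>\<sigma> | \<sigma> permutes {0..<l}. signof \<sigma> * (\<Prod>j<l. A j (\<sigma> j)))"
  proof (intro sum.cong HOL.refl arg_cong2[where f = "(*)"])
    fix \<sigma> assume "\<sigma> \<in> {\<sigma>. \<sigma> permutes {0..<l}}"
    then have "\<sigma> j < l" if "j < l" for j using permutes_in_image[of \<sigma> "{0..<l}" j] that by auto
    then show "(\<Prod>j=0..<l. mat l l (\<lambda>(j, i). A j i) $$ (j, \<sigma> j)) = (\<Prod>j<l. A j (\<sigma> j))"
      unfolding lessThan_atLeast0 by (intro prod.cong) auto
  qed
  finally show ?thesis .
qed

lemma prod_replace_row: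
  fixes A :: "nat \<Rightarrow> nat \<Rightarrow> 'a :: comm_ring_1"
  assumes "k < l"
  shows "(\<Prod>j<l. (if j = k then B j (\<sigma> j) else A j (\<sigma> j))) = B k (\<sigma> k) * (\<Prod>j\<in>{..<l} - {k}. A j (\<sigma> j))"
  using assms by (subst prod.remove[of _ k]) (auto intro: prod.cong)

lemma det_fun_replace_row_add:
  assumes "k < l"
  shows "det_fun l (\<lambda>j i. if j = k then B j i + C j i else A j i) =
    det_fun l (\<lambda>j i. if j = k then B j i else A j i) + det_fun l (\<lambda>j i. if j = k then C j i else A j i)"
  unfolding det_fun_def
    prod_replace_row[OF assms, where B = "\<lambda>j i. B j i + C j i"]
    prod_replace_row[OF assms, where B = B] prod_replace_row[OF assms, where B = C]
  by (simp add: algebra_simps sum.distrib)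

text \<open>In the Leibniz expansion the weights belonging to one permutation add up to the sum of
  the \<open>x j\<close> minus the sum of the \<open>y i\<close>, whatever the permutation. With
  \<open>x j = n j\<close> and \<open>y i = i\<close> this is how the Euler operator produces the
  degree.\<close>

lemma det_fun_row_weights:
  "(\<Sum>k<l. det_fun l (\<lambda>j i. if j = k then (x j - y i) * A j i else A j i)) =
    ((\<Sum>j<l. x j) - (\<Sum>i<l. y i)) * det_fun l A"
proof -
  have "(\<Sum>k<l. det_fun l (\<lambda>j i. if j = k then (x j - y i) * A j i else A j i)) =
    (\<Sum>k<l. \<Sum>\<sigma> | \<sigma> permutes {0..<l}. signof \<sigma> * ((x k - y (\<sigma> k)) * (\<Prod>j<l. A j (\<sigma> j))))"
  proof (intro sum.cong HOL.refl)
    fix k assume k: "k \<in> {..<l}"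
    show "det_fun l (\<lambda>j i. if j = k then (x j - y i) * A j i else A j i) = 
      (\<Sum>\<sigma> | \<sigma> permutes {0..<l}. signof \<sigma> * ((x k - y (\<sigma> k)) * (\<Prod>j<l. A j (\<sigma> j))))"
      unfolding det_fun_def using k 
      by (intro sum.cong HOL.refl arg_cong2[where f = "(*)"], subst prod_replace_row)
         (auto simp: prod.remove[of "{..<l}" k] mult.assoc)
  qed
  also have "\<dots> = (\<Sum>\<sigma> | \<sigma> permutes {0..<l}. \<Sum>k<l. signof \<sigma> * ((x k - y (\<sigma> k)) * (\<Prod>j<l. A j (\<sigma> j))))"
    by (rule sum.swap)
  also have "\<dots> = (\<Sum>\<sigma> | \<sigma> permutes {0..<l}. ((\<Sum>j<l. x j) - (\<Sum>i<l. y i)) * (signof \<sigma> * (\<Prod>j<l. A j (\<sigma> j))))"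
  proof (intro sum.cong HOL.refl)
    fix \<sigma> assume "\<sigma> \<in> {\<sigma>. \<sigma> permutes {0..<l}}"
    then have "(\<Sum>k<l. y (\<sigma> k)) = (\<Sum>i<l. y i)"
      using sum.permute[of \<sigma> "{0..<l}" y] by (simp add: lessThan_atLeast0 o_def)
    then have "(\<Sum>k<l. x k - y (\<sigma> k)) = (\<Sum>j<l. x j) - (\<Sum>i<l. y i)" by (simp add: sum_subtractf)
    then show "(\<Sum>k<l. signof \<sigma> * ((x k - y (\<sigma> k)) * (\<Prod>j<l. A j (\<sigma> j)))) =
      ((\<Sum>j<l. x j) - (\<Sum>i<l. y i)) * (signof \<sigma> * (\<Prod>j<l. A j (\<sigma> j)))"
      by (simp flip: sum_distrib_left sum_distrib_right)
  qed
  also have "\<dots> = ((\<Sum>j<l. x j) - (\<Sum>i<l. y i)) * det_fun l A"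
    by (simp add: det_fun_def sum_distrib_left)
  finally show ?thesis .
qed

lemma pderiv_sum: "pderiv (\<Sum>x\<in>A. f x) = (\<Sum>x\<in>A. pderiv (f x))"
  by (induction A rule: infinite_finite_induct) (auto simp: pderiv_add)

lemma pderiv_det_fun:
  fixes A :: "nat \<Rightarrow> nat \<Rightarrow> 'a :: idom poly"
  shows "c * pderiv (det_fun l A) =
    (\<Sum>k<l. det_fun l (\<lambda>j i. if j = k then c * pderiv (A j i) else A j i))"
proof -
  have s0: "pderiv (signof \<sigma> :: 'a poly) = 0" for \<sigma> :: "nat \<Rightarrow> nat"
    by (cases \<sigma> rule: sign_cases) (simp_all add: pderiv_minus)
  have "c * pderiv (det_fun l A) = (\<Sum>\<sigma> | \<sigma> permutes {0..<l}. \<Sum>k<l.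
      signof \<sigma> * (c * pderiv (A k (\<sigma> k)) * (\<Prod>j\<in>{..<l} - {k}. A j (\<sigma> j))))"
    unfolding det_fun_def by (simp add: pderiv_sum pderiv_mult s0 pderiv_prod sum_distrib_left mult_ac)
  also have "\<dots> = (\<Sum>k<l. \<Sum>\<sigma> | \<sigma> permutes {0..<l}.
      signof \<sigma> * (c * pderiv (A k (\<sigma> k)) * (\<Prod>j\<in>{..<l} - {k}. A j (\<sigma> j))))"
    by (rule sum.swap)
  also have "\<dots> = (\<Sum>k<l. det_fun l (\<lambda>j i. if j = k then c * pderiv (A j i) else A j i))"
    unfolding det_fun_def
    by (intro sum.cong HOL.refl arg_cong2[where f = "(*)"]) 
       (simp add: prod_replace_row[where B = "\<lambda>j i. c * pderiv (A j i)"])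
  finally show ?thesis .
qed

lemma det_fun_scale_rows: "det_fun l (\<lambda>j i. c j * A j i) = (\<Prod>j<l. c j) * det_fun l A"
  unfolding det_fun_def by (simp add: prod.distrib sum_distrib_left mult_ac)

lemma det_fun_permute_rows:
  assumes "\<pi> permutes {0..<l}"
  shows "det_fun l (\<lambda>j. A (\<pi> j)) = signof \<pi> * det_fun l A"
proof -
  have "mat l l (\<lambda>(j, i). A (\<pi> j) i) = mat l l (\<lambda>(j, i). mat l l (\<lambda>(j, i). A j i) $$ (\<pi> j, i))"
    using permutes_in_image[OF assms] by (intro eq_matI) auto
  then show ?thesis using det_permute_rows[of "mat l l (\<lambda>(j, i). A j i)" l \<pi>] assms by simp
qed

lemma det_fun_identical_rows:
  assumes "a < l" "b < l" "a \<noteq> b" "\<And>i. A a i = A b i"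
  shows "det_fun l A = 0"
  by (rule det_identical_rows[of _ l a b]) (use assms in \<open>auto intro!: eq_vecI\<close>)

lemma det_fun_zero_row:
  assumes "a < l" "\<And>i. A a i = 0"
  shows "det_fun l A = 0"
proof -
  have "(\<Prod>j<l. A j (\<sigma> j)) = 0" for \<sigma> using assms by (intro prod_zero) auto
  then show ?thesis unfolding det_fun_def by simp
qed

text \<open>As functions of the last node, both sides are polynomials of degree at most
  \<open>l\<close> with the same coefficient at \<open>l\<close> and the same zeros at the other
  \<open>l\<close> nodes. General monic \<open>P i\<close> are allowed because falling factorials
  will be inserted.\<close>

lemma det_fun_vandermonde:
  fixes x :: "nat \<Rightarrow> 'a :: idom"
  assumes P: "\<And>i. degree (P i) = i" "\<And>i. lead_coeff (P i) = 1"
    and inj: "inj_on x {..<l}"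
  shows "det_fun l (\<lambda>j i. poly (P i) (x j)) = (\<Prod>i<l. \<Prod>j\<in>{i<..<l}. x j - x i)"
  using inj
proof (induction l)
  case 0
  show ?case by (simp add: det_fun_def permutes_empty)
next
  case (Suc l)
  define A where "A X = mat (Suc l) (Suc l) (\<lambda>(j, i). poly (P i) (if j = l then X else x j))" for X
  define D where "D = (\<Prod>i<l. \<Prod>j\<in>{i<..<l}. x j - x i)"
  have IH: "det_fun l (\<lambda>j i. poly (P i) (x j)) = D"
    unfolding D_def using Suc by (simp add: lessThan_Suc)
  \<comment> \<open>The cofactors along the last row involve only the other nodes, so
    \<open>det (A X)\<close> is a fixed linear combination of the \<open>P i\<close> at
    \<open>X\<close>.\<close>
  have del: "mat_delete (A X) l i = mat_delete (A 0) l i" if "i < Suc l" for X i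
    using that by (intro eq_matI) (auto simp: mat_delete_def A_def)
  have del': "mat_delete (A 0) l l = mat l l (\<lambda>(j, i). poly (P i) (x j))"
    by (intro eq_matI) (auto simp: mat_delete_def A_def)
  define F where "F = (\<Sum>i<Suc l. smult (cofactor (A 0) l i) (P i))"
  have AF: "det (A X) = poly F X" for X
  proof -
    have "det (A X) = (\<Sum>i<Suc l. A X $$ (l, i) * cofactor (A X) l i)"
      by (rule laplace_expansion_row) (auto simp: A_def)
    also have "\<dots> = (\<Sum>i<Suc l. poly (smult (cofactor (A 0) l i) (P i)) X)"
    proof (intro sum.cong HOL.refl)
      fix i assume i: "i \<in> {..<Suc l}"
      then have "cofactor (A X) l i = cofactor (A 0) l i"
        unfolding cofactor_def using del[of i X] by simp
      moreover have "A X $$ (l, i) = poly (P i) X" using i by (simp add: A_def)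
      ultimately show "A X $$ (l, i) * cofactor (A X) l i = poly (smult (cofactor (A 0) l i) (P i)) X"
        by simp
    qed
    finally show ?thesis by (simp add: F_def poly_sum)
  qed
  define G where "G = smult D (\<Prod>j<l. [:- x j, 1:])"
  have degprod: "degree (\<Prod>j<l. [:- x j, 1:]) = l"
    by (subst degree_prod_eq_sum_degree) auto
  have "F = G"
  proof (rule poly_eqI_degree_lead_coeff[where n = l and A = "x ` {..<l}"])
    have "coeff (\<Prod>j<l. [:- x j, 1:]) l = 1"
      using lead_coeff_prod[of "\<lambda>j. [:- x j, 1:]" "{..<l}"] degprod by simp
    moreover have "coeff F l = cofactor (A 0) l l"
    proof -
      have "coeff F l = (\<Sum>i<Suc l. cofactor (A 0) l i * coeff (P i) l)" by (simp add: F_def coeff_sum)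
      also have "\<dots> = cofactor (A 0) l l * coeff (P l) l"
        using P by (simp add: lessThan_Suc coeff_eq_0)
      finally show ?thesis using P[of l] by simp
    qed
    moreover have "cofactor (A 0) l l = D" by (simp add: cofactor_def del' IH)
    ultimately show "coeff F l = coeff G l" by (simp add: G_def)
    show "card (x ` {..<l}) \<ge> l"
      using Suc.prems by (subst card_image) (auto intro: inj_on_subset)
    show "degree F \<le> l" unfolding F_def
      by (intro degree_sum_le) (auto intro: order_trans[OF degree_smult_le] simp: P)
    show "degree G \<le> l" unfolding G_def using degprod degree_smult_le by metis
    fix z assume "z \<in> x ` {..<l}"
    then obtain j where j: "j < l" "z = x j" by auto
    have "det (A z) = 0" unfolding A_def
      by (rule det_fun_identical_rows[of j _ l]) (use j in auto)
    moreover have "poly G z = 0" using j by (auto simp: G_def poly_prod)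
    ultimately show "poly F z = poly G z" using AF by simp
  qed
  have "det_fun (Suc l) (\<lambda>j i. poly (P i) (x j)) = det (A (x l))"
    unfolding A_def by (intro arg_cong[where f = det] eq_matI) auto
  also have "\<dots> = D * (\<Prod>i<l. x l - x i)" unfolding AF \<open>F = G\<close> by (simp add: G_def poly_prod)
  also have "\<dots> = (\<Prod>i<l. (\<Prod>j\<in>{i<..<l}. x j - x i) * (x l - x i))"
    by (simp add: D_def prod.distrib)
  also have "\<dots> = (\<Prod>i<l. \<Prod>j\<in>{i<..<Suc l}. x j - x i)"
  proof (intro prod.cong HOL.refl)
    fix i assume "i \<in> {..<l}"
    then have "{i<..<Suc l} = insert l {i<..<l}" by auto
    then show "(\<Prod>j\<in>{i<..<l}. x j - x i) * (x l - x i) = (\<Prod>j\<in>{i<..<Suc l}. x j - x i)"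
      by (simp add: mult.commute)
  qed
  also have "\<dots> = (\<Prod>i<Suc l. \<Prod>j\<in>{i<..<Suc l}. x j - x i)"
  proof -
    have "{l<..<Suc l} = {}" by auto
    then show ?thesis by (simp add: lessThan_Suc del: prod_zero_iff)
  qed
  finally show ?case .
qed

section \<open>The polynomials \<open>q_n / n!\<close> for integer index\<close>

definition inv_fact :: "int \<Rightarrow> real" where
  "inv_fact k = (if k < 0 then 0 else 1 / fact (nat k))"

text \<open>Being zero at negative arguments is what makes the inverse factorial satisfy this at
  \<open>k = 0\<close> and below.\<close>

lemma inv_fact_rec: "of_int k * inv_fact k = inv_fact (k - 1)"
proof (cases "k > 0")
  case True
  then have "nat k = Suc (nat (k - 1))" by simp
  then show ?thesis using True by (simp add: inv_fact_def)
qed (auto simp: inv_fact_def)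

text \<open>The \<open>u\<close> of the overview; its leading coefficient is \<open>1 / n!\<close>.
  Extending it by zero to negative \<open>n\<close> makes the derivative rule and the Euler identity
  hold for all integers, so matrix entries with \<open>n j < i\<close> need no separate
  treatment.\<close>

definition q_monic :: "nat \<Rightarrow> int \<Rightarrow> real poly" where
  "q_monic p n = (if n < 0 then 0 else \<Sum>d\<le>nat n. monom
     (if p dvd nat n - d then (- 1 / real p) ^ ((nat n - d) div p) / fact ((nat n - d) div p) / fact d else 0) d)"

lemma coeff_q_monic:
  "coeff (q_monic p n) d = (if int d \<le> n \<and> p dvd nat (n - int d) then
     (- 1 / real p) ^ (nat (n - int d) div p) / fact (nat (n - int d) div p) / fact d else 0)"
proof (cases "n < 0")
  case False
  then have "nat n - d = nat (n - int d)" by simp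
  then show ?thesis using False
    by (auto simp: q_monic_def coeff_sum le_nat_iff)
qed (auto simp: q_monic_def)

lemma pderiv_q_monic: "pderiv (q_monic p n) = q_monic p (n - 1)"
proof (rule poly_eqI)
  fix d
  have n: "n - 1 - int d = n - int (Suc d)" "int d \<le> n - 1 \<longleftrightarrow> int (Suc d) \<le> n" by auto
  have "real (Suc d) * (x / fact (Suc d)) = x / fact d" for x :: real by simp
  then show "coeff (pderiv (q_monic p n)) d = coeff (q_monic p (n - 1)) d"
    unfolding coeff_pderiv coeff_q_monic n
    by (cases "int (Suc d) \<le> n \<and> p dvd nat (n - int (Suc d))") (simp_all only: simp_thms if_True if_False mult_zero_right)
qed

lemma funpow_pderiv_q_monic: "(pderiv ^^ i) (q_monic p n) = q_monic p (n - int i)"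
  by (induction i) (auto simp: pderiv_q_monic algebra_simps)

lemma coeff_q_monic_add:
  assumes "p \<ge> 1"
  shows "coeff (q_monic p (int d + int (p * k))) d = (- 1 / real p) ^ k / fact k / fact d"
proof -
  have "nat (int d + int (p * k) - int d) = p * k" by linarith
  moreover have "int d \<le> int d + int (p * k)" by linarith
  ultimately show ?thesis unfolding coeff_q_monic using assms by simp
qed

text \<open>The coefficient at \<open>x^d\<close> with \<open>n = d + p k\<close> is multiplied by
  \<open>d = n - p k\<close>. The part \<open>- p k\<close> turns the factor
  \<open>(-1/p)^k / k!\<close> into the one for \<open>k - 1\<close>, which is the coefficient for
  the index \<open>n - p\<close>.\<close>

lemma euler_q_monic:
  assumes p: "p \<ge> 1"
  shows "[:0, 1:] * pderiv (q_monic p n) = of_int n * q_monic p n + q_monic p (n - int p)"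
proof (rule poly_eqI)
  fix d
  have l: "coeff ([:0, 1:] * pderiv (q_monic p n)) d = real d * coeff (q_monic p n) d"
    by (cases d) (auto simp: coeff_pderiv coeff_pCons)
  have r: "coeff (of_int n * q_monic p n + q_monic p (n - int p)) d = 
    of_int n * coeff (q_monic p n) d + coeff (q_monic p (n - int p)) d"
    by (simp add: of_int_poly)
  show "coeff ([:0, 1:] * pderiv (q_monic p n)) d = coeff (of_int n * q_monic p n + q_monic p (n - int p)) d"
  proof (cases "int d \<le> n \<and> p dvd nat (n - int d)")
    case True
    then obtain k where "nat (n - int d) = p * k" by auto
    then have n: "n = int d + int (p * k)" using True by linarith
    show ?thesis
    proof (cases k)
      case 0
      then show ?thesis unfolding l r unfolding n using p by (simp add: coeff_q_monic)
    next
      case (Suc k')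
      have "n - int p = int d + int (p * k')" using Suc n by (simp add: algebra_simps)
      have "real p * real k * ((- 1 / real p) ^ k / fact k) = - ((- 1 / real p) ^ k' / fact k')"
      proof -
        have "real p * real (Suc k') * (E * (- 1 / real p) / (real (Suc k') * fact k')) = - (E / fact k')" for E
          using p by (simp add: field_simps del: of_nat_Suc)
        then show ?thesis unfolding Suc power_Suc2 fact_Suc of_nat_mult .
      qed
      then have "real p * real k * ((- 1 / real p) ^ k / fact k / fact d) = - ((- 1 / real p) ^ k' / fact k' / fact d)"
        by (simp only: times_divide_eq_right divide_minus_left[symmetric])
      then show ?thesis unfolding l r unfolding \<open>n - int p = _\<close> unfolding n
        unfolding coeff_q_monic_add[OF p] by (simp add: algebra_simps add_divide_distrib)
    qed
  next
    case False
    have False': "\<not> (int d \<le> n - int p \<and> p dvd nat (n - int p - int d))"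
    proof
      assume h: "int d \<le> n - int p \<and> p dvd nat (n - int p - int d)"
      then have "int d \<le> n - int p" by blast
      then have "nat (n - int d) = nat (n - int p - int d) + p" by linarith
      then show False using h False by auto
    qed
    show ?thesis unfolding l r coeff_q_monic if_not_P[OF False] if_not_P[OF False'] by simp
  qed
qed

lemma degree_q_monic: "n \<ge> 0 \<Longrightarrow> degree (q_monic p n) \<le> nat n"
  by (rule degree_le) (auto simp: coeff_q_monic)

lemma coeff_q_monic_top: "n \<ge> 0 \<Longrightarrow> coeff (q_monic p n) (nat n) = inv_fact n"
  by (auto simp: coeff_q_monic inv_fact_def)

lemma qn_eq_poly:
  assumes p: "p \<ge> 1"
  shows "qn p n x = poly (smult (fact n) (q_monic p (int n))) x"
proof -
  define e where "e = - 1 / real p"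
  let ?E = "fps_exp e"
  have comp: "fps_nth (?E oo fps_X ^ p) m = (if p dvd m then e ^ (m div p) / fact (m div p) else 0)" for m
  proof -
    have "fps_nth (?E oo fps_X ^ p) m = (\<Sum>i=0..m. fps_nth ?E i * (if m = p * i then 1 else 0))"
      by (simp add: fps_compose_nth flip: power_mult)
    also have "\<dots> = (\<Sum>i\<in>{0..m} \<inter> {i. m = p * i}. fps_nth ?E i)"
      by (subst sum.inter_restrict) (auto intro: sum.cong)
    also have "{0..m} \<inter> {i. m = p * i} = (if p dvd m then {m div p} else {})"
      using p by (auto simp: div_le_dividend)
    finally show ?thesis by auto
  qed
  have q: "q_monic p (int n) = (\<Sum>d\<le>n. monom (if p dvd n - d then e ^ ((n - d) div p) / fact ((n - d) div p) / fact d else 0) d)"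
    unfolding q_monic_def e_def nat_int by simp
  have "poly (q_monic p (int n)) x = (\<Sum>d\<le>n. x ^ d / fact d * fps_nth (?E oo fps_X ^ p) (n - d))"
    unfolding q by (auto simp: poly_sum poly_monom comp intro!: sum.cong)
  also have "\<dots> = fps_nth (fps_exp x * (?E oo fps_X ^ p)) n"
    by (simp add: fps_mult_nth atMost_atLeast0)
  finally show ?thesis by (simp add: qn_def e_def)
qed

section \<open>Normalised Wronskians\<close>

definition det_q :: "nat \<Rightarrow> nat \<Rightarrow> (nat \<Rightarrow> int) \<Rightarrow> real poly" where
  "det_q p l n = det_fun l (\<lambda>j i. q_monic p (n j - int i))"

text \<open>Built from the leading coefficients of the entries of \<open>det_q\<close>. For distinct
  nonnegative degrees it is the Vandermonde product divided by the factorials, and so it links the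
  normalisation of the Wronskian with hook lengths.\<close>

definition det_lead :: "nat \<Rightarrow> (nat \<Rightarrow> int) \<Rightarrow> real" where
  "det_lead l n = det_fun l (\<lambda>j i. inv_fact (n j - int i))"

lemma euler_det_q:
  assumes p: "p \<ge> 1"
  shows "[:0, 1:] * pderiv (det_q p l n) =
    of_int ((\<Sum>j<l. n j) - (\<Sum>i<l. int i)) * det_q p l n + (\<Sum>k<l. det_q p l (n(k := n k - int p)))"
proof -
  let ?A = "\<lambda>j i. q_monic p (n j - int i)"
  let ?B = "\<lambda>j i. (of_int (n j) - of_nat i) * ?A j i"
  let ?C = "\<lambda>j i. q_monic p (n j - int p - int i)"
  have e: "[:0, 1:] * pderiv (?A j i) = ?B j i + ?C j i" for j i
    unfolding euler_q_monic[OF p] by (simp add: algebra_simps)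
  have "[:0, 1:] * pderiv (det_q p l n) =
    (\<Sum>k<l. det_fun l (\<lambda>j i. if j = k then ?B j i + ?C j i else ?A j i))"
    unfolding det_q_def pderiv_det_fun e ..
  also have "\<dots> = (\<Sum>k<l. det_fun l (\<lambda>j i. if j = k then ?B j i else ?A j i) +
      det_fun l (\<lambda>j i. if j = k then ?C j i else ?A j i))"
    by (intro sum.cong HOL.refl det_fun_replace_row_add) simp
  also have "\<dots> = ((\<Sum>j<l. of_int (n j)) - (\<Sum>i<l. of_nat i)) * det_fun l ?A +
      (\<Sum>k<l. det_fun l (\<lambda>j i. if j = k then ?C j i else ?A j i))"
    unfolding sum.distrib det_fun_row_weights ..
  also have "(\<Sum>k<l. det_fun l (\<lambda>j i. if j = k then ?C j i else ?A j i)) =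
      (\<Sum>k<l. det_q p l (n(k := n k - int p)))"
    unfolding det_q_def
    by (intro sum.cong HOL.refl arg_cong[where f = "\<lambda>f. det (mat l l f)"]) (auto simp: fun_eq_iff)
  finally show ?thesis by (simp add: det_q_def of_int_sum)
qed

text \<open>Here the row weights are the whole effect, since \<open>(n - i) / (n - i)!\<close> is
  the inverse factorial one lower. It is the counterpart of the Euler identity for strips of one
  box.\<close>

lemma det_lead_rec:
  "of_int ((\<Sum>j<l. n j) - (\<Sum>i<l. int i)) * det_lead l n = (\<Sum>k<l. det_lead l (n(k := n k - 1)))"
proof -
  let ?A = "\<lambda>j i. inv_fact (n j - int i)"
  have "of_int ((\<Sum>j<l. n j) - (\<Sum>i<l. int i)) * det_lead l n =
    (\<Sum>k<l. det_fun l (\<lambda>j i. if j = k then (of_int (n j) - of_nat i) * ?A j i else ?A j i))"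
    unfolding det_fun_row_weights by (simp add: det_lead_def of_int_sum)
  also have "\<dots> = (\<Sum>k<l. det_lead l (n(k := n k - 1)))"
    unfolding det_lead_def
  proof (intro sum.cong HOL.refl arg_cong[where f = "\<lambda>f. det (mat l l f)"] ext)
    fix k and x :: "nat \<times> nat"
    have "(of_int (n j) - of_nat i) * ?A j i = inv_fact (n j - 1 - int i)" for j i
      using inv_fact_rec[of "n j - int i"] by (simp add: algebra_simps)
    then show "(case x of (j, i) \<Rightarrow> if j = k then (of_int (n j) - of_nat i) * ?A j i else ?A j i) =
      (case x of (j, i) \<Rightarrow> inv_fact ((n(k := n k - 1)) j - int i))"
      by (cases x) simp
  qed
  finally show ?thesis .
qed

lemma det_q_repeat: "a < l \<Longrightarrow> b < l \<Longrightarrow> a \<noteq> b \<Longrightarrow> n a = n b \<Longrightarrow> det_q p l n = 0"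
  and det_lead_repeat: "a < l \<Longrightarrow> b < l \<Longrightarrow> a \<noteq> b \<Longrightarrow> n a = n b \<Longrightarrow> det_lead l n = 0"
  unfolding det_q_def det_lead_def by (auto intro: det_fun_identical_rows[of a _ b])

lemma det_q_neg: "a < l \<Longrightarrow> n a < 0 \<Longrightarrow> det_q p l n = 0"
  and det_lead_neg: "a < l \<Longrightarrow> n a < 0 \<Longrightarrow> det_lead l n = 0"
  unfolding det_q_def det_lead_def
  by (auto intro!: det_fun_zero_row[of a] simp: q_monic_def inv_fact_def)

lemma coeff_prod_top:
  fixes f :: "'b \<Rightarrow> 'a :: comm_semiring_1 poly"
  assumes "finite A" "\<And>i. i \<in> A \<Longrightarrow> degree (f i) \<le> d i"
  shows "coeff (\<Prod>i\<in>A. f i) (\<Sum>i\<in>A. d i) = (\<Prod>i\<in>A. coeff (f i) (d i)) \<and>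
    degree (\<Prod>i\<in>A. f i) \<le> (\<Sum>i\<in>A. d i)"
  using assms
proof (induction A rule: finite_induct)
  case (insert x A)
  have "coeff (f x * (\<Prod>i\<in>A. f i)) (d x + (\<Sum>i\<in>A. d i)) = coeff (f x) (d x) * coeff (\<Prod>i\<in>A. f i) (\<Sum>i\<in>A. d i)"
  proof -
    have "coeff (f x * (\<Prod>i\<in>A. f i)) (d x + (\<Sum>i\<in>A. d i)) = 
      (\<Sum>k\<le>d x + (\<Sum>i\<in>A. d i). coeff (f x) k * coeff (\<Prod>i\<in>A. f i) (d x + (\<Sum>i\<in>A. d i) - k))"
      by (rule coeff_mult)
    also have "\<dots> = (\<Sum>k\<in>{d x}. coeff (f x) k * coeff (\<Prod>i\<in>A. f i) (d x + (\<Sum>i\<in>A. d i) - k))"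
    proof (rule sum.mono_neutral_right)
      have fx: "degree (f x) \<le> d x" and fA: "degree (\<Prod>i\<in>A. f i) \<le> (\<Sum>i\<in>A. d i)" using insert by auto
      show "\<forall>k\<in>{..d x + (\<Sum>i\<in>A. d i)} - {d x}. coeff (f x) k * coeff (\<Prod>i\<in>A. f i) (d x + (\<Sum>i\<in>A. d i) - k) = 0"
      proof
        fix k assume k: "k \<in> {..d x + (\<Sum>i\<in>A. d i)} - {d x}"
        show "coeff (f x) k * coeff (\<Prod>i\<in>A. f i) (d x + (\<Sum>i\<in>A. d i) - k) = 0"
        proof (cases "k > d x")
          case True
          then have "coeff (f x) k = 0" using fx by (intro coeff_eq_0) simp
          then show ?thesis by simp
        next
          case False
          then have "coeff (\<Prod>i\<in>A. f i) (d x + (\<Sum>i\<in>A. d i) - k) = 0"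
            using fA k by (intro coeff_eq_0) auto
          then show ?thesis by simp
        qed
      qed
    qed auto
    finally show ?thesis by simp
  qed
  moreover have "degree (f x * (\<Prod>i\<in>A. f i)) \<le> d x + (\<Sum>i\<in>A. d i)"
    using insert by (intro order_trans[OF degree_mult_le] add_mono) auto
  ultimately show ?case using insert by simp
qed auto

text \<open>Every Leibniz term has the same degree bound, the sum of the
  \<open>n j - \<sigma> j\<close>. If one of these indices is negative, the term and its leading
  part both vanish.\<close>

lemma coeff_det_q_top:
  assumes d: "int d = (\<Sum>j<l. n j) - (\<Sum>i<l. int i)"
  shows "coeff (det_q p l n) d = det_lead l n"
proof -
  have "coeff (signof \<sigma> * (\<Prod>j<l. q_monic p (n j - int (\<sigma> j)))) d = 
    signof \<sigma> * (\<Prod>j<l. inv_fact (n j - int (\<sigma> j)))" if \<sigma>: "\<sigma> permutes {0..<l}" for \<sigma>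
  proof -
    have "coeff (\<Prod>j<l. q_monic p (n j - int (\<sigma> j))) d = (\<Prod>j<l. inv_fact (n j - int (\<sigma> j)))"
    proof (cases "\<exists>j<l. n j < int (\<sigma> j)")
      case True
      then obtain j where j: "j < l" "n j < int (\<sigma> j)" by blast
      have "(\<Prod>j<l. q_monic p (n j - int (\<sigma> j))) = 0"
        using j by (intro prod_zero) (auto simp: q_monic_def)
      moreover have "(\<Prod>j<l. inv_fact (n j - int (\<sigma> j))) = 0"
        using j by (intro prod_zero) (auto simp: inv_fact_def)
      ultimately show ?thesis by (simp only: coeff_0)
    next
      case False
      then have ge: "n j - int (\<sigma> j) \<ge> 0" if "j < l" for j using that by fastforce
      have "(\<Sum>j<l. int (\<sigma> j)) = (\<Sum>i<l. int i)"
        using sum.permute[OF \<sigma>, of int] by (simp add: lessThan_atLeast0 o_def)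
      moreover have "int (\<Sum>j<l. nat (n j - int (\<sigma> j))) = (\<Sum>j<l. n j - int (\<sigma> j))"
        using ge by (simp add: of_nat_sum)
      ultimately have "int (\<Sum>j<l. nat (n j - int (\<sigma> j))) = int d" using d by (simp add: sum_subtractf)
      then have d': "d = (\<Sum>j<l. nat (n j - int (\<sigma> j)))" by linarith
      have "coeff (\<Prod>j<l. q_monic p (n j - int (\<sigma> j))) d = 
        (\<Prod>j<l. coeff (q_monic p (n j - int (\<sigma> j))) (nat (n j - int (\<sigma> j))))"
        unfolding d' by (rule conjunct1[OF coeff_prod_top]) (use ge degree_q_monic in auto)
      also have "\<dots> = (\<Prod>j<l. inv_fact (n j - int (\<sigma> j)))"
        using ge by (intro prod.cong) (auto simp: coeff_q_monic_top)
      finally show ?thesis .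
    qed
    then show ?thesis by (cases \<sigma> rule: sign_cases) simp_all
  qed
  then show ?thesis unfolding det_q_def det_lead_def det_fun_def coeff_sum by (intro sum.cong) auto
qed

text \<open>\<open>1 / (m - i)!\<close> is \<open>1 / m!\<close> times the falling factorial of
  \<open>m\<close> with \<open>i\<close> factors, a monic polynomial of degree \<open>i\<close> in
  \<open>m\<close>; for \<open>m < i\<close> both sides are zero. So the determinant is of
  Vandermonde type.\<close>

lemma det_lead_eq:
  assumes inj: "inj_on n {..<l}" and nn: "\<And>j. j < l \<Longrightarrow> n j \<ge> 0"
  shows "det_lead l n = (\<Prod>i<l. \<Prod>j\<in>{i<..<l}. of_int (n j) - of_int (n i)) / (\<Prod>j<l. fact (nat (n j)))"
proof -
  define P :: "nat \<Rightarrow> real poly" where "P i = (\<Prod>k<i. [:- of_nat k, 1:])" for i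
  have Pd: "degree (P i) = i" for i unfolding P_def by (subst degree_prod_eq_sum_degree) auto
  have Pl: "lead_coeff (P i) = 1" for i unfolding P_def lead_coeff_prod by simp
  have fall: "inv_fact (int m - int i) = inverse (fact m) * poly (P i) (of_int (int m))" for m i
  proof (induction i)
    case 0
    show ?case by (simp add: P_def inv_fact_def inverse_eq_divide)
  next
    case (Suc i)
    have "inv_fact (int m - int (Suc i)) = of_int (int m - int i) * inv_fact (int m - int i)"
      unfolding inv_fact_rec by (simp add: algebra_simps)
    then show ?case unfolding Suc by (simp add: P_def mult_ac left_diff_distrib)
  qed
  have "det_lead l n = det_fun l (\<lambda>j i. inverse (fact (nat (n j))) * poly (P i) (of_int (n j)))"
    unfolding det_lead_def
  proof (intro arg_cong[where f = det] eq_matI)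
    fix j i assume "j < dim_row (mat l l (\<lambda>(j, i). inverse (fact (nat (n j))) * poly (P i) (of_int (n j))))"
      "i < dim_col (mat l l (\<lambda>(j, i). inverse (fact (nat (n j))) * poly (P i) (of_int (n j))))"
    then show "mat l l (\<lambda>(j, i). inv_fact (n j - int i)) $$ (j, i) =
      mat l l (\<lambda>(j, i). inverse (fact (nat (n j))) * poly (P i) (of_int (n j))) $$ (j, i)"
      using fall[of "nat (n j)" i] nn[of j] by simp
  qed auto
  also have "\<dots> = (\<Prod>j<l. inverse (fact (nat (n j)))) * det_fun l (\<lambda>j i. poly (P i) (of_int (n j)))"
    by (rule det_fun_scale_rows)
  also have "det_fun l (\<lambda>j i. poly (P i) (of_int (n j))) = (\<Prod>i<l. \<Prod>j\<in>{i<..<l}. of_int (n j) - of_int (n i))"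
    by (rule det_fun_vandermonde) (use Pd Pl inj in \<open>auto simp: inj_on_def\<close>)
  finally show ?thesis by (simp only: inverse_eq_divide prod_dividef prod.neutral_const) simp
qed

section \<open>Absolute value and sign of the leading coefficient\<close>

lemma prod_pairs_eq:
  fixes f :: "nat \<Rightarrow> nat \<Rightarrow> 'a :: comm_monoid_mult"
  shows "(\<Prod>i<l. \<Prod>j\<in>{i<..<l}. f i j) = (\<Prod>(i, j)\<in>{(i, j). i < j \<and> j < l}. f i j)"
proof -
  have "(\<Prod>i<l. \<Prod>j\<in>{i<..<l}. f i j) = (\<Prod>(i, j)\<in>Sigma {..<l} (\<lambda>i. {i<..<l}). f i j)"
    by (rule prod.Sigma) auto
  also have "Sigma {..<l} (\<lambda>i. {i<..<l}) = {(i, j). i < j \<and> j < l}" by auto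
  finally show ?thesis .
qed

lemma prod_abs_differences:
  fixes n :: "nat \<Rightarrow> int"
  assumes inj: "inj_on n {..<l}"
  defines "T \<equiv> n ` {..<l}"
  shows "(\<Prod>(i, j)\<in>{(i, j). i < j \<and> j < l}. \<bar>real_of_int (n j) - of_int (n i)\<bar>) =
    (\<Prod>x\<in>{(a, b). a \<in> T \<and> b \<in> T \<and> b < a}. of_int (fst x - snd x))"
proof -
  let ?P = "{(i, j). i < j \<and> j < l}"
  let ?f = "\<lambda>(i, j). (max (n i) (n j), min (n i) (n j))"
  have ne: "n i \<noteq> n j" if "i < j" "j < l" for i j using inj that by (auto simp: inj_on_def)
  have eq: "n i = n j \<longleftrightarrow> i = j" if "i < l" "j < l" for i j using inj that by (auto simp: inj_on_def)
  have "inj_on ?f ?P"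
  proof (rule inj_onI, clarify)
    fix i j i' j' assume ij: "i < j" "j < l" "i' < j'" "j' < l"
      and h: "max (n i) (n j) = max (n i') (n j')" "min (n i) (n j) = min (n i') (n j')"
    then have "(n i = n i' \<and> n j = n j') \<or> (n i = n j' \<and> n j = n i')"
      by (auto simp: max_def min_def split: if_splits)
    then show "i = i' \<and> j = j'" using eq ij by auto
  qed
  moreover have "?f ` ?P = {(a, b). a \<in> T \<and> b \<in> T \<and> b < a}"
  proof
    show "?f ` ?P \<subseteq> {(a, b). a \<in> T \<and> b \<in> T \<and> b < a}"
      using ne by (fastforce simp: T_def max_def min_def)
    show "{(a, b). a \<in> T \<and> b \<in> T \<and> b < a} \<subseteq> ?f ` ?P"
    proof clarify
      fix a b assume "a \<in> T" "b \<in> T" "b < a"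
      then obtain i j where ij: "i < l" "j < l" "a = n i" "b = n j" "n j < n i" by (auto simp: T_def)
      show "(a, b) \<in> ?f ` ?P"
      proof (cases i j rule: linorder_cases)
        case less
        then show ?thesis using ij by (intro image_eqI[of _ _ "(i, j)"]) auto
      next
        case greater
        then show ?thesis using ij by (intro image_eqI[of _ _ "(j, i)"]) auto
      qed (use ij in auto)
    qed
  qed
  ultimately have bij: "bij_betw ?f ?P {(a, b). a \<in> T \<and> b \<in> T \<and> b < a}" by (simp add: bij_betw_def)
  have "(\<Prod>x\<in>{(a, b). a \<in> T \<and> b \<in> T \<and> b < a}. real_of_int (fst x - snd x)) =
    (\<Prod>x\<in>?P. of_int (fst (?f x) - snd (?f x)))"
    by (rule prod.reindex_bij_betw[OF bij, symmetric])
  also have "\<dots> = (\<Prod>(i, j)\<in>?P. \<bar>real_of_int (n j) - of_int (n i)\<bar>)"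
    by (intro prod.cong) (auto simp: max_def min_def)
  finally show ?thesis by simp
qed

lemma fact_eq_prod_int: "m \<ge> 0 \<Longrightarrow> (\<Prod>h\<in>{0..<m}. of_int (m - h)) = (fact (nat m) :: real)"
proof (induction "nat m" arbitrary: m)
  case (Suc k)
  then have k: "k = nat (m - 1)" and m: "m \<ge> 1" by auto
  have "{0..<m} = insert 0 {1..<m}" using m by auto
  then have "(\<Prod>h\<in>{0..<m}. real_of_int (m - h)) = of_int m * (\<Prod>h\<in>{1..<m}. of_int (m - h))" by simp
  also have "(\<Prod>h\<in>{1..<m}. real_of_int (m - h)) = (\<Prod>h\<in>{0..<m - 1}. of_int (m - 1 - h))"
    by (rule prod.reindex_bij_witness[of _ "\<lambda>h. h + 1" "\<lambda>h. h - 1"]) auto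
  also have "(\<Prod>h\<in>{0..<m - 1}. of_int (m - 1 - h)) = (fact (nat (m - 1)) :: real)"
    using Suc.hyps(1)[OF k] m by simp
  also have "of_int m * fact (nat (m - 1)) = (fact (nat m) :: real)"
    using fact_reduce[of "nat m", where 'a = real] m by (simp add: nat_diff_distrib)
  finally show ?case .
qed simp

text \<open>In \<open>m!\<close> as the product of \<open>m - h\<close> over
  \<open>0 \<le> h < m\<close>, each \<open>h\<close> is a bead or a gap. The beads reproduce the
  Vandermonde product and the gaps the hook lengths, so the Vandermonde product over the factorials
  is the inverse hook product.\<close>

lemma abs_det_lead:
  fixes n :: "nat \<Rightarrow> int"
  assumes inj: "inj_on n {..<l}" and nn: "\<And>j. j < l \<Longrightarrow> n j \<ge> 0"
  shows "\<bar>det_lead l n\<bar> = 1 / hook_prod ({..<0} \<union> n ` {..<l})"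
proof -
  let ?T = "n ` {..<l}"
  let ?M = "{..<0} \<union> ?T"
  let ?D = "{(a, b). a \<in> ?T \<and> b \<in> ?T \<and> b < a}"
  let ?g = "\<lambda>x::int\<times>int. real_of_int (fst x - snd x)"
  have T0: "m \<ge> 0" if "m \<in> ?T" for m using nn that by auto
  have "(\<Prod>j<l. fact (nat (n j)) :: real) = (\<Prod>m\<in>?T. fact (nat m))"
    by (simp add: prod.reindex[OF inj])
  also have "\<dots> = (\<Prod>m\<in>?T. \<Prod>h\<in>{0..<m}. real_of_int (m - h))"
    using T0 by (intro prod.cong) (auto simp: fact_eq_prod_int simp del: of_int_diff)
  also have "\<dots> = prod ?g (Sigma ?T (\<lambda>m. {0..<m}))"
    by (subst prod.Sigma) (auto simp: case_prod_beta)
  also have "Sigma ?T (\<lambda>m. {0..<m}) = bead_gaps ?M \<union> ?D"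
    using T0 by (fastforce simp: bead_gaps_def)
  also have "prod ?g (bead_gaps ?M \<union> ?D) = prod ?g (bead_gaps ?M) * prod ?g ?D"
  proof (rule prod.union_disjoint)
    have "finite (Sigma ?T (\<lambda>m. {0..<m}))" by auto
    then show "finite (bead_gaps ?M)" "finite ?D"
      by (rule rev_finite_subset; use T0 in \<open>fastforce simp: bead_gaps_def\<close>)+
  qed (auto simp: bead_gaps_def)
  finally have F: "(\<Prod>j<l. fact (nat (n j)) :: real) = hook_prod ?M * prod ?g ?D"
    by (simp add: hook_prod_def case_prod_beta)
  have D: "\<bar>\<Prod>i<l. \<Prod>j\<in>{i<..<l}. real_of_int (n j) - of_int (n i)\<bar> = prod ?g ?D"
    unfolding prod_pairs_eq using prod_abs_differences[OF inj] by (simp add: abs_prod case_prod_beta)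
  have "prod ?g ?D > 0" by (rule prod_pos) auto
  moreover have "\<bar>\<Prod>j<l. fact (nat (n j)) :: real\<bar> = hook_prod ?M * prod ?g ?D"
    unfolding F[symmetric] by (intro abs_of_nonneg prod_nonneg) auto
  moreover have "\<bar>det_lead l n\<bar> = prod ?g ?D / \<bar>\<Prod>j<l. fact (nat (n j)) :: real\<bar>"
    by (subst det_lead_eq) (use inj nn D in \<open>auto simp: abs_divide simp del: of_int_diff\<close>)
  ultimately show ?thesis using hook_prod_pos[of ?M] by (simp add: field_simps)
qed

lemma sgn_prod: "sgn (\<Prod>x\<in>A. f x) = (\<Prod>x\<in>A. sgn (f x :: 'a :: linordered_idom))"
  by (induction A rule: infinite_finite_induct) (auto simp: sgn_mult)

text \<open>The sign is that of the Vandermonde product, and a factor of it changes sign exactly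
  when it compares the moved bead with a bead jumped over.\<close>

lemma sgn_det_lead_update:
  fixes n :: "nat \<Rightarrow> int"
  assumes inj: "inj_on n {..<l}" and nn: "\<And>j. j < l \<Longrightarrow> n j \<ge> 0"
    and a: "a < l" and n': "n a - int p \<ge> 0" "n a - int p \<notin> n ` {..<l}"
  shows "sgn (det_lead l (n(a := n a - int p))) * sgn (det_lead l n) =
    (-1) ^ card {x \<in> n ` {..<l}. n a - int p < x \<and> x < n a}"
proof -
  let ?n = "n(a := n a - int p)" and ?P = "{(i, j). i < j \<and> j < l}"
  let ?s = "\<lambda>n x. sgn (real_of_int (n (snd x)) - of_int (n (fst x)))"
  have inj': "inj_on ?n {..<l}" using inj n'(2) by (rule inj_on_fun_updI)
  have nn': "?n j \<ge> 0" if "j < l" for j using nn n' that by auto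
  have sg: "sgn (det_lead l n) = (\<Prod>x\<in>?P. ?s n x)" 
    if "inj_on n {..<l}" "\<And>j. j < l \<Longrightarrow> n j \<ge> 0" for n
  proof -
    have "sgn (\<Prod>j<l. fact (nat (n j)) :: real) = 1" by (intro sgn_pos prod_pos) auto
    then have "sgn (det_lead l n) = sgn (\<Prod>i<l. \<Prod>j\<in>{i<..<l}. real_of_int (n j) - of_int (n i))"
      by (subst det_lead_eq) (use that in \<open>auto simp: sgn_divide\<close>)
    also have "\<dots> = (\<Prod>x\<in>?P. ?s n x)"
      unfolding prod_pairs_eq by (simp add: sgn_prod case_prod_beta)
    finally show ?thesis .
  qed
  define btw where "btw j \<longleftrightarrow> j < l \<and> n a - int p < n j \<and> n j < n a" for j
  let ?X = "{x \<in> ?P. (fst x = a \<and> btw (snd x)) \<or> (snd x = a \<and> btw (fst x))}"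
  have finP: "finite ?P" by (rule finite_subset[of _ "{..<l} \<times> {..<l}"]) auto
  have ne: "n i \<noteq> n j \<and> n i \<noteq> n a - int p" if "i < l" "j < l" "i \<noteq> j" for i j
  proof
    show "n i \<noteq> n j" using inj that by (auto simp: inj_on_def)
    have "n i \<in> n ` {..<l}" using that by simp
    then show "n i \<noteq> n a - int p" using n'(2) by metis
  qed
  have "sgn (det_lead l ?n) * sgn (det_lead l n) = (\<Prod>x\<in>?P. ?s ?n x * ?s n x)"
  proof -
    have "sgn (det_lead l n) = (\<Prod>x\<in>?P. ?s n x)" by (rule sg) (use inj nn in auto)
    moreover have "sgn (det_lead l ?n) = (\<Prod>x\<in>?P. ?s ?n x)" by (rule sg) (use inj' nn' in auto)
    ultimately show ?thesis by (simp only: prod.distrib)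
  qed
  also have "\<dots> = (\<Prod>x\<in>?P. if x \<in> ?X then - 1 else 1)"
  proof (rule prod.cong[OF HOL.refl])
    fix x assume x: "x \<in> ?P"
    then have l: "fst x < l" "snd x < l" "fst x \<noteq> snd x" by auto
    note ne1 = ne[OF l] ne[OF l(2,1) l(3)[symmetric]]
    show "?s ?n x * ?s n x = (if x \<in> ?X then - 1 else 1)"
      using x l ne1 by (auto simp: btw_def sgn_if)
  qed
  also have "\<dots> = (-1) ^ card ?X"
    using prod.inter_restrict[OF finP, of "\<lambda>_. -1 :: real" ?X] by (simp add: Int_absorb1 subset_iff if_distrib)
  also have "card ?X = card {x \<in> n ` {..<l}. n a - int p < x \<and> x < n a}"
  proof -
    have "bij_betw (\<lambda>x. if fst x = a then n (snd x) else n (fst x)) ?X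
      {x \<in> n ` {..<l}. n a - int p < x \<and> x < n a}"
    proof (rule bij_betw_imageI)
      have eq: "n i = n j \<longleftrightarrow> i = j" if "i < l" "j < l" for i j using inj that by (auto simp: inj_on_def)
      show "inj_on (\<lambda>x. if fst x = a then n (snd x) else n (fst x)) ?X"
        by (rule inj_onI) (auto simp: eq btw_def split: if_splits)
      show "(\<lambda>x. if fst x = a then n (snd x) else n (fst x)) ` ?X = {x \<in> n ` {..<l}. n a - int p < x \<and> x < n a}"
      proof
        show "{x \<in> n ` {..<l}. n a - int p < x \<and> x < n a} \<subseteq> (\<lambda>x. if fst x = a then n (snd x) else n (fst x)) ` ?X"
        proof clarify
          fix j assume j: "j < l" "n a - int p < n j" "n j < n a"
          then have "j \<noteq> a" by auto
          then show "n j \<in> (\<lambda>x. if fst x = a then n (snd x) else n (fst x)) ` ?X"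
            using j a by (intro image_eqI[of _ _ "if j < a then (j, a) else (a, j)"]) (auto simp: btw_def)
        qed
      qed (auto simp: btw_def)
    qed
    then show ?thesis by (rule bij_betw_same_card)
  qed
  finally show ?thesis .
qed

text \<open>Dividing by the leading coefficient makes the Wronskian symmetric in the degrees, so that no
  sign for reordering them after a bead move has to be tracked.\<close>

definition q_norm :: "nat \<Rightarrow> nat \<Rightarrow> (nat \<Rightarrow> int) \<Rightarrow> real poly" where
  "q_norm p l n = smult (1 / det_lead l n) (det_q p l n)"

lemma det_fun_cong: "(\<And>j i. j < l \<Longrightarrow> i < l \<Longrightarrow> A j i = B j i) \<Longrightarrow> det_fun l A = det_fun l B"
  by (intro arg_cong[where f = det] eq_matI) auto

lemma q_norm_image_cong:
  assumes inj: "inj_on n {..<l}" "inj_on n' {..<l}" and im: "n ` {..<l} = n' ` {..<l}"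
  shows "q_norm p l n = q_norm p l n'"
proof -
  define \<pi> where "\<pi> j = (if j < l then the_inv_into {..<l} n (n' j) else j)" for j
  have b: "bij_betw n {..<l} (n ` {..<l})" "bij_betw n' {..<l} (n ` {..<l})"
    using inj im by (auto simp: bij_betw_def)
  have "bij_betw (the_inv_into {..<l} n \<circ> n') {..<l} {..<l}"
    by (rule bij_betw_trans[OF b(2) bij_betw_the_inv_into[OF b(1)]])
  then have "bij_betw \<pi> {..<l} {..<l}"
    by (rule bij_betw_cong[THEN iffD1, rotated]) (simp add: \<pi>_def)
  then have perm: "\<pi> permutes {0..<l}"
    by (intro bij_imp_permutes) (auto simp: lessThan_atLeast0 \<pi>_def)
  have n': "n' j = n (\<pi> j)" if "j < l" for j
    unfolding \<pi>_def using that f_the_inv_into_f[OF inj(1), of "n' j"] im by auto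
  have "det_q p l n' = signof \<pi> * det_q p l n"
    unfolding det_q_def det_fun_permute_rows[OF perm, symmetric] by (rule det_fun_cong) (simp add: n')
  moreover have "det_lead l n' = signof \<pi> * det_lead l n"
    unfolding det_lead_def det_fun_permute_rows[OF perm, symmetric] by (rule det_fun_cong) (simp add: n')
  ultimately show ?thesis
    by (cases \<pi> rule: sign_cases) (simp_all add: q_norm_def)
qed

section \<open>Recursion over border strips\<close>

definition hooks :: "nat list \<Rightarrow> real" where
  "hooks nu = (\<Prod>b\<in>diagram nu. real (hook nu b))"

lemma hook_prod_maya_of:
  assumes "partition nu"
  shows "hook_prod (maya_of nu c) = hooks nu"
proof -
  let ?f = "\<lambda>(i, j). (beta nu c i, gap nu c j)"
  have "hook_prod (maya_of nu c) = (\<Prod>b\<in>diagram nu. real_of_int (fst (?f b) - snd (?f b)))"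
    unfolding hook_prod_def case_prod_beta[of "\<lambda>m h. real_of_int (m - h)"]
    by (rule prod.reindex_bij_betw[OF bij_betw_diagram_bead_gaps[OF assms], symmetric])
  also have "\<dots> = hooks nu"
    unfolding hooks_def
  proof (rule prod.cong[OF HOL.refl])
    fix b assume "b \<in> diagram nu"
    then have "int (hook nu b) = fst (?f b) - snd (?f b)"
      using hook_eq[OF assms, of "fst b" "snd b" c] by (cases b) simp
    then show "real_of_int (fst (?f b) - snd (?f b)) = real (hook nu b)"
      by (metis of_int_of_nat_eq)
  qed
  finally show ?thesis .
qed

lemma hooks_pos: "partition nu \<Longrightarrow> hooks nu > 0"
  using hook_prod_pos[of "maya_of nu 0"] by (simp add: hook_prod_maya_of)

lemma hooks_Nil [simp]: "hooks [] = 1"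
  by (simp add: hooks_def diagram_def)

lemma border_strip_psize: "border_strip p lam nu h \<Longrightarrow> psize lam = psize nu + p"
proof -
  assume bs: "border_strip p lam nu h"
  then have sub: "diagram nu \<subseteq> diagram lam" and c: "card (diagram lam - diagram nu) = p"
    by (auto simp: border_strip_def Let_def diagram_subset_iff yd_le_iff)
  then show ?thesis
    using card_Diff_subset[OF finite_diagram sub] card_mono[OF finite_diagram sub]
    by (simp add: psize_eq_card)
qed

text \<open>With charge equal to the number \<open>l\<close> of beads taken, the remaining beads are
  exactly the negative integers, and the \<open>l\<close> beads are the degrees in a determinant of
  size \<open>l\<close>.\<close>

lemma beta_window:
  assumes "length nu \<le> l"
  shows "{..<0} \<subseteq> maya_of nu (int l)" "maya_of nu (int l) = {..<0} \<union> beta nu (int l) ` {..<l}"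
    "\<And>j. j < l \<Longrightarrow> beta nu (int l) j \<ge> 0"
proof -
  show nn: "\<And>j. j < l \<Longrightarrow> beta nu (int l) j \<ge> 0" by (simp add: beta_def)
  show sub: "{..<0} \<subseteq> maya_of nu (int l)"
    using lower_maya_of[of "int l" nu] assms by (auto simp: subset_iff)
  have "beta nu (int l) j < 0" if "\<not> j < l" for j
    using that assms by (simp add: beta_ge_length)
  then show "maya_of nu (int l) = {..<0} \<union> beta nu (int l) ` {..<l}"
    using sub by (auto simp: maya_of_eq) 
qed

lemma sum_beta_window:
  assumes "length nu \<le> l"
  shows "(\<Sum>j<l. beta nu (int l) j) - (\<Sum>i<l. int i) = int (psize nu)"
proof -
  have "(\<Sum>j<l. int (l - Suc j)) = (\<Sum>i<l. int i)" by (rule sum.nat_diff_reindex)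
  moreover have "(\<Sum>j<l. beta nu (int l) j) = (\<Sum>j<l. int (part nu j) + int (l - Suc j))"
    by (intro sum.cong) (auto simp: beta_def of_nat_diff)
  ultimately show ?thesis
    using card_diagram[OF assms] by (simp add: sum.distrib psize_eq_card)
qed

lemma inj_mv:
  assumes "m \<in> movable p M" "m' \<in> movable p M" "mv p m M = mv p m' M"
  shows "m = m'"
proof (rule ccontr)
  assume ne: "m \<noteq> m'"
  then have "m \<in> mv p m' M" using assms(1) by (auto simp: movable_def mv_def)
  then have "m \<in> mv p m M" using assms(3) by simp
  then have "int p = 0" by (auto simp: mv_def)
  then show False using assms(1) by (simp add: movable_def)
qed

lemma yd_le_length: "yd_le a b \<Longrightarrow> length a \<le> length b"
  by (simp add: yd_le_def)

text \<open>The \<open>l - length nu\<close> extra beads stand for empty rows; they keep the size of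
  the determinants constant along a chain.\<close>

locale bead_window =
  fixes p l :: nat and nu :: "nat list"
  assumes p: "p \<ge> 1" and nu: "partition nu" and len: "length nu \<le> l"
begin

abbreviation "n \<equiv> beta nu (int l)"
abbreviation "M \<equiv> maya_of nu (int l)"

text \<open>The rows that still give a nonzero determinant after being lowered by \<open>p\<close>;
  they correspond to the removable strips.\<close>

definition J where "J = {a. a < l \<and> n a - int p \<notin> M}"
definition kap where "kap a = maya_partition (mv p (n a) M)"
definition ht where "ht a = card {x \<in> M. n a - int p < x \<and> x < n a}"

lemma inj_n: "inj_on n {..<l}"
  using inj_beta[OF nu] by (rule inj_on_subset) auto

lemma n_nonneg: "j < l \<Longrightarrow> n j \<ge> 0"
  by (rule beta_window(3)[OF len])

lemma n_movable: "a \<in> J \<Longrightarrow> n a \<in> movable p M"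
  by (auto simp: J_def movable_def maya_of_eq)

lemma kap:
  assumes "a \<in> J"
  shows "partition (kap a)" "maya_of (kap a) (int l) = mv p (n a) M" "border_strip p nu (kap a) (ht a)"
    "length (kap a) \<le> l"
proof -
  note m = n_movable[OF assms]
  have "mayaset (mv p (n a) M)" by (rule mayaset_mv[OF mayaset_maya_of[OF nu] m])
  moreover have "charge (mv p (n a) M) = int l"
    using charge_mv[OF mayaset_maya_of[OF nu] m] nu by simp
  ultimately show 1: "partition (kap a)" "maya_of (kap a) (int l) = mv p (n a) M"
    using partition_maya_partition maya_of_maya_partition unfolding kap_def by metis+
  show bs: "border_strip p nu (kap a) (ht a)"
    unfolding border_strip_iff_move[OF nu p, of _ _ "int l"] using 1 m by (auto simp: ht_def)
  then show "length (kap a) \<le> l" using len yd_le_length by (force simp: border_strip_def)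
qed

lemma bij_J: "bij_betw (\<lambda>a. (kap a, ht a)) J {(kappa, h). border_strip p nu kappa h}"
proof (rule bij_betw_imageI)
  show "inj_on (\<lambda>a. (kap a, ht a)) J"
  proof (rule inj_onI)
    fix a b assume ab: "a \<in> J" "b \<in> J" and eq: "(kap a, ht a) = (kap b, ht b)"
    then have "n a = n b" using inj_mv[OF n_movable n_movable, of a b] kap(2) by (metis Pair_inject)
    then show "a = b" using inj_n ab by (auto simp: inj_on_def J_def)
  qed
  show "(\<lambda>a. (kap a, ht a)) ` J = {(kappa, h). border_strip p nu kappa h}"
  proof
    show "(\<lambda>a. (kap a, ht a)) ` J \<subseteq> {(kappa, h). border_strip p nu kappa h}" using kap(3) by auto
    show "{(kappa, h). border_strip p nu kappa h} \<subseteq> (\<lambda>a. (kap a, ht a)) ` J"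
    proof clarify
      fix kappa h assume "border_strip p nu kappa h"
      then obtain m where m: "partition kappa" "m \<in> movable p M" "maya_of kappa (int l) = mv p m M"
        "h = card {x \<in> M. m - int p < x \<and> x < m}"
        unfolding border_strip_iff_move[OF nu p, of _ _ "int l"] by blast
      have "m \<ge> 0"
        using lower_mv[OF beta_window(1)[OF len] m(2)] by simp
      then obtain a where a: "a < l" "m = n a"
        using m(2) beta_window(2)[OF len] by (auto simp: movable_def)
      then have aJ: "a \<in> J" using m(2) by (auto simp: J_def movable_def)
      have "kappa = kap a" using m(3) kap(1,2)[OF aJ] maya_of_inject[OF m(1)] a by metis
      then show "(kappa, h) \<in> (\<lambda>a. (kap a, ht a)) ` J" using aJ m(4) a by (auto simp: ht_def)
    qed
  qed
qed

lemma update_image: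
  assumes "a \<in> J"
  shows "inj_on (n(a := n a - int p)) {..<l}" "n a - int p \<ge> 0" "n a - int p \<notin> n ` {..<l}"
    "(n(a := n a - int p)) ` {..<l} = beta (kap a) (int l) ` {..<l}"
proof -
  have a: "a < l" "n a - int p \<notin> M" using assms by (auto simp: J_def)
  show nin: "n a - int p \<notin> n ` {..<l}" using a by (auto simp: maya_of_eq)
  show "inj_on (n(a := n a - int p)) {..<l}" using inj_n nin by (rule inj_on_fun_updI)
  show nn: "n a - int p \<ge> 0" using a(2) beta_window(1)[OF len] by force
  let ?k = "beta (kap a) (int l)"
  have "?k ` {..<l} = maya_of (kap a) (int l) \<inter> {0..}"
    using beta_window(2)[OF kap(4)[OF assms]] beta_window(3)[OF kap(4)[OF assms]] by auto
  also have "\<dots> = insert (n a - int p) (n ` {..<l} - {n a})"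
    unfolding kap(2)[OF assms] using nn n_nonneg by (auto simp: mv_def beta_window(2)[OF len])
  also have "n ` {..<l} - {n a} = n ` ({..<l} - {a})"
    using inj_on_image_set_diff[OF inj_n, of "{..<l}" "{a}"] a by simp
  also have "insert (n a - int p) (n ` ({..<l} - {a})) = (n(a := n a - int p)) ` {..<l}"
    using a(1) by (auto simp: image_iff)
  finally show "(n(a := n a - int p)) ` {..<l} = ?k ` {..<l}" ..
qed

lemma det_lead_abs: "\<bar>det_lead l n\<bar> = 1 / hooks nu"
  using abs_det_lead[OF inj_n n_nonneg] hook_prod_maya_of[OF nu, of "int l"] beta_window(2)[OF len] by simp

lemma det_lead_ne0: "det_lead l n \<noteq> 0"
  using det_lead_abs hooks_pos[OF nu] by auto

text \<open>The absolute value comes from the two hook products, the sign from the beads jumped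
  over. Together they are the weight of a strip in the recursion.\<close>

lemma det_lead_ratio:
  assumes a: "a \<in> J"
  shows "det_lead l (n(a := n a - int p)) / det_lead l n = (- 1) ^ ht a * (hooks nu / hooks (kap a))"
proof -
  let ?n = "n(a := n a - int p)"
  have al: "a < l" using a by (simp add: J_def)
  note u = update_image[OF a]
  have nn: "?n j \<ge> 0" if "j < l" for j using that n_nonneg u(2) by simp
  have "{..<0} \<union> ?n ` {..<l} = maya_of (kap a) (int l)"
    using u(4) beta_window(2)[OF kap(4)[OF a]] by simp
  moreover have "\<bar>det_lead l ?n\<bar> = 1 / hook_prod ({..<0} \<union> ?n ` {..<l})"
    using u(1) nn by (rule abs_det_lead)
  ultimately have abs: "\<bar>det_lead l ?n\<bar> = 1 / hooks (kap a)"
    by (simp only: hook_prod_maya_of[OF kap(1)[OF a]])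
  have "{x \<in> n ` {..<l}. n a - int p < x \<and> x < n a} = {x \<in> M. n a - int p < x \<and> x < n a}"
    unfolding beta_window(2)[OF len] using u(2) by auto
  then have sgn: "sgn (det_lead l ?n) * sgn (det_lead l n) = (- 1) ^ ht a"
    using sgn_det_lead_update[OF inj_n n_nonneg al u(2,3)] by (simp add: ht_def)
  have "det_lead l ?n / det_lead l n =
      (sgn (det_lead l ?n) * \<bar>det_lead l ?n\<bar>) / (sgn (det_lead l n) * \<bar>det_lead l n\<bar>)"
    by (simp only: sgn_mult_abs)
  also have "\<dots> = (sgn (det_lead l ?n) * sgn (det_lead l n)) * (\<bar>det_lead l ?n\<bar> / \<bar>det_lead l n\<bar>)"
    using det_lead_ne0 by (simp add: sgn_if)
  finally show ?thesis unfolding sgn abs det_lead_abs by simp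
qed

text \<open>Lowering a row outside \<open>J\<close> makes its index negative or equal to another
  one, which gives a zero row or two equal rows. \<open>F\<close> is abstract to cover both the
  coefficients of \<open>det_q\<close> and \<open>det_lead\<close>.\<close>

lemma sum_update:
  assumes neg: "\<And>n a. a < l \<Longrightarrow> n a < 0 \<Longrightarrow> F n = (0::real)"
    and rep: "\<And>n a b. a < l \<Longrightarrow> b < l \<Longrightarrow> a \<noteq> b \<Longrightarrow> n a = n b \<Longrightarrow> F n = 0"
  shows "(\<Sum>a<l. F (n(a := n a - int p))) = (\<Sum>a\<in>J. F (n(a := n a - int p)))"
proof (rule sum.mono_neutral_right)
  show "\<forall>a\<in>{..<l} - J. F (n(a := n a - int p)) = 0"
  proof
    fix a assume "a \<in> {..<l} - J"
    then have a: "a < l" "n a - int p \<in> M" by (auto simp: J_def)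
    show "F (n(a := n a - int p)) = 0"
    proof (cases "n a - int p < 0")
      case True
      then show ?thesis using neg[of a "n(a := n a - int p)"] a by simp
    next
      case False
      then obtain b where b: "b < l" "n b = n a - int p" using a beta_window(2)[OF len] by auto
      then have "b \<noteq> a" using p by auto
      then show ?thesis using rep[of a b "n(a := n a - int p)"] a b by simp
    qed
  qed
qed (auto simp: J_def)

lemma coeff_q_norm_rec:
  "(real d - real (psize nu)) * coeff (q_norm p l n) d =
    (\<Sum>(kappa, h)\<in>{(kappa, h). border_strip p nu kappa h}.
      (- 1) ^ h * (hooks nu / hooks kappa) * coeff (q_norm p l (beta kappa (int l))) d)"
proof -
  let ?n = "\<lambda>a. n(a := n a - int p)"
  have "coeff ([:0, 1:] * pderiv (det_q p l n)) d = real d * coeff (det_q p l n) d"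
    by (cases d) (auto simp: coeff_pderiv coeff_pCons)
  moreover have scale: "coeff (of_int z * f) d = of_int z * coeff f d" for z and f :: "real poly"
    by (simp add: of_int_poly)
  ultimately have "real d * coeff (det_q p l n) d = of_int (int (psize nu)) * coeff (det_q p l n) d
      + (\<Sum>a<l. coeff (det_q p l (?n a)) d)"
    using arg_cong[OF euler_det_q[OF p, of l n], of "\<lambda>f. coeff f d"]
    unfolding sum_beta_window[OF len] coeff_add coeff_sum scale by simp
  then have "(real d - real (psize nu)) * coeff (det_q p l n) d = (\<Sum>a<l. coeff (det_q p l (?n a)) d)"
    by (simp add: algebra_simps)
  also have "\<dots> = (\<Sum>a\<in>J. coeff (det_q p l (?n a)) d)"
    by (rule sum_update) (auto simp: det_q_neg intro: det_q_repeat arg_cong[where f = "\<lambda>f. coeff f d" and y = 0, simplified])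
  finally have "(real d - real (psize nu)) * coeff (q_norm p l n) d =
    (\<Sum>a\<in>J. coeff (det_q p l (?n a)) d / det_lead l n)"
    by (simp add: q_norm_def sum_divide_distrib)
  also have "\<dots> = (\<Sum>a\<in>J. (- 1) ^ ht a * (hooks nu / hooks (kap a)) * coeff (q_norm p l (beta (kap a) (int l))) d)"
  proof (rule sum.cong[OF HOL.refl])
    fix a assume a: "a \<in> J"
    interpret k: bead_window p l "kap a" by unfold_locales (use p kap[OF a] in auto)
    \<comment> \<open>After the move the degrees are in general no longer decreasing; only the set
      of degrees matters, so they may be replaced by the sorted beads of
      \<open>kap a\<close>.\<close>
    have eq: "q_norm p l (?n a) = q_norm p l (beta (kap a) (int l))"
      by (rule q_norm_image_cong[OF update_image(1)[OF a] k.inj_n update_image(4)[OF a]])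
    have "det_lead l (?n a) \<noteq> 0"
      using det_lead_ratio[OF a] hooks_pos[OF nu] hooks_pos[OF kap(1)[OF a]] by auto
    then have "coeff (det_q p l (?n a)) d / det_lead l n =
        det_lead l (?n a) / det_lead l n * coeff (q_norm p l (?n a)) d"
      by (simp add: q_norm_def)
    then show "coeff (det_q p l (?n a)) d / det_lead l n =
      (- 1) ^ ht a * (hooks nu / hooks (kap a)) * coeff (q_norm p l (beta (kap a) (int l))) d"
      unfolding det_lead_ratio[OF a] eq .
  qed
  also have "\<dots> = (\<Sum>(kappa, h)\<in>{(kappa, h). border_strip p nu kappa h}.
      (- 1) ^ h * (hooks nu / hooks kappa) * coeff (q_norm p l (beta kappa (int l))) d)"
    using sum.reindex_bij_betw[OF bij_J, of "\<lambda>(kappa, h). (- 1) ^ h * (hooks nu / hooks kappa) * coeff (q_norm p l (beta kappa (int l))) d"]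
    by simp
  finally show ?thesis .
qed

lemma coeff_q_norm_top: "coeff (q_norm p l n) (psize nu) = 1"
  using coeff_det_q_top[of "psize nu" n l p] sum_beta_window[OF len] det_lead_ne0 by (simp add: q_norm_def)

end

text \<open>For \<open>p = 1\<close> a bead has nothing to jump over, so all signs are
  positive.\<close>

lemma hooks_rec:
  assumes nu: "partition nu"
  shows "real (psize nu) = (\<Sum>(kappa, h)\<in>{(kappa, h). border_strip 1 nu kappa h}. hooks nu / hooks kappa)"
proof -
  interpret bead_window 1 "length nu" nu by unfold_locales (use nu in auto)
  let ?l = "length nu"
  have "real (psize nu) * det_lead ?l n = (\<Sum>a<?l. det_lead ?l (n(a := n a - int 1)))"
    using det_lead_rec[where l = ?l and n = n] sum_beta_window[OF len] by simp
  also have "\<dots> = (\<Sum>a\<in>J. det_lead ?l (n(a := n a - int 1)))"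
    by (rule sum_update) (auto simp: det_lead_neg intro: det_lead_repeat)
  finally have "real (psize nu) = (\<Sum>a\<in>J. det_lead ?l (n(a := n a - int 1)) / det_lead ?l n)"
    using det_lead_ne0 by (simp add: sum_divide_distrib[symmetric] field_simps)
  also have "\<dots> = (\<Sum>a\<in>J. hooks nu / hooks (kap a))"
  proof (rule sum.cong[OF HOL.refl])
    fix a assume a: "a \<in> J"
    have "{x \<in> M. n a - int 1 < x \<and> x < n a} = {}" by auto
    then have "ht a = 0" unfolding ht_def by (metis card.empty)
    then show "det_lead ?l (n(a := n a - int 1)) / det_lead ?l n = hooks nu / hooks (kap a)"
      using det_lead_ratio[OF a] by simp
  qed
  also have "\<dots> = (\<Sum>(kappa, h)\<in>{(kappa, h). border_strip 1 nu kappa h}. hooks nu / hooks kappa)"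
    using sum.reindex_bij_betw[OF bij_J, of "\<lambda>(kappa, h). hooks nu / hooks kappa"] by simp
  finally show ?thesis .
qed

section \<open>The Wronskian as a normalised determinant\<close>

lemma poly_det_fun: "poly (det_fun l A) x = det_fun l (\<lambda>j i. poly (A j i) x)"
proof -
  have "poly (signof \<sigma> * f) x = signof \<sigma> * poly f x" for \<sigma> :: "nat \<Rightarrow> nat" and f
    by (cases \<sigma> rule: sign_cases) simp_all
  then show ?thesis unfolding det_fun_def by (simp add: poly_sum poly_prod)
qed

lemma funpow_deriv_poly: "(deriv ^^ i) (poly f) = poly ((pderiv ^^ i) f)" for f :: "real poly"
proof (induction i)
  case (Suc i)
  have "deriv (poly g) = poly (pderiv g)" for g :: "real poly"
    by (rule ext, rule DERIV_imp_deriv, rule poly_DERIV)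
  then show ?case using Suc by simp
qed simp

lemma funpow_pderiv_smult: "(pderiv ^^ i) (smult c f) = smult c ((pderiv ^^ i) f)"
  by (induction i) (auto simp: pderiv_smult)

text \<open>The factorials from \<open>q_n = n! u_n\<close> and the Vandermonde product in the
  definition of \<open>q_lam\<close> combine to \<open>1 / det_lead\<close>. Thus the prescribed
  normalisation is exactly the one that makes the polynomial monic.\<close>

lemma q_lam_eq_poly:
  assumes p: "p \<ge> 1" and lam: "partition lam"
  shows "q_lam p lam x = poly (q_norm p (length lam) (beta lam (int (length lam)))) x"
proof -
  interpret bead_window p "length lam" lam by unfold_locales (use p lam in auto)
  let ?l = "length lam" and ?ns = "degvec lam"
  have ns: "int (?ns ! i) = n i" if "i < ?l" for i
    using that by (simp add: degvec_def beta_def part_def of_nat_diff)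
  have len': "length ?ns = ?l" by (simp add: degvec_def)
  have D: "(\<Prod>i<?l. \<Prod>j\<in>{i<..<?l}. real (?ns ! j) - real (?ns ! i)) = 
    (\<Prod>i<?l. \<Prod>j\<in>{i<..<?l}. of_int (n j) - of_int (n i))"
  proof -
    have "real (?ns ! j) = of_int (n j)" if "j < ?l" for j using ns[OF that] by (metis of_int_of_nat_eq)
    then show ?thesis by (intro prod.cong HOL.refl) auto
  qed
  have entry: "(deriv ^^ i) (qn p (?ns ! j)) x = fact (nat (n j)) * poly (q_monic p (n j - int i)) x" if "j < ?l" for i j
  proof -
    have "qn p (?ns ! j) = poly (smult (fact (?ns ! j)) (q_monic p (n j)))"
      using qn_eq_poly[OF p] ns[OF that] by auto
    moreover have "nat (n j) = ?ns ! j" using ns[OF that] by linarith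
    ultimately show ?thesis
      by (simp add: funpow_deriv_poly funpow_pderiv_smult funpow_pderiv_q_monic)
  qed
  have "wronskian (map (qn p) ?ns) x = 
      det (transpose_mat (mat ?l ?l (\<lambda>(j, i). fact (nat (n j)) * poly (q_monic p (n j - int i)) x)))"
    unfolding wronskian_def using entry len' by (intro arg_cong[where f = det] eq_matI) auto
  also have "\<dots> = det_fun ?l (\<lambda>j i. fact (nat (n j)) * poly (q_monic p (n j - int i)) x)"
    by (rule det_transpose) auto
  also have "\<dots> = (\<Prod>j<?l. fact (nat (n j))) * poly (det_q p ?l n) x"
    unfolding det_fun_scale_rows det_q_def poly_det_fun ..
  finally have "q_lam p lam x = (\<Prod>j<?l. fact (nat (n j))) * poly (det_q p ?l n) x /
      (\<Prod>i<?l. \<Prod>j\<in>{i<..<?l}. of_int (n j) - of_int (n i))"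
    by (simp add: q_lam_def Let_def D)
  also have "\<dots> = poly (det_q p ?l n) x / det_lead ?l n"
    by (subst det_lead_eq[OF inj_n n_nonneg]) auto
  finally show ?thesis by (simp add: q_norm_def)
qed

section \<open>Chains in the Young lattice\<close>

definition covers :: "nat list \<Rightarrow> nat list set" where
  "covers nu = {kappa. partition kappa \<and> yd_le kappa nu \<and> psize nu = Suc (psize kappa)}"

lemma border_strip_1_iff:
  assumes "partition nu"
  shows "border_strip 1 nu kappa h \<longleftrightarrow> h = 0 \<and> kappa \<in> covers nu"
proof
  assume bs: "border_strip 1 nu kappa h"
  then have "card (diagram nu - diagram kappa) = 1" "h = card (fst ` (diagram nu - diagram kappa)) - 1"
    by (auto simp: border_strip_def Let_def)
  then have "h = 0" by (auto simp: card_1_singleton_iff)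
  then show "h = 0 \<and> kappa \<in> covers nu"
    using bs border_strip_psize[OF bs] by (auto simp: border_strip_def covers_def)
next
  assume k: "h = 0 \<and> kappa \<in> covers nu"
  then have sub: "diagram kappa \<subseteq> diagram nu" and sz: "psize nu = Suc (psize kappa)" and pk: "partition kappa"
    by (auto simp: covers_def diagram_subset_iff yd_le_iff)
  have "card (diagram nu - diagram kappa) = 1"
    using card_Diff_subset[OF finite_diagram sub] sz by (simp add: psize_eq_card)
  then obtain b where b: "diagram nu - diagram kappa = {b}" by (auto simp: card_1_singleton_iff)
  show "border_strip 1 nu kappa h"
    using k pk unfolding border_strip_def Let_def b
    by (auto simp: covers_def connected_boxes_def no_square_def)
qed

lemma finite_below: "finite {kappa. partition kappa \<and> yd_le kappa nu}"
proof (rule finite_imageD)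
  show "finite (diagram ` {kappa. partition kappa \<and> yd_le kappa nu})"
    by (rule finite_subset[of _ "Pow (diagram nu)"]) (simp_all add: image_subset_iff diagram_subset_iff, use yd_le_iff in blast)
  show "inj_on diagram {kappa. partition kappa \<and> yd_le kappa nu}"
    by (auto simp: inj_on_def intro: partition_diagram_inject)
qed

lemma finite_covers: "finite (covers nu)"
  by (rule finite_subset[OF _ finite_below[of nu]]) (auto simp: covers_def)

lemma hooks_rec_covers:
  assumes "partition nu"
  shows "real (psize nu) = (\<Sum>kappa\<in>covers nu. hooks nu / hooks kappa)"
proof -
  have "{(kappa, h). border_strip 1 nu kappa h} = (\<lambda>kappa. (kappa, 0)) ` covers nu"
    using border_strip_1_iff[OF assms] by auto
  then show ?thesis unfolding hooks_rec[OF assms]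
    by (simp add: sum.reindex inj_on_def)
qed

text \<open>An empty sum in the hook recursion would force size 0.\<close>

lemma covers_nonempty: "partition nu \<Longrightarrow> nu \<noteq> [] \<Longrightarrow> covers nu \<noteq> {}"
  using hooks_rec_covers[of nu] psize_eq_0_iff[of nu] by auto

section \<open>Counting chains, and the hook length formula\<close>

definition young_chains :: "nat list \<Rightarrow> nat list \<Rightarrow> nat list list set" where
  "young_chains alpha gamma = {ks. ks \<noteq> [] \<and> hd ks = gamma \<and> last ks = alpha \<and>
      (\<forall>k\<in>set ks. partition k) \<and>
      (\<forall>i. Suc i < length ks \<longrightarrow> yd_le (ks ! i) (ks ! Suc i) \<and>
                                    psize (ks ! Suc i) = Suc (psize (ks ! i)))}"

lemma F_chains_eq: "F_chains alpha gamma = card (young_chains alpha gamma)"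
  by (simp add: F_chains_def young_chains_def)

lemma yd_le_trans: "yd_le a b \<Longrightarrow> yd_le b c \<Longrightarrow> yd_le a c"
  by (auto simp: yd_le_def intro: le_trans)

lemma young_chains_nth:
  assumes "ks \<in> young_chains alpha gamma" "i < length ks"
  shows "psize (ks ! i) = psize gamma + i \<and> yd_le gamma (ks ! i)"
  using assms(2)
proof (induction i)
  case 0
  then show ?case using assms(1) by (auto simp: young_chains_def hd_conv_nth)
next
  case (Suc i)
  then have "yd_le (ks ! i) (ks ! Suc i) \<and> psize (ks ! Suc i) = Suc (psize (ks ! i))"
    using assms(1) by (auto simp: young_chains_def)
  then show ?case using Suc by (auto intro: yd_le_trans)
qed

lemma young_chains_psize:
  assumes "ks \<in> young_chains alpha gamma"
  shows "Suc (psize alpha) = psize gamma + length ks" "yd_le gamma alpha"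
proof -
  have "alpha = ks ! (length ks - 1)" "ks \<noteq> []" using assms by (auto simp: young_chains_def last_conv_nth)
  then show "Suc (psize alpha) = psize gamma + length ks" "yd_le gamma alpha"
    using young_chains_nth[OF assms, of "length ks - 1"] by auto
qed

lemma young_chains_psize_eq:
  assumes "psize alpha = psize gamma"
  shows "young_chains alpha gamma = (if alpha = gamma \<and> partition alpha then {[alpha]} else {})"
proof -
  have "ks = [alpha] \<and> alpha = gamma \<and> partition alpha" if "ks \<in> young_chains alpha gamma" for ks
  proof -
    have "length ks = 1" using young_chains_psize(1)[OF that] assms by simp
    then obtain k where "ks = [k]" by (auto simp: length_Suc_conv)
    then show ?thesis using that by (auto simp: young_chains_def)
  qed
  moreover have "[alpha] \<in> young_chains alpha alpha" if "partition alpha"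
    using that by (simp add: young_chains_def)
  ultimately show ?thesis by auto
qed

text \<open>Splits off the top of the chain; \<open>alpha \<noteq> gamma\<close> excludes the
  one-element chain, which has no predecessor of its top.\<close>

lemma young_chains_step:
  assumes "partition alpha" "alpha \<noteq> gamma"
  shows "young_chains alpha gamma = (\<Union>kappa\<in>covers alpha. (\<lambda>ks. ks @ [alpha]) ` young_chains kappa gamma)"
proof
  show "young_chains alpha gamma \<subseteq> (\<Union>kappa\<in>covers alpha. (\<lambda>ks. ks @ [alpha]) ` young_chains kappa gamma)"
  proof
    fix ks assume ks: "ks \<in> young_chains alpha gamma"
    define us where "us = butlast ks"
    have ks_eq: "ks = us @ [alpha]" using ks by (auto simp: us_def young_chains_def)
    have "us \<noteq> []" using ks ks_eq assms(2) by (auto simp: young_chains_def)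
    have step: "yd_le (ks ! i) (ks ! Suc i) \<and> psize (ks ! Suc i) = Suc (psize (ks ! i))" if "Suc i < length ks" for i
      using ks that by (auto simp: young_chains_def)
    have "us \<in> young_chains (last us) gamma"
      unfolding young_chains_def
    proof (intro CollectI conjI allI impI)
      show "hd us = gamma" using ks \<open>us \<noteq> []\<close> ks_eq by (auto simp: young_chains_def)
      show "\<forall>k\<in>set us. partition k" using ks ks_eq by (auto simp: young_chains_def)
      fix i assume i: "Suc i < length us"
      then show "yd_le (us ! i) (us ! Suc i)" "psize (us ! Suc i) = Suc (psize (us ! i))"
        using step[of i] by (auto simp: ks_eq nth_append)
    qed (use \<open>us \<noteq> []\<close> in auto)
    moreover have "last us \<in> covers alpha"
    proof -
      have e: "ks ! (length us - 1) = last us" "ks ! Suc (length us - 1) = alpha"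
        using \<open>us \<noteq> []\<close> by (auto simp: ks_eq last_conv_nth nth_append)
      have "Suc (length us - 1) < length ks" using \<open>us \<noteq> []\<close> by (simp add: ks_eq)
      from step[OF this] have "yd_le (last us) alpha \<and> psize alpha = Suc (psize (last us))"
        unfolding e .
      moreover have "last us \<in> set ks" using \<open>us \<noteq> []\<close> by (simp add: ks_eq)
      then have "partition (last us)" using ks by (auto simp: young_chains_def)
      ultimately show ?thesis by (simp add: covers_def)
    qed
    ultimately show "ks \<in> (\<Union>kappa\<in>covers alpha. (\<lambda>ks. ks @ [alpha]) ` young_chains kappa gamma)"
      using ks_eq by blast
  qed
next
  show "(\<Union>kappa\<in>covers alpha. (\<lambda>ks. ks @ [alpha]) ` young_chains kappa gamma) \<subseteq> young_chains alpha gamma"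
  proof clarify
    fix kappa us assume k: "kappa \<in> covers alpha" and us: "us \<in> young_chains kappa gamma"
    have "yd_le ((us @ [alpha]) ! i) ((us @ [alpha]) ! Suc i) \<and>
      psize ((us @ [alpha]) ! Suc i) = Suc (psize ((us @ [alpha]) ! i))" if "Suc i < length (us @ [alpha])" for i
    proof (cases "Suc i < length us")
      case True
      then show ?thesis using us by (auto simp: young_chains_def nth_append)
    next
      case False
      then have i: "i = length us - 1" "us \<noteq> []" using that us by (auto simp: young_chains_def)
      then have "us ! i = kappa" using us by (auto simp: young_chains_def last_conv_nth)
      then show ?thesis using i k by (auto simp: nth_append covers_def)
    qed
    then show "us @ [alpha] \<in> young_chains alpha gamma"
      using us assms(1) by (auto simp: young_chains_def)
  qed
qed

lemma finite_young_chains: "finite (young_chains alpha gamma)"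
proof (induction "psize alpha" arbitrary: alpha rule: less_induct)
  case less
  show ?case
  proof (cases "partition alpha")
    case True
    show ?thesis
    proof (cases "alpha = gamma")
      case False
      show ?thesis unfolding young_chains_step[OF True False]
        by (intro finite_UN_I finite_covers finite_imageI less) (auto simp: covers_def)
    qed (simp add: young_chains_psize_eq)
  next
    case False
    have "young_chains alpha gamma = {}"
    proof (rule equals0I)
      fix ks assume "ks \<in> young_chains alpha gamma"
      then show False using False last_in_set[of ks] by (auto simp: young_chains_def)
    qed
    then show ?thesis by simp
  qed
qed

lemma F_chains_rec:
  assumes "partition alpha" "alpha \<noteq> gamma"
  shows "F_chains alpha gamma = (\<Sum>kappa\<in>covers alpha. F_chains kappa gamma)"
proof -
  have "F_chains alpha gamma = (\<Sum>kappa\<in>covers alpha. card ((\<lambda>ks. ks @ [alpha]) ` young_chains kappa gamma))"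
    unfolding F_chains_eq young_chains_step[OF assms]
    by (rule card_UN_disjoint) (auto simp: finite_covers finite_young_chains, auto simp: young_chains_def)
  also have "\<dots> = (\<Sum>kappa\<in>covers alpha. F_chains kappa gamma)"
    unfolding F_chains_eq by (intro sum.cong HOL.refl card_image) (auto simp: inj_on_def)
  finally show ?thesis .
qed

lemma F_chains_psize_eq:
  "partition alpha \<Longrightarrow> psize alpha = psize gamma \<Longrightarrow> F_chains alpha gamma = of_bool (alpha = gamma)"
  by (auto simp: F_chains_eq young_chains_psize_eq)

lemma F_chains_nonzero:
  assumes "F_chains alpha gamma \<noteq> 0"
  shows "yd_le gamma alpha" "psize gamma \<le> psize alpha"
proof -
  have "young_chains alpha gamma \<noteq> {}" using assms by (auto simp: F_chains_eq)
  then obtain ks where ks: "ks \<in> young_chains alpha gamma" by blast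
  then have "length ks \<ge> 1" by (auto simp: young_chains_def Suc_le_eq)
  then show "yd_le gamma alpha" "psize gamma \<le> psize alpha"
    using young_chains_psize[OF ks] by auto
qed

text \<open>\<open>n! / hooks\<close> and the number of chains obey the same recursion over the
  partitions with one box less.\<close>

lemma hook_length_formula:
  assumes "partition alpha"
  shows "real (F_chains alpha []) * hooks alpha = fact (psize alpha)"
  using assms
proof (induction "psize alpha" arbitrary: alpha)
  case 0
  then have "alpha = []" using psize_eq_0_iff by metis
  then show ?case by (simp add: F_chains_psize_eq)
next
  case (Suc m)
  then have "alpha \<noteq> []" by auto
  have "real (F_chains alpha []) * hooks alpha = (\<Sum>kappa\<in>covers alpha. real (F_chains kappa []) * hooks alpha)"
    unfolding F_chains_rec[OF Suc.prems \<open>alpha \<noteq> []\<close>] by (simp add: sum_distrib_right)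
  also have "\<dots> = (\<Sum>kappa\<in>covers alpha. fact m * (hooks alpha / hooks kappa))"
  proof (rule sum.cong[OF HOL.refl])
    fix kappa assume "kappa \<in> covers alpha"
    then have k: "partition kappa" "m = psize kappa" using Suc.hyps(2) by (auto simp: covers_def)
    show "real (F_chains kappa []) * hooks alpha = fact m * (hooks alpha / hooks kappa)"
      using Suc.hyps(1)[OF k(2,1)] hooks_pos[OF k(1)] k(2) by (simp add: field_simps)
  qed
  also have "\<dots> = fact m * real (psize alpha)"
    unfolding hooks_rec_covers[OF Suc.prems] by (simp add: sum_distrib_left)
  finally show ?case using Suc.hyps(2)[symmetric] by simp
qed

section \<open>Tuples of partitions\<close>

definition tuple_covers :: "nat \<Rightarrow> (nat \<Rightarrow> nat list) \<Rightarrow> (nat \<Rightarrow> nat list) set" where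
  "tuple_covers p mu = {kappa. is_ptuple p kappa \<and> qle p kappa mu \<and> Suc (qsize p kappa) = qsize p mu}"

lemma qsize_update:
  "i < p \<Longrightarrow> qsize p (mu(i := a)) + psize (mu i) = qsize p mu + psize a"
  by (simp add: qsize_def sum.remove[of "{..<p}" i])

text \<open>The component sizes can only drop, and in total by one, so exactly one component loses a
  box. Inclusion with equal size forces the others to agree.\<close>

lemma tuple_covers_eq:
  assumes mu: "is_ptuple p mu"
  shows "tuple_covers p mu = (\<lambda>(i, a). mu(i := a)) ` Sigma {..<p} (\<lambda>i. covers (mu i))"
proof
  show "(\<lambda>(i, a). mu(i := a)) ` Sigma {..<p} (\<lambda>i. covers (mu i)) \<subseteq> tuple_covers p mu"
  proof (rule image_subsetI)
    fix x assume "x \<in> Sigma {..<p} (\<lambda>i. covers (mu i))"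
    then obtain i a where x: "x = (i, a)" "i < p" "a \<in> covers (mu i)" by auto
    then have "mu(i := a) \<in> tuple_covers p mu"
      using mu qsize_update[of i p mu a] by (auto simp: tuple_covers_def is_ptuple_def qle_def covers_def)
    then show "(\<lambda>(i, a). mu(i := a)) x \<in> tuple_covers p mu" by (simp add: x(1))
  qed
  show "tuple_covers p mu \<subseteq> (\<lambda>(i, a). mu(i := a)) ` Sigma {..<p} (\<lambda>i. covers (mu i))"
  proof
    fix kappa assume k: "kappa \<in> tuple_covers p mu"
    have le: "psize (kappa i) \<le> psize (mu i)" if "i < p" for i
      using k that by (auto simp: tuple_covers_def is_ptuple_def qle_def intro: psize_mono)
    have "\<not> (\<forall>i<p. psize (kappa i) = psize (mu i))"
    proof
      assume "\<forall>i<p. psize (kappa i) = psize (mu i)"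
      then have "qsize p kappa = qsize p mu" by (simp add: qsize_def)
      then show False using k by (simp add: tuple_covers_def)
    qed
    then obtain i where i: "i < p" "psize (kappa i) < psize (mu i)" using le by (meson le_neq_implies_less)
    have sum: "Suc (psize (kappa i) + (\<Sum>j\<in>{..<p} - {i}. psize (kappa j))) =
        psize (mu i) + (\<Sum>j\<in>{..<p} - {i}. psize (mu j))"
      using k i by (simp add: tuple_covers_def qsize_def sum.remove[of "{..<p}" i])
    moreover have "(\<Sum>j\<in>{..<p} - {i}. psize (kappa j)) \<le> (\<Sum>j\<in>{..<p} - {i}. psize (mu j))"
      by (rule sum_mono) (use le in auto)
    ultimately have si: "psize (mu i) = Suc (psize (kappa i))" 
      and "(\<Sum>j\<in>{..<p} - {i}. psize (kappa j)) = (\<Sum>j\<in>{..<p} - {i}. psize (mu j))" using i by linarith+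
    then have eq: "psize (kappa j) = psize (mu j)" if "j < p" "j \<noteq> i" for j
      using sum_mono_inv[of "\<lambda>j. psize (kappa j)" "{..<p} - {i}" "\<lambda>j. psize (mu j)" j] le that by auto
    have "kappa = mu(i := kappa i)"
    proof
      fix j
      show "kappa j = (mu(i := kappa i)) j"
      proof (cases "j < p \<and> j \<noteq> i")
        case True
        then show ?thesis using eq[of j] k mu yd_le_psize_eq[of "kappa j" "mu j"]
          by (auto simp: tuple_covers_def is_ptuple_def qle_def)
      next
        case False
        then show ?thesis using k mu by (auto simp: tuple_covers_def is_ptuple_def)
      qed
    qed
    moreover have "kappa i \<in> covers (mu i)"
      using k i si by (auto simp: covers_def tuple_covers_def is_ptuple_def qle_def)
    ultimately show "kappa \<in> (\<lambda>(i, a). mu(i := a)) ` Sigma {..<p} (\<lambda>i. covers (mu i))"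
      using i(1) by (intro image_eqI[of _ _ "(i, kappa i)"]) auto
  qed
qed

lemma inj_on_tuple_update: "inj_on (\<lambda>(i, a). mu(i := a)) (Sigma {..<p} (\<lambda>i. covers (mu i)))"
proof (rule inj_onI, clarify)
  fix i a j b assume h: "a \<in> covers (mu i)" "b \<in> covers (mu j)" "mu(i := a) = mu(j := b)"
  have ne: "a \<noteq> mu i" "b \<noteq> mu j" using h by (auto simp: covers_def)
  have "i = j"
  proof (rule ccontr)
    assume "i \<noteq> j"
    then have "a = mu i" using fun_cong[OF h(3), of i] by simp
    with ne show False by simp
  qed
  then show "i = j \<and> a = b" using fun_cong[OF h(3), of i] by simp
qed

lemma sum_tuple_covers:
  assumes "is_ptuple p mu"
  shows "(\<Sum>kappa\<in>tuple_covers p mu. f kappa) = (\<Sum>i<p. \<Sum>a\<in>covers (mu i). f (mu(i := a)))"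
  unfolding tuple_covers_eq[OF assms] sum.reindex[OF inj_on_tuple_update]
  by (subst sum.Sigma) (auto simp: finite_covers intro: sum.cong)

text \<open>Spreading the multinomial denominator over the components gives each of them a factor
  \<open>F / k!\<close>, so that removing a box affects a single factor.\<close>

lemma Fp_eq:
  "Fp p mu nu = fact (qsize p mu - qsize p nu) *
    (\<Prod>i<p. real (F_chains (mu i) (nu i)) / fact (psize (mu i) - psize (nu i)))"
  by (simp add: Fp_def prod_dividef)

lemma Fp_nonzero:
  assumes "Fp p mu nu \<noteq> 0" 
  shows "qle p nu mu" "i < p \<Longrightarrow> psize (nu i) \<le> psize (mu i)"
proof -
  have "F_chains (mu i) (nu i) \<noteq> 0" if "i < p" for i
    using assms that by (auto simp: Fp_def)
  then show "qle p nu mu" "i < p \<Longrightarrow> psize (nu i) \<le> psize (mu i)"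
    using F_chains_nonzero by (auto simp: qle_def)
qed

text \<open>With \<open>k i\<close> the size difference in component \<open>i\<close> and
  \<open>N\<close> the total, summing over the covers of component \<open>i\<close> multiplies its
  factor by \<open>k i\<close>. Since the \<open>k i\<close> add up to \<open>N\<close>, the
  factorial of \<open>N - 1\<close> becomes that of \<open>N\<close>.\<close>

lemma Fp_rec:
  assumes mu: "is_ptuple p mu" and lt: "qsize p nu < qsize p mu"
  shows "Fp p mu nu = (\<Sum>kappa\<in>tuple_covers p mu. Fp p kappa nu)"
proof (cases "\<forall>i<p. psize (nu i) \<le> psize (mu i)")
  case False
  \<comment> \<open>Here a component of \<open>nu\<close> is larger than that of \<open>mu\<close>,
    and subtraction of sizes is truncated. Both sides are zero because no chain of Young diagrams
    exists in that component.\<close>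
  then obtain i where i: "i < p" "psize (mu i) < psize (nu i)" by auto
  then have "Fp p mu nu = 0" using Fp_nonzero(2)[of p mu nu i] by auto
  moreover have "Fp p kappa nu = 0" if "kappa \<in> tuple_covers p mu" for kappa
  proof (rule ccontr)
    assume "Fp p kappa nu \<noteq> 0"
    then have "psize (nu i) \<le> psize (kappa i)" using Fp_nonzero(2)[OF \<open>Fp p kappa nu \<noteq> 0\<close> i(1)] by blast
    moreover have "psize (kappa i) \<le> psize (mu i)"
      using that i by (auto simp: tuple_covers_def is_ptuple_def qle_def intro: psize_mono)
    ultimately show False using i by simp
  qed
  ultimately show ?thesis by simp
next
  case True
  define N where "N = qsize p mu - qsize p nu"
  define k where "k i = psize (mu i) - psize (nu i)" for i
  define f where "f i = real (F_chains (mu i) (nu i)) / fact (k i)" for i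
  have sumk: "(\<Sum>i<p. k i) = N" unfolding N_def k_def qsize_def using True by (intro sum_subtractf_nat) auto
  have N: "N \<ge> 1" using lt by (simp add: N_def)
  have inner: "(\<Sum>a\<in>covers (mu i). Fp p (mu(i := a)) nu) = fact (N - 1) * (real (k i) * (\<Prod>j<p. f j))"
    if i: "i < p" for i
  proof -
    have mi: "partition (mu i)" using mu i by (simp add: is_ptuple_def)
    have "(\<Sum>a\<in>covers (mu i). Fp p (mu(i := a)) nu) = (\<Sum>a\<in>covers (mu i). fact (N - 1) *
       (\<Prod>j\<in>{..<p} - {i}. f j) * (real (F_chains a (nu i)) / fact (psize a - psize (nu i))))"
    proof (rule sum.cong[OF HOL.refl])
      fix a assume a: "a \<in> covers (mu i)"
      then have "qsize p (mu(i := a)) - qsize p nu = N - 1"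
        using qsize_update[OF i, of mu a] by (auto simp: N_def covers_def)
      moreover have "(\<Prod>j<p. real (F_chains ((mu(i := a)) j) (nu j)) / fact (psize ((mu(i := a)) j) - psize (nu j))) =
          real (F_chains a (nu i)) / fact (psize a - psize (nu i)) * (\<Prod>j\<in>{..<p} - {i}. f j)"
        using i by (subst prod.remove[of _ i]) (auto simp: f_def k_def intro: prod.cong)
      ultimately show "Fp p (mu(i := a)) nu = fact (N - 1) *
         (\<Prod>j\<in>{..<p} - {i}. f j) * (real (F_chains a (nu i)) / fact (psize a - psize (nu i)))"
        by (simp add: Fp_eq)
    qed
    also have "\<dots> = fact (N - 1) * (\<Prod>j\<in>{..<p} - {i}. f j) *
        (\<Sum>a\<in>covers (mu i). real (F_chains a (nu i)) / fact (psize a - psize (nu i)))"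
      by (simp add: sum_distrib_left)
    also have "(\<Sum>a\<in>covers (mu i). real (F_chains a (nu i)) / fact (psize a - psize (nu i))) = real (k i) * f i"
    proof (cases "k i")
      case 0
      \<comment> \<open>The sizes in component \<open>i\<close> agree, so with one box less it is
        already smaller than \<open>nu i\<close>.\<close>
      have "F_chains a (nu i) = 0" if "a \<in> covers (mu i)" for a
        using that 0 F_chains_nonzero(2)[of a "nu i"] by (force simp: covers_def k_def)
      then show ?thesis using 0 by simp
    next
      case (Suc k')
      then have ne: "mu i \<noteq> nu i" by (auto simp: k_def)
      have "(\<Sum>a\<in>covers (mu i). real (F_chains a (nu i)) / fact (psize a - psize (nu i))) =
        (\<Sum>a\<in>covers (mu i). real (F_chains a (nu i)) / fact k')"
      proof (rule sum.cong[OF HOL.refl])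
        fix a assume "a \<in> covers (mu i)"
        then have "psize a - psize (nu i) = k'" using Suc by (simp add: covers_def k_def)
        then show "real (F_chains a (nu i)) / fact (psize a - psize (nu i)) = real (F_chains a (nu i)) / fact k'"
          by simp
      qed
      also have "\<dots> = real (F_chains (mu i) (nu i)) / fact k'"
        unfolding F_chains_rec[OF mi ne] by (simp add: sum_divide_distrib)
      also have "\<dots> = real (k i) * f i" using Suc by (simp add: f_def)
      finally show ?thesis .
    qed
    also have "fact (N - 1) * (\<Prod>j\<in>{..<p} - {i}. f j) * (real (k i) * f i) =
        fact (N - 1) * (real (k i) * (\<Prod>j<p. f j))"
      using i by (simp add: prod.remove[of "{..<p}" i])
    finally show ?thesis .
  qed
  have "(\<Sum>kappa\<in>tuple_covers p mu. Fp p kappa nu) = (\<Sum>i<p. fact (N - 1) * (real (k i) * (\<Prod>j<p. f j)))"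
    unfolding sum_tuple_covers[OF mu] using inner by simp
  also have "\<dots> = fact (N - 1) * real N * (\<Prod>j<p. f j)"
    unfolding sumk[symmetric] by (simp add: sum_distrib_left sum_distrib_right mult_ac)
  also have "fact (N - 1) * real N = fact N" using N fact_reduce[of N, where 'a = real] by simp
  finally show ?thesis by (simp add: Fp_eq f_def k_def N_def)
qed

lemma ptuple_eqI:
  "is_ptuple p mu \<Longrightarrow> is_ptuple p nu \<Longrightarrow> (\<And>i. i < p \<Longrightarrow> mu i = nu i) \<Longrightarrow> mu = nu"
  by (rule ext) (metis is_ptuple_def not_le)

lemma Fp_qsize_eq:
  assumes mu: "is_ptuple p mu" and nu: "is_ptuple p nu" and eq: "qsize p mu = qsize p nu"
  shows "Fp p mu nu = of_bool (mu = nu)"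
proof (cases "mu = nu")
  case True
  have "F_chains (nu i) (nu i) = 1" if "i < p" for i
    using nu that by (subst F_chains_psize_eq) (auto simp: is_ptuple_def)
  then show ?thesis using True by (simp add: Fp_eq)
next
  case False
  have "Fp p mu nu = 0"
  proof (rule ccontr)
    assume nz: "Fp p mu nu \<noteq> 0"
    have le: "psize (nu i) \<le> psize (mu i)" if "i < p" for i using Fp_nonzero(2)[OF nz that] .
    have "mu i = nu i" if "i < p" for i
    proof -
      have "psize (nu i) = psize (mu i)"
        using sum_mono_inv[of "\<lambda>i. psize (nu i)" "{..<p}" "\<lambda>i. psize (mu i)" i] eq le that
        by (auto simp: qsize_def)
      then show ?thesis using Fp_nonzero(1)[OF nz] that mu nu yd_le_psize_eq[of "nu i" "mu i"]
        by (auto simp: qle_def is_ptuple_def)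
    qed
    then show False using False ptuple_eqI[OF mu nu] by blast
  qed
  then show ?thesis using False by simp
qed

text \<open>The hook length formula in each component produces the factorial of its size, which the
  multinomial denominator cancels.\<close>

lemma Fp_full_eq:
  assumes mu: "is_ptuple p mu"
  shows "Fp_full p mu * (\<Prod>i<p. hooks (mu i)) = fact (qsize p mu)"
proof -
  have "(\<Prod>i<p. real (F_chains (mu i) []) / fact (psize (mu i))) * (\<Prod>i<p. hooks (mu i)) = 1"
    unfolding prod.distrib[symmetric]
  proof (rule prod.neutral, rule ballI)
    fix i assume "i \<in> {..<p}"
    then have "partition (mu i)" using mu by (simp add: is_ptuple_def)
    then show "real (F_chains (mu i) []) / fact (psize (mu i)) * hooks (mu i) = 1"
      using hook_length_formula[of "mu i"] by simp
  qed
  then show ?thesis by (simp add: Fp_full_def Fp_eq qsize_def)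
qed

section \<open>Quotient tuples and signs\<close>

text \<open>With residues for \<open>r\<close>, the parity is the sign of the permutation that sorts
  the beads by runner. The bound \<open>b\<close> is a level below which all places are filled; it
  keeps the set finite.\<close>

definition inversions :: "(int \<Rightarrow> int) \<Rightarrow> int \<Rightarrow> int set \<Rightarrow> (int \<times> int) set" where
  "inversions r b M = {(x, y). x \<in> M \<and> y \<in> M \<and> b \<le> x \<and> x < y \<and> r y < r x}"

definition residue_sign :: "nat \<Rightarrow> int \<Rightarrow> int set \<Rightarrow> real" where
  "residue_sign p b M = (- 1) ^ card (inversions (\<lambda>x. x mod int p) b M)"

lemma residue_sign_cases: "residue_sign p b M = 1 \<or> residue_sign p b M = - 1"
  unfolding residue_sign_def by (cases "even (card (inversions (\<lambda>x. x mod int p) b M))") auto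

lemma residue_sign_square [simp]: "residue_sign p b M * residue_sign p b M = 1"
  using residue_sign_cases[of p b M] by auto

lemma card_inversions_insert:
  assumes fin: "finite (M \<inter> {b..})" and z: "z \<notin> M" "b \<le> z"
  shows "card (inversions r b (insert z M)) = card (inversions r b M) +
    card {x \<in> M. b \<le> x \<and> x < z \<and> r z < r x} +
    card {y \<in> M. z < y \<and> r y < r z}"
proof -
  let ?A = "{x \<in> M. b \<le> x \<and> x < z \<and> r z < r x}"
  let ?D = "{y \<in> M. z < y \<and> r y < r z}"
  have fA: "finite ?A" and fD: "finite ?D"
    by (rule finite_subset[OF _ fin], use z in auto)+
  have fI: "finite (inversions r b M)"
    by (rule finite_subset[of _ "(M \<inter> {b..}) \<times> (M \<inter> {b..})"]) (use fin in \<open>auto simp: inversions_def\<close>)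
  have e: "inversions r b (insert z M) = (inversions r b M \<union> (\<lambda>x. (x, z)) ` ?A) \<union> Pair z ` ?D"
    using z by (auto simp: inversions_def)
  have c1: "card (inversions r b (insert z M)) = card (inversions r b M \<union> (\<lambda>x. (x, z)) ` ?A) + card (Pair z ` ?D)"
    unfolding e
  proof (rule card_Un_disjoint)
    show "(inversions r b M \<union> (\<lambda>x. (x, z)) ` ?A) \<inter> Pair z ` ?D = {}"
      using z(1) unfolding inversions_def by blast
  qed (intro finite_UnI finite_imageI fI fA fD)+
  have c2: "card (inversions r b M \<union> (\<lambda>x. (x, z)) ` ?A) = card (inversions r b M) + card ((\<lambda>x. (x, z)) ` ?A)"
  proof (rule card_Un_disjoint)
    show "inversions r b M \<inter> (\<lambda>x. (x, z)) ` ?A = {}"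
      using z(1) unfolding inversions_def by blast
  qed (intro finite_imageI fI fA)+
  have c3: "card ((\<lambda>x. (x, z)) ` ?A) = card ?A" by (rule card_image) (auto simp: inj_on_def)
  have c4: "card (Pair z ` ?D) = card ?D" by (rule card_image) (auto simp: inj_on_def)
  show ?thesis unfolding c1 c2 c3 c4 ..
qed

text \<open>The moved bead keeps its residue, and a bead jumped over has a different one, being less
  than \<open>p\<close> away. It forms an inversion with the moving bead before the move if its
  residue is larger and after the move if it is smaller, never both; no other pair changes.\<close>

lemma residue_sign_mv:
  assumes p: "p \<ge> 1" and M: "mayaset M" and b: "{..<b} \<subseteq> M" and m: "m \<in> movable p M"
  shows "residue_sign p b (mv p m M) =
    residue_sign p b M * (- 1) ^ card {x \<in> M. m - int p < x \<and> x < m}"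
proof -
  define M0 where "M0 = M - {m}"
  define z where "z = m - int p"
  have "m \<in> M" "z \<notin> M" using m by (simp_all add: movable_def z_def)
  then have z: "z \<notin> M0" "b \<le> z" "z < m" "b \<le> m" and m0: "m \<notin> M0" and M_eq: "M = insert m M0"
    using lower_mv[OF b m] p by (auto simp: M0_def z_def)
  have mv_eq: "mv p m M = insert z M0" by (simp add: mv_def M0_def z_def)
  have fin: "finite (M0 \<inter> {b..})" 
    by (rule rev_finite_subset[OF mayaset_finite_above[OF M, of b]]) (auto simp: M0_def)
  let ?r = "\<lambda>x. x mod int p"
  have zmod: "z mod int p = m mod int p" unfolding z_def by simp
  let ?B = "{x \<in> M0. z < x \<and> x < m}"
  have Bmod: "?r x \<noteq> ?r m" if "x \<in> ?B" for x
  proof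
    assume "?r x = ?r m"
    then have "int p dvd m - x" by (metis mod_eq_dvd_iff)
    moreover have "0 < m - x" "m - x < int p" using that by (auto simp: z_def)
    ultimately show False using zdvd_imp_le by fastforce
  qed
  let ?Am = "{x \<in> M0. b \<le> x \<and> x < m \<and> ?r m < ?r x}"
  let ?Az = "{x \<in> M0. b \<le> x \<and> x < z \<and> ?r m < ?r x}"
  let ?Dm = "{y \<in> M0. m < y \<and> ?r y < ?r m}"
  let ?Dz = "{y \<in> M0. z < y \<and> ?r y < ?r m}"
  let ?Bg = "{x \<in> ?B. ?r m < ?r x}" and ?Bl = "{x \<in> ?B. ?r x < ?r m}"
  have fin': "finite X" if "X \<subseteq> M0 \<inter> {b..}" for X using fin that finite_subset by blast
  have "?Am = ?Az \<union> ?Bg"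
  proof (rule Set.set_eqI)
    fix x
    have "x \<in> M0 \<Longrightarrow> x \<noteq> z" using z(1) by blast
    moreover have "z < x \<Longrightarrow> b \<le> x" "x < z \<Longrightarrow> x < m" using z(2,3) by simp_all
    ultimately show "x \<in> ?Am \<longleftrightarrow> x \<in> ?Az \<union> ?Bg" by (cases x z rule: linorder_cases) auto
  qed
  moreover have "card (?Az \<union> ?Bg) = card ?Az + card ?Bg"
    by (rule card_Un_disjoint) (use z in \<open>auto intro!: fin'\<close>)
  ultimately have A: "card ?Am = card ?Az + card ?Bg" by simp
  have "?Dz = ?Dm \<union> ?Bl"
  proof (rule Set.set_eqI)
    fix x
    have "x \<in> M0 \<Longrightarrow> x \<noteq> m" using m0 by blast
    moreover have "m < x \<Longrightarrow> z < x" using z(3) by simp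
    ultimately show "x \<in> ?Dz \<longleftrightarrow> x \<in> ?Dm \<union> ?Bl" by (cases x m rule: linorder_cases) auto
  qed
  moreover have "card (?Dm \<union> ?Bl) = card ?Dm + card ?Bl"
    by (rule card_Un_disjoint) (use z in \<open>auto intro!: fin'\<close>)
  ultimately have D: "card ?Dz = card ?Dm + card ?Bl" by simp
  have "card ?B = card (?Bg \<union> ?Bl)" by (rule arg_cong[where f = card]) (use Bmod in force)
  also have "card (?Bg \<union> ?Bl) = card ?Bg + card ?Bl"
    by (rule card_Un_disjoint) (use z in \<open>auto intro!: fin'\<close>)
  finally have B: "card ?B = card ?Bg + card ?Bl" .
  have Bet: "{x \<in> M. m - int p < x \<and> x < m} = ?B" by (auto simp: M0_def z_def)
  have c1: "card (inversions ?r b M) = card (inversions ?r b M0) + card ?Am + card ?Dm"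
    unfolding M_eq by (rule card_inversions_insert[OF fin m0 z(4)])
  have c2: "card (inversions ?r b (mv p m M)) = card (inversions ?r b M0) + card ?Az + card ?Dz"
    unfolding mv_eq using card_inversions_insert[OF fin z(1,2), of ?r] unfolding zmod .
  \<comment> \<open>The beads in \<open>?Bg\<close> cost one inversion each and those in
    \<open>?Bl\<close> gain one; adding twice \<open>card ?Bg\<close> expresses this without
    subtraction and without changing the parity.\<close>
  have "card (inversions ?r b (mv p m M)) + 2 * card ?Bg = card (inversions ?r b M) + card ?B"
    unfolding c1 c2 A D B by simp
  then have "(- 1 :: real) ^ (card (inversions ?r b (mv p m M)) + 2 * card ?Bg) =
      (- 1) ^ (card (inversions ?r b M) + card ?B)" by simp
  then show ?thesis unfolding residue_sign_def Bet by (simp add: power_add power_mult)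
qed

text \<open>The signs of the intermediate partitions occur twice and cancel. So the parity of the
  total height depends on the two ends only, which makes the choice in \<open>ht_p\<close>
  harmless.\<close>

lemma strip_chain_sign:
  assumes "strip_chain p lam kappa k h" "p \<ge> 1" "partition lam" "{..<b} \<subseteq> maya_of lam c"
  shows "partition kappa \<and> {..<b} \<subseteq> maya_of kappa c \<and>
    (- 1) ^ h = residue_sign p b (maya_of lam c) * residue_sign p b (maya_of kappa c)"
  using assms
proof (induction rule: strip_chain.induct)
  case (refl lam)
  then show ?case by simp
next
  case (step lam kap h1 nu k h2)
  obtain m where m: "partition kap" "m \<in> movable p (maya_of lam c)" "maya_of kap c = mv p m (maya_of lam c)"
    "h1 = card {x \<in> maya_of lam c. m - int p < x \<and> x < m}"
    using step.hyps(1) unfolding border_strip_iff_move[OF step.prems(2,1), of _ _ c] by blast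
  have "{..<b} \<subseteq> maya_of kap c" using lower_mv[OF step.prems(3) m(2)] m(3) by simp
  note IH = step.IH[OF step.prems(1) m(1) this]
  have s: "residue_sign p b (maya_of kap c) = residue_sign p b (maya_of lam c) * (- 1) ^ h1"
    unfolding m(3,4) by (rule residue_sign_mv[OF step.prems(1) mayaset_maya_of[OF step.prems(2)] step.prems(3) m(2)])
  have "(- 1 :: real) ^ h1 = residue_sign p b (maya_of lam c) * residue_sign p b (maya_of kap c)"
    unfolding s mult.assoc[symmetric] by simp
  then have "(- 1 :: real) ^ (h1 + h2) = residue_sign p b (maya_of lam c) * residue_sign p b (maya_of nu c) *
      (residue_sign p b (maya_of kap c) * residue_sign p b (maya_of kap c))"
    using IH by (simp only: power_add mult_ac)
  then show ?case using IH by simp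
qed

lemma border_strip_height_unique:
  "border_strip p lam kappa h \<Longrightarrow> border_strip p lam kappa h' \<Longrightarrow> h = h'"
  by (simp add: border_strip_def Let_def)

text \<open>The charges \<open>c\<close> of the runners encode a core together with a labelling. For
  fixed \<open>c\<close>, \<open>to_part\<close> and \<open>quot\<close> pass between tuples and the
  partitions with this core.\<close>

locale core_charges =
  fixes p :: nat and c :: "nat \<Rightarrow> int"
  assumes p: "p \<ge> 1"
begin

definition C :: int where "C = (\<Sum>i<p. c i)"

definition bead_set :: "(nat \<Rightarrow> nat list) \<Rightarrow> int set" where
  "bead_set nu = combine p (\<lambda>i. maya_of (nu i) (c i))"

definition to_part :: "(nat \<Rightarrow> nat list) \<Rightarrow> nat list" where
  "to_part nu = maya_partition (bead_set nu)"

definition quot :: "nat list \<Rightarrow> nat \<Rightarrow> nat list" where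
  "quot kappa i = (if i < p then maya_partition (maya_comp p (maya_of kappa C) i) else [])"

lemma maya_comp_bead_set: "i < p \<Longrightarrow> maya_comp p (bead_set nu) i = maya_of (nu i) (c i)"
  by (simp add: bead_set_def)

lemma mayaset_bead_set: "is_ptuple p nu \<Longrightarrow> mayaset (bead_set nu)"
  unfolding bead_set_def by (rule mayaset_combine[OF p]) (auto simp: is_ptuple_def mayaset_maya_of)

lemma charge_bead_set:
  assumes nu: "is_ptuple p nu"
  shows "charge (bead_set nu) = C"
  unfolding charge_residues[OF p mayaset_bead_set[OF nu]] C_def
  using nu by (intro sum.cong) (auto simp: maya_comp_bead_set is_ptuple_def)

lemma to_part:
  assumes "is_ptuple p nu"
  shows "partition (to_part nu)" "maya_of (to_part nu) C = bead_set nu"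
  unfolding to_part_def
  using partition_maya_partition[OF mayaset_bead_set[OF assms]]
    maya_of_maya_partition[OF mayaset_bead_set[OF assms]] charge_bead_set[OF assms] by simp_all

lemma quot_eqI:
  assumes nu: "is_ptuple p nu" and eq: "maya_of kappa C = bead_set nu"
  shows "quot kappa = nu"
proof
  fix i show "quot kappa i = nu i"
    using nu by (auto simp: quot_def eq maya_comp_bead_set is_ptuple_def)
qed

text \<open>All places below \<open>C - l\<close> are filled as soon as the partition has at most
  \<open>l\<close> rows. Strip removal does not add rows, so one \<open>l\<close> serves a whole
  chain.\<close>

definition sgn_of :: "(nat \<Rightarrow> nat list) \<Rightarrow> nat \<Rightarrow> real" where
  "sgn_of nu l = residue_sign p (C - int l) (bead_set nu)"

text \<open>A bead moved by \<open>p\<close> is a bead moved by one on its runner, that is, a box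
  removed from one component of the quotient.\<close>

lemma border_strip_tuple_cover:
  assumes nu: "is_ptuple p nu" and bs: "border_strip p (to_part nu) kappa h"
  shows "quot kappa \<in> tuple_covers p nu" "to_part (quot kappa) = kappa"
proof -
  obtain m where m: "partition kappa" "m \<in> movable p (bead_set nu)" "maya_of kappa C = mv p m (bead_set nu)"
    using bs unfolding border_strip_iff_move[OF to_part(1)[OF nu] p, of _ _ C] to_part(2)[OF nu] by blast
  obtain i a where ia: "i < p" "m = int p * a + int i" using ex_residue[OF p] by blast
  have nui: "partition (nu i)" using nu ia by (simp add: is_ptuple_def)
  have a: "a \<in> movable 1 (maya_of (nu i) (c i))"
    using m(2) ia by (simp add: movable_residue maya_comp_bead_set)
  define al where "al = maya_partition (mv 1 a (maya_of (nu i) (c i)))"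
  have ms: "mayaset (mv 1 a (maya_of (nu i) (c i)))" by (rule mayaset_mv[OF mayaset_maya_of[OF nui] a])
  have al: "partition al" "maya_of al (c i) = mv 1 a (maya_of (nu i) (c i))"
    using partition_maya_partition[OF ms] maya_of_maya_partition[OF ms]
      charge_mv[OF mayaset_maya_of[OF nui] a] nui by (simp_all add: al_def)
  then have "border_strip 1 (nu i) al (card {x \<in> maya_of (nu i) (c i). a - int 1 < x \<and> x < a})"
    unfolding border_strip_iff_move[OF nui order_refl, of _ _ "c i"] using a by blast
  then have cov: "al \<in> covers (nu i)" unfolding border_strip_1_iff[OF nui] by blast
  have mem: "nu(i := al) \<in> tuple_covers p nu"
    unfolding tuple_covers_eq[OF nu] using ia cov by (intro image_eqI[of _ _ "(i, al)"]) auto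
  then have tup: "is_ptuple p (nu(i := al))" by (simp add: tuple_covers_def)
  have eq: "maya_of kappa C = bead_set (nu(i := al))"
    unfolding m(3)
    by (rule maya_comp_eqI[OF p]) (use ia al in \<open>auto simp: maya_comp_mv maya_comp_bead_set\<close>)
  have q: "quot kappa = nu(i := al)" by (rule quot_eqI[OF tup eq])
  then show "quot kappa \<in> tuple_covers p nu" using mem by simp
  show "to_part (quot kappa) = kappa"
    unfolding q using eq to_part[OF tup] m(1) maya_of_inject by metis
qed

lemma tuple_cover_border_strip:
  assumes nu: "is_ptuple p nu" and k: "k \<in> tuple_covers p nu"
  shows "\<exists>h. border_strip p (to_part nu) (to_part k) h"
proof -
  obtain i al where ia: "i < p" "al \<in> covers (nu i)" "k = nu(i := al)"
    using k unfolding tuple_covers_eq[OF nu] by auto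
  have nui: "partition (nu i)" using nu ia by (simp add: is_ptuple_def)
  have "border_strip 1 (nu i) al 0" using ia(2) border_strip_1_iff[OF nui] by blast
  then obtain a where a: "a \<in> movable 1 (maya_of (nu i) (c i))" "maya_of al (c i) = mv 1 a (maya_of (nu i) (c i))"
    unfolding border_strip_iff_move[OF nui order_refl, of _ _ "c i"] by blast
  have tup: "is_ptuple p k" using k by (simp add: tuple_covers_def)
  let ?m = "int p * a + int i"
  have "?m \<in> movable p (bead_set nu)" using a(1) ia by (simp add: movable_residue maya_comp_bead_set)
  moreover have "bead_set k = mv p ?m (bead_set nu)"
    by (rule maya_comp_eqI[OF p]) (use ia a in \<open>auto simp: maya_comp_mv maya_comp_bead_set\<close>)
  ultimately show ?thesis
    unfolding border_strip_iff_move[OF to_part(1)[OF nu] p, of _ _ C] to_part(2)[OF nu] to_part(2)[OF tup]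
    using to_part(1)[OF tup] by blast
qed

lemma bij_betw_border_strips:
  assumes nu: "is_ptuple p nu"
  shows "bij_betw (\<lambda>(kappa, h). quot kappa) {(kappa, h). border_strip p (to_part nu) kappa h} (tuple_covers p nu)"
proof (rule bij_betw_imageI)
  show "inj_on (\<lambda>(kappa, h). quot kappa) {(kappa, h). border_strip p (to_part nu) kappa h}"
  proof (rule inj_onI, clarify)
    fix k h k' h' assume b: "border_strip p (to_part nu) k h" "border_strip p (to_part nu) k' h'" "quot k = quot k'"
    then have "k = k'" using border_strip_tuple_cover(2)[OF nu] by metis
    then show "k = k' \<and> h = h'" using b border_strip_height_unique by blast
  qed
  show "(\<lambda>(kappa, h). quot kappa) ` {(kappa, h). border_strip p (to_part nu) kappa h} = tuple_covers p nu"
  proof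
    show "tuple_covers p nu \<subseteq> (\<lambda>(kappa, h). quot kappa) ` {(kappa, h). border_strip p (to_part nu) kappa h}"
    proof
      fix k assume k: "k \<in> tuple_covers p nu"
      then have tup: "is_ptuple p k" by (simp add: tuple_covers_def)
      obtain h where "border_strip p (to_part nu) (to_part k) h" using tuple_cover_border_strip[OF nu k] by blast
      moreover have "quot (to_part k) = k" by (rule quot_eqI[OF tup to_part(2)[OF tup]])
      ultimately show "k \<in> (\<lambda>(kappa, h). quot kappa) ` {(kappa, h). border_strip p (to_part nu) kappa h}"
        by (intro image_eqI[of _ _ "(to_part k, h)"]) auto
    qed
  qed (use border_strip_tuple_cover(1)[OF nu] in auto)
qed

lemma lower_bead_set:
  assumes "is_ptuple p nu" "length (to_part nu) \<le> l"
  shows "{..<C - int l} \<subseteq> bead_set nu"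
  using lower_maya_of[of C "to_part nu"] assms unfolding to_part(2)[OF assms(1)] by auto

lemma sgn_of_border_strip:
  assumes nu: "is_ptuple p nu" and l: "length (to_part nu) \<le> l"
    and bs: "border_strip p (to_part nu) kappa h"
  shows "(- 1) ^ h = sgn_of nu l * sgn_of (quot kappa) l"
proof -
  have tup: "is_ptuple p (quot kappa)" 
    using border_strip_tuple_cover(1)[OF nu bs] by (simp add: tuple_covers_def)
  have "strip_chain p (to_part nu) kappa (Suc 0) (h + 0)"
    by (rule strip_chain.step[OF bs strip_chain.refl])
  from strip_chain_sign[OF this p to_part(1)[OF nu], of "C - int l" C]
  have "(- 1) ^ h = residue_sign p (C - int l) (bead_set nu) * residue_sign p (C - int l) (maya_of kappa C)"
    using lower_bead_set[OF nu l] to_part(2)[OF nu] by simp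
  then show ?thesis
    using to_part(2)[OF tup] border_strip_tuple_cover(2)[OF nu bs] by (simp add: sgn_of_def)
qed

lemma tuple_cover_length:
  assumes nu: "is_ptuple p nu" and l: "length (to_part nu) \<le> l" and k: "k \<in> tuple_covers p nu"
  shows "is_ptuple p k" "length (to_part k) \<le> l" "psize (to_part nu) = psize (to_part k) + p"
    "Suc (qsize p k) = qsize p nu"
proof -
  show "is_ptuple p k" "Suc (qsize p k) = qsize p nu" using k by (auto simp: tuple_covers_def)
  obtain h where bs: "border_strip p (to_part nu) (to_part k) h" using tuple_cover_border_strip[OF nu k] by blast
  then show "length (to_part k) \<le> l" using l yd_le_length by (force simp: border_strip_def)
  show "psize (to_part nu) = psize (to_part k) + p" by (rule border_strip_psize[OF bs])
qed

section \<open>Coefficients indexed by tuples\<close>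

definition q_coeff :: "nat \<Rightarrow> (nat \<Rightarrow> nat list) \<Rightarrow> nat \<Rightarrow> real" where
  "q_coeff l nu d = coeff (q_norm p l (beta (to_part nu) (int l))) d"

lemma q_coeff_rec:
  assumes nu: "is_ptuple p nu" and l: "length (to_part nu) \<le> l"
  shows "(real d - real (psize (to_part nu))) * q_coeff l nu d =
    (\<Sum>k\<in>tuple_covers p nu. sgn_of nu l * sgn_of k l *
      (hooks (to_part nu) / hooks (to_part k)) * q_coeff l k d)"
proof -
  interpret w: bead_window p l "to_part nu" by unfold_locales (use p l to_part(1)[OF nu] in auto)
  let ?g = "\<lambda>k. sgn_of nu l * sgn_of k l * (hooks (to_part nu) / hooks (to_part k)) * q_coeff l k d"
  have "(real d - real (psize (to_part nu))) * q_coeff l nu d =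
    (\<Sum>x\<in>{(kappa, h). border_strip p (to_part nu) kappa h}. ?g ((\<lambda>(kappa, h). quot kappa) x))"
    unfolding q_coeff_def w.coeff_q_norm_rec
  proof (rule sum.cong[OF HOL.refl], clarify)
    fix kappa h assume bs: "border_strip p (to_part nu) kappa h"
    show "(- 1) ^ h * (hooks (to_part nu) / hooks kappa) * coeff (q_norm p l (beta kappa (int l))) d =
      sgn_of nu l * sgn_of (quot kappa) l * (hooks (to_part nu) / hooks (to_part (quot kappa))) *
      coeff (q_norm p l (beta (to_part (quot kappa)) (int l))) d"
      unfolding border_strip_tuple_cover(2)[OF nu bs] sgn_of_border_strip[OF nu l bs] ..
  qed
  also have "\<dots> = (\<Sum>k\<in>tuple_covers p nu. ?g k)"
    by (rule sum.reindex_bij_betw[OF bij_betw_border_strips[OF nu]])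
  finally show ?thesis .
qed

lemma q_coeff_top:
  assumes nu: "is_ptuple p nu" and l: "length (to_part nu) \<le> l"
  shows "q_coeff l nu (psize (to_part nu)) = 1"
proof -
  interpret w: bead_window p l "to_part nu" by unfold_locales (use p l to_part(1)[OF nu] in auto)
  show ?thesis unfolding q_coeff_def by (rule w.coeff_q_norm_top)
qed

definition empty_tuple :: "nat \<Rightarrow> nat list" where "empty_tuple i = []"

lemma is_ptuple_empty: "is_ptuple p empty_tuple"
  by (simp add: is_ptuple_def empty_tuple_def)

lemma qsize_eq_0_iff: "is_ptuple p nu \<Longrightarrow> qsize p nu = 0 \<longleftrightarrow> nu = empty_tuple"
  using psize_eq_0_iff ptuple_eqI[of p nu empty_tuple] is_ptuple_empty
  by (auto simp: qsize_def is_ptuple_def empty_tuple_def)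

lemma tuple_covers_nonempty:
  assumes nu: "is_ptuple p nu" and pos: "qsize p nu > 0"
  shows "tuple_covers p nu \<noteq> {}"
proof -
  obtain i where i: "i < p" "nu i \<noteq> []"
  proof (rule ccontr)
    assume "\<not> thesis"
    then have "nu i = []" if "i < p" for i using \<open>\<And>i. i < p \<Longrightarrow> nu i \<noteq> [] \<Longrightarrow> thesis\<close> that by blast
    then have "qsize p nu = 0" by (simp add: qsize_def)
    with pos show False by simp
  qed
  then have "covers (nu i) \<noteq> {}" using nu covers_nonempty by (simp add: is_ptuple_def)
  then show ?thesis unfolding tuple_covers_eq[OF nu] using i by auto
qed

lemma psize_to_part:
  "is_ptuple p nu \<Longrightarrow> psize (to_part nu) = psize (to_part empty_tuple) + p * qsize p nu"
proof (induction "qsize p nu" arbitrary: nu)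
  case 0
  then have "nu = empty_tuple" using qsize_eq_0_iff by metis
  then show ?case using 0 by simp
next
  case (Suc m)
  then obtain k where k: "k \<in> tuple_covers p nu" using tuple_covers_nonempty by fastforce
  note t = tuple_cover_length[OF Suc.prems order_refl k]
  have "m = qsize p k" using Suc.hyps(2) t(4) by simp
  from Suc.hyps(1)[OF this t(1)] show ?case using t(3,4) by (simp add: algebra_simps flip: t(4))
qed

text \<open>If \<open>d\<close> is not the top degree, the factor in front of the coefficient is
  nonzero, so some tuple with one box less has a nonzero coefficient at the same \<open>d\<close>.
  The descent stops where \<open>d\<close> is a top degree. This is why \<open>q_lam\<close> is a
  power of \<open>x\<close> times a polynomial in \<open>x^p\<close>.\<close>

lemma q_coeff_support:
  "is_ptuple p nu \<Longrightarrow> length (to_part nu) \<le> l \<Longrightarrow> q_coeff l nu d \<noteq> 0 \<Longrightarrow>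
    \<exists>e\<le>qsize p nu. d = psize (to_part empty_tuple) + p * e"
proof (induction "qsize p nu" arbitrary: nu rule: less_induct)
  case less
  show ?case
  proof (cases "d = psize (to_part nu)")
    case True
    then show ?thesis using psize_to_part[OF less.prems(1)] by auto
  next
    case False
    then have "(\<Sum>k\<in>tuple_covers p nu. sgn_of nu l * sgn_of k l *
      (hooks (to_part nu) / hooks (to_part k)) * q_coeff l k d) \<noteq> 0"
      using less.prems(3) q_coeff_rec[OF less.prems(1,2), of d, symmetric] by simp
    then obtain k where k: "k \<in> tuple_covers p nu" "q_coeff l k d \<noteq> 0"
      by (metis (no_types, lifting) mult_zero_right sum.neutral)
    note t = tuple_cover_length[OF less.prems(1,2) k(1)]
    obtain e where "e \<le> qsize p k" "d = psize (to_part empty_tuple) + p * e"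
      using less.hyps[OF _ t(1,2) k(2)] t(4) by auto
    then show ?thesis using t(4) by (intro exI[of _ e]) auto
  qed
qed

definition below :: "nat \<Rightarrow> (nat \<Rightarrow> nat list) \<Rightarrow> (nat \<Rightarrow> nat list) set" where
  "below j mu = {nu. is_ptuple p nu \<and> qle p nu mu \<and> qsize p nu + j = qsize p mu}"

lemma finite_below_tuple: "finite (below j mu)"
proof (rule finite_subset)
  show "below j mu \<subseteq> {f. \<forall>i. (i \<in> {..<p} \<longrightarrow> f i \<in> (\<Union>i<p. {k. partition k \<and> yd_le k (mu i)})) \<and> (i \<notin> {..<p} \<longrightarrow> f i = [])}"
    by (auto simp: below_def is_ptuple_def qle_def)
  show "finite {f. \<forall>i. (i \<in> {..<p} \<longrightarrow> f i \<in> (\<Union>i<p. {k. partition k \<and> yd_le k (mu i)})) \<and> (i \<notin> {..<p} \<longrightarrow> f i = [])}"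
    by (rule finite_set_of_finite_funs) (auto simp: finite_below)
qed

lemma below_0: "is_ptuple p mu \<Longrightarrow> below 0 mu = {mu}"
proof -
  assume mu: "is_ptuple p mu"
  have "nu = mu" if nu: "nu \<in> below 0 mu" for nu
  proof (rule ptuple_eqI[of p])
    fix i assume i: "i < p"
    have le: "psize (nu k) \<le> psize (mu k)" if "k < p" for k
      using nu that by (auto simp: below_def qle_def is_ptuple_def intro: psize_mono)
    then have "psize (nu i) = psize (mu i)"
      using sum_mono_inv[of "\<lambda>i. psize (nu i)" "{..<p}" "\<lambda>i. psize (mu i)" i] nu i
      by (auto simp: below_def qsize_def)
    then show "nu i = mu i"
      using nu mu i yd_le_psize_eq by (auto simp: below_def qle_def is_ptuple_def)
  qed (use mu nu in \<open>auto simp: below_def\<close>)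
  then show ?thesis using mu by (auto simp: below_def qle_def)
qed

text \<open>Induction on \<open>j\<close> at fixed \<open>d\<close>: removing a strip lowers the top
  degree by \<open>p\<close>, hence \<open>j\<close> by one. Through an intermediate tuple the hook
  ratios telescope and its sign is squared, so the sum over intermediate tuples acts on
  \<open>Fp\<close> alone and is evaluated by \<open>Fp_rec\<close>.\<close>

lemma q_coeff_eq:
  assumes "is_ptuple p mu" "length (to_part mu) \<le> l" "d + p * j = psize (to_part mu)" "j \<le> qsize p mu"
  shows "q_coeff l mu d = (- 1) ^ j / (real p ^ j * fact j) *
    (\<Sum>nu\<in>below j mu. sgn_of mu l * sgn_of nu l * (hooks (to_part mu) / hooks (to_part nu)) * Fp p mu nu)"
  using assms
proof (induction j arbitrary: mu)
  case 0
  have "sgn_of mu l * sgn_of mu l = 1" by (simp add: sgn_of_def)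
  then show ?case using 0 hooks_pos[OF to_part(1)[OF 0(1)]]
    by (simp add: below_0 q_coeff_top Fp_qsize_eq)
next
  case (Suc j)
  note mu = Suc.prems(1,2)
  let ?s = "\<lambda>nu. sgn_of nu l" and ?h = "\<lambda>nu. hooks (to_part nu)"
  let ?c = "(- 1) ^ j / (real p ^ j * fact j) :: real"
  have hpos: "?h k > 0" if "is_ptuple p k" for k using hooks_pos[OF to_part(1)[OF that]] .
  have summand: "?s mu * ?s k * (?h mu / ?h k) * q_coeff l k d =
     ?c * (\<Sum>nu\<in>below (Suc j) mu. ?s mu * ?s nu * (?h mu / ?h nu) * Fp p k nu)"
    if k: "k \<in> tuple_covers p mu" for k
  proof -
    note t = tuple_cover_length[OF mu k]
    have "q_coeff l k d = ?c * (\<Sum>nu\<in>below j k. ?s k * ?s nu * (?h k / ?h nu) * Fp p k nu)"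
      by (rule Suc.IH) (use t Suc.prems in auto)
    \<comment> \<open>The index set is enlarged to one that does not depend on \<open>k\<close>, so
      that the sums can be exchanged. The added terms have \<open>Fp p k nu = 0\<close>.\<close>
    also have "(\<Sum>nu\<in>below j k. ?s k * ?s nu * (?h k / ?h nu) * Fp p k nu) =
      (\<Sum>nu\<in>below (Suc j) mu. ?s k * ?s nu * (?h k / ?h nu) * Fp p k nu)"
    proof (rule sum.mono_neutral_left)
      have q: "qle p k mu" using k by (simp add: tuple_covers_def)
      show "below j k \<subseteq> below (Suc j) mu"
        using t(4) q by (auto simp: below_def qle_def intro: yd_le_trans)
      show "\<forall>nu\<in>below (Suc j) mu - below j k. ?s k * ?s nu * (?h k / ?h nu) * Fp p k nu = 0"
      proof
        fix nu assume "nu \<in> below (Suc j) mu - below j k"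
        then have "\<not> qle p nu k" using t(4) by (auto simp: below_def)
        then have "Fp p k nu = 0" using Fp_nonzero(1) by blast
        then show "?s k * ?s nu * (?h k / ?h nu) * Fp p k nu = 0" by simp
      qed
    qed (rule finite_below_tuple)
    finally have q: "q_coeff l k d = ?c * (\<Sum>nu\<in>below (Suc j) mu. ?s k * ?s nu * (?h k / ?h nu) * Fp p k nu)" .
    have "?s mu * ?s k * (?h mu / ?h k) * q_coeff l k d = ?c *
      (?s mu * ?s k * (?h mu / ?h k) * (\<Sum>nu\<in>below (Suc j) mu. ?s k * ?s nu * (?h k / ?h nu) * Fp p k nu))"
      unfolding q by (rule mult.left_commute)
    also have "\<dots> = ?c *
      (\<Sum>nu\<in>below (Suc j) mu. ?s mu * ?s k * (?h mu / ?h k) * (?s k * ?s nu * (?h k / ?h nu) * Fp p k nu))"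
      by (simp only: sum_distrib_left)
    also have "\<dots> = ?c * (\<Sum>nu\<in>below (Suc j) mu. ?s mu * ?s nu * (?h mu / ?h nu) * Fp p k nu)"
    proof (intro arg_cong[where f = "\<lambda>x. ?c * x"] sum.cong HOL.refl)
      fix nu
      have "?s k * ?s k = 1" by (simp add: sgn_of_def)
      then have "?s mu * ?s k * (?h mu / ?h k) * (?s k * ?s nu * (?h k / ?h nu) * F) =
         (?s mu * ?s nu * (?h mu / ?h nu) * F) * (?h k / ?h k)" for F
      proof -
        have "?s mu * ?s k * (?h mu / ?h k) * (?s k * ?s nu * (?h k / ?h nu) * F) =
          (?s k * ?s k) * ((?s mu * ?s nu * (?h mu / ?h nu) * F) * (?h k / ?h k))" by simp
        then show ?thesis unfolding \<open>?s k * ?s k = 1\<close> by simp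
      qed
      then show "?s mu * ?s k * (?h mu / ?h k) * (?s k * ?s nu * (?h k / ?h nu) * Fp p k nu) =
        ?s mu * ?s nu * (?h mu / ?h nu) * Fp p k nu"
        using hpos[OF t(1)] by simp
    qed
    finally show ?thesis .
  qed
  have "(real d - real (psize (to_part mu))) * q_coeff l mu d =
    (\<Sum>k\<in>tuple_covers p mu. ?c * (\<Sum>nu\<in>below (Suc j) mu. ?s mu * ?s nu * (?h mu / ?h nu) * Fp p k nu))"
    unfolding q_coeff_rec[OF mu] by (rule sum.cong[OF HOL.refl summand])
  also have "\<dots> = ?c * (\<Sum>nu\<in>below (Suc j) mu. \<Sum>k\<in>tuple_covers p mu. ?s mu * ?s nu * (?h mu / ?h nu) * Fp p k nu)"
  proof -
    have "(\<Sum>k\<in>tuple_covers p mu. \<Sum>nu\<in>below (Suc j) mu. ?s mu * ?s nu * (?h mu / ?h nu) * Fp p k nu) =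
      (\<Sum>nu\<in>below (Suc j) mu. \<Sum>k\<in>tuple_covers p mu. ?s mu * ?s nu * (?h mu / ?h nu) * Fp p k nu)"
      by (rule sum.swap)
    then show ?thesis by (simp only: sum_distrib_left[where r = ?c, symmetric])
  qed
  also have "\<dots> = ?c * (\<Sum>nu\<in>below (Suc j) mu. ?s mu * ?s nu * (?h mu / ?h nu) * Fp p mu nu)"
  proof (intro arg_cong[where f = "\<lambda>x. ?c * x"] sum.cong HOL.refl)
    fix nu assume "nu \<in> below (Suc j) mu"
    then have lt: "qsize p nu < qsize p mu" by (auto simp: below_def)
    then show "(\<Sum>k\<in>tuple_covers p mu. ?s mu * ?s nu * (?h mu / ?h nu) * Fp p k nu) =
      ?s mu * ?s nu * (?h mu / ?h nu) * Fp p mu nu"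
      using Fp_rec[OF mu(1) lt] by (simp only: sum_distrib_left[symmetric])
  qed
  finally have eq: "(real d - real (psize (to_part mu))) * q_coeff l mu d = ?c *
    (\<Sum>nu\<in>below (Suc j) mu. ?s mu * ?s nu * (?h mu / ?h nu) * Fp p mu nu)" (is "_ = ?c * ?S") .
  \<comment> \<open>The factor to divide by. It supplies the sign, the next power of
    \<open>p\<close> and the next factor of the factorial.\<close>
  have "real d - real (psize (to_part mu)) = - (real p * real (Suc j))"
    unfolding Suc.prems(3)[symmetric] by (simp add: algebra_simps)
  then have "- (real p * real (Suc j)) * q_coeff l mu d = ?c * ?S" using eq by simp
  moreover have solve: "x = - y / a" if "- a * x = y" "a \<noteq> 0" for x y a :: real
    using that by (simp add: field_simps)
  ultimately have "q_coeff l mu d = - (?c * ?S) / (real p * real (Suc j))"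
    using p by (intro solve) simp_all
  also have "\<dots> = (- 1) ^ Suc j / (real p ^ Suc j * fact (Suc j)) * ?S"
    by (simp add: mult_ac del: of_nat_Suc) 
  finally show ?case .
qed

text \<open>The choice in \<open>ht_p\<close> is meaningful only if a chain of strips exists. A
  nonzero \<open>Fp\<close> provides one, since by its recursion some tuple with one box less again
  has a nonzero \<open>Fp\<close>.\<close>

lemma strip_chain_of_Fp:
  "is_ptuple p mu \<Longrightarrow> is_ptuple p nu \<Longrightarrow> qsize p nu \<le> qsize p mu \<Longrightarrow> Fp p mu nu \<noteq> 0 \<Longrightarrow>
    \<exists>k h. strip_chain p (to_part mu) (to_part nu) k h"
proof (induction "qsize p mu" arbitrary: mu rule: less_induct)
  case less
  show ?case
  proof (cases "qsize p nu = qsize p mu")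
    case True
    then have "mu = nu" using Fp_qsize_eq[OF less.prems(1,2)] less.prems(4) by (auto split: if_splits)
    then show ?thesis using strip_chain.refl by blast
  next
    case False
    then have lt: "qsize p nu < qsize p mu" using less.prems(3) by simp
    then have "(\<Sum>k\<in>tuple_covers p mu. Fp p k nu) \<noteq> 0" using Fp_rec[OF less.prems(1) lt] less.prems(4) by simp
    then obtain k where k: "k \<in> tuple_covers p mu" "Fp p k nu \<noteq> 0" by (meson sum.neutral)
    note t = tuple_cover_length[OF less.prems(1) order_refl k(1)]
    obtain n h where "strip_chain p (to_part k) (to_part nu) n h"
      using less.hyps[OF _ t(1) less.prems(2) _ k(2)] t(4) lt by auto
    moreover obtain h' where "border_strip p (to_part mu) (to_part k) h'"
      using tuple_cover_border_strip[OF less.prems(1) k(1)] by blast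
    ultimately show ?thesis using strip_chain.step by blast
  qed
qed

lemma ht_p_sign:
  assumes mu: "is_ptuple p mu" and nu: "is_ptuple p nu" and l: "length (to_part mu) \<le> l"
    and le: "qsize p nu \<le> qsize p mu" and nz: "Fp p mu nu \<noteq> 0"
  shows "(- 1) ^ ht_p p (to_part mu) (to_part nu) = sgn_of mu l * sgn_of nu l"
proof -
  have "\<exists>h k. strip_chain p (to_part mu) (to_part nu) k h"
    using strip_chain_of_Fp[OF mu nu le nz] by blast
  from someI_ex[OF this] obtain k where "strip_chain p (to_part mu) (to_part nu) k (ht_p p (to_part mu) (to_part nu))"
    unfolding ht_p_def by blast
  from strip_chain_sign[OF this p to_part(1)[OF mu], of "C - int l" C] show ?thesis
    using lower_bead_set[OF mu l] to_part(2)[OF mu] to_part(2)[OF nu] by (simp add: sgn_of_def)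
qed

section \<open>The core as the partition of the empty tuple\<close>

lemma strip_chain_to_part:
  assumes "strip_chain p lam kappa k h" "is_ptuple p nu" "lam = to_part nu"
  shows "\<exists>nu'. is_ptuple p nu' \<and> kappa = to_part nu'"
  using assms
proof (induction arbitrary: nu rule: strip_chain.induct)
  case (step lam kap h1 nu' k h2)
  have bs: "border_strip p (to_part nu) kap h1" using step.hyps(1) step.prems(2) by simp
  have "is_ptuple p (quot kap)" using border_strip_tuple_cover(1)[OF step.prems(1) bs] by (simp add: tuple_covers_def)
  then show ?case using step.IH border_strip_tuple_cover(2)[OF step.prems(1) bs] by metis
qed blast

lemma no_border_strip_iff:
  assumes nu: "is_ptuple p nu"
  shows "(\<exists>kap h. border_strip p (to_part nu) kap h) \<longleftrightarrow> nu \<noteq> empty_tuple"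
proof
  assume "\<exists>kap h. border_strip p (to_part nu) kap h"
  then have "tuple_covers p nu \<noteq> {}" using border_strip_tuple_cover(1)[OF nu] by blast
  then have "qsize p nu \<noteq> 0" by (auto simp: tuple_covers_def)
  then show "nu \<noteq> empty_tuple" using qsize_eq_0_iff[OF nu] by simp
next
  assume "nu \<noteq> empty_tuple"
  then have "tuple_covers p nu \<noteq> {}" using tuple_covers_nonempty[OF nu] qsize_eq_0_iff[OF nu] by simp
  then show "\<exists>kap h. border_strip p (to_part nu) kap h" using tuple_cover_border_strip[OF nu] by blast
qed

lemma strip_chain_to_core:
  "is_ptuple p nu \<Longrightarrow> \<exists>k h. strip_chain p (to_part nu) (to_part empty_tuple) k h"
proof (induction "qsize p nu" arbitrary: nu rule: less_induct)
  case less
  show ?case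
  proof (cases "nu = empty_tuple")
    case True
    then show ?thesis using strip_chain.refl by blast
  next
    case False
    then have pos: "qsize p nu > 0" using qsize_eq_0_iff[OF less.prems] by simp
    then obtain k where k: "k \<in> tuple_covers p nu" using tuple_covers_nonempty[OF less.prems] by blast
    note t = tuple_cover_length[OF less.prems order_refl k]
    obtain n h where "strip_chain p (to_part k) (to_part empty_tuple) n h"
      using less.hyps[OF _ t(1)] t(4) by auto
    moreover obtain h' where "border_strip p (to_part nu) (to_part k) h'"
      using tuple_cover_border_strip[OF less.prems k] by blast
    ultimately show ?thesis using strip_chain.step by blast
  qed
qed

text \<open>Every partition reached by removals belongs to a tuple with the same charges, and only
  the empty tuple admits no further removal. Hence the end of the process is unique.\<close>

lemma p_core_to_part:
  assumes nu: "is_ptuple p nu"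
  shows "p_core p (to_part nu) = to_part empty_tuple"
  unfolding p_core_def
proof (rule the_equality)
  show "(\<exists>k h. strip_chain p (to_part nu) (to_part empty_tuple) k h) \<and>
    \<not> (\<exists>kap h. border_strip p (to_part empty_tuple) kap h)"
    using strip_chain_to_core[OF nu] no_border_strip_iff[OF is_ptuple_empty] by simp
next
  fix kappa assume k: "(\<exists>k h. strip_chain p (to_part nu) kappa k h) \<and> \<not> (\<exists>kap h. border_strip p kappa kap h)"
  then obtain nu' where "is_ptuple p nu'" "kappa = to_part nu'" using strip_chain_to_part[OF _ nu] by blast
  then show "kappa = to_part empty_tuple" using k no_border_strip_iff by blast
qed

lemma hooks_to_part:
  assumes nu: "is_ptuple p nu"
  shows "hooks (to_part nu) = H_nonpfold p (to_part nu) * real p ^ qsize p nu * (\<Prod>i<p. hooks (nu i))"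
proof -
  have "hooks (to_part nu) = hook_prod (bead_set nu)"
    using hook_prod_maya_of[OF to_part(1)[OF nu], of C] to_part(2)[OF nu] by simp
  also have "\<dots> = hook_prod_nonp p (bead_set nu) *
    (\<Prod>i<p. real p ^ card (bead_gaps (maya_comp p (bead_set nu) i)) * hook_prod (maya_comp p (bead_set nu) i))"
    by (rule hook_prod_residues[OF p mayaset_bead_set[OF nu]])
  also have "(\<Prod>i<p. real p ^ card (bead_gaps (maya_comp p (bead_set nu) i)) * hook_prod (maya_comp p (bead_set nu) i)) =
    (\<Prod>i<p. real p ^ psize (nu i) * hooks (nu i))"
  proof (rule prod.cong[OF HOL.refl])
    fix i assume "i \<in> {..<p}"
    then have "i < p" "partition (nu i)" using nu by (auto simp: is_ptuple_def)
    then show "real p ^ card (bead_gaps (maya_comp p (bead_set nu) i)) * hook_prod (maya_comp p (bead_set nu) i) =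
      real p ^ psize (nu i) * hooks (nu i)"
      by (simp add: maya_comp_bead_set hook_prod_maya_of psize_eq_card_bead_gaps[of _ "c i"])
  qed
  also have "hook_prod_nonp p (bead_set nu) = H_nonpfold p (to_part nu)"
    using H_nonpfold_eq[OF to_part(1)[OF nu], of p C] to_part(2)[OF nu] by simp
  finally show ?thesis by (simp add: prod.distrib qsize_def power_sum mult.assoc)
qed

end

section \<open>The coefficient formula\<close>

lemma maya_lam_eq:
  "maya_lam lam = maya_of lam (int (length lam))"
proof -
  have "{int (degvec lam ! i) |i. i < length lam} = beta lam (int (length lam)) ` {..<length lam}"
    by (force simp: degvec_def beta_def part_def of_nat_diff image_iff)
  then show ?thesis
    unfolding maya_lam_def beta_window(2)[OF order_refl] by (auto simp: lessThan_def)
qed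

text \<open>The parameter \<open>t\<close> enters only through the charge.\<close>

lemma maya_shift_eq: "maya_shift t lam = maya_of lam (int (length lam) + int t)"
  unfolding maya_shift_def maya_lam_eq maya_of_eq image_image
  by (rule image_cong) (auto simp: beta_def)

lemma coeff_R_lam:
  assumes q: "\<And>x. q_lam p lam x = poly q x" and p: "p \<ge> 1"
    and supp: "\<And>d. coeff q d \<noteq> 0 \<Longrightarrow> \<exists>e\<le>N. d = psize (p_core p lam) + p * e" and e: "e \<le> N"
  shows "coeff (R_lam p lam) e = coeff q (psize (p_core p lam) + p * e)"
proof -
  let ?m = "psize (p_core p lam)"
  define R where "R = (\<Sum>e\<le>N. monom (coeff q (?m + p * e)) e)"
  have "q = (\<Sum>e\<le>N. monom (coeff q (?m + p * e)) (?m + p * e))"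
  proof (rule poly_eqI)
    fix d
    have "coeff (\<Sum>e\<le>N. monom (coeff q (?m + p * e)) (?m + p * e)) d =
      (\<Sum>e\<le>N. if ?m + p * e = d then coeff q d else 0)"
      unfolding coeff_sum by (intro sum.cong) auto
    also have "\<dots> = coeff q d"
    proof (cases "\<exists>e\<le>N. d = ?m + p * e")
      case True
      then obtain e where "e \<le> N" "d = ?m + p * e" by blast
      then have "(\<Sum>e\<le>N. if ?m + p * e = d then coeff q d else 0) = (\<Sum>e'\<le>N. if e' = e then coeff q d else 0)"
        using p by (intro sum.cong) auto
      then show ?thesis using \<open>e \<le> N\<close> by simp
    next
      case False
      then have "coeff q d = 0" using supp by blast
      then show ?thesis by (simp cong: if_cong)
    qed
    finally show "coeff q d = coeff (\<Sum>e\<le>N. monom (coeff q (?m + p * e)) (?m + p * e)) d" ..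
  qed
  then have q_sum: "poly q x = (\<Sum>e\<le>N. coeff q (?m + p * e) * x ^ (?m + p * e))" for x
    by (metis (no_types, lifting) poly_monom poly_sum sum.cong)
  have R: "poly q x = x ^ ?m * poly R (x ^ p)" for x
    unfolding q_sum R_def poly_sum poly_monom sum_distrib_left
    by (intro sum.cong HOL.refl) (simp add: power_add power_mult)
  have "R_lam p lam = R"
    unfolding R_lam_def
  proof (rule the_equality)
    show "\<forall>x. q_lam p lam x = x ^ ?m * poly R (x ^ p)" using q R by simp
    fix R' assume R': "\<forall>x. q_lam p lam x = x ^ ?m * poly R' (x ^ p)"
    \<comment> \<open>Uniqueness for the definite description: a positive \<open>y\<close> has a
      positive \<open>p\<close>-th root, where the power of \<open>x\<close> in front is nonzero,
      and infinitely many such \<open>y\<close> determine the polynomial.\<close>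
    have "poly R' y = poly R y" if "y > 0" for y
    proof -
      have "root p y > 0" "root p y ^ p = y" using p that by auto
      moreover have "root p y ^ ?m * poly R' (root p y ^ p) = root p y ^ ?m * poly R (root p y ^ p)"
        using q R R' by metis
      ultimately show ?thesis by simp
    qed
    then have "{0<..} \<subseteq> {y. poly (R' - R) y = 0}" by auto
    moreover have "infinite {0::real<..}" by (rule infinite_Ioi)
    ultimately have "R' - R = 0" using poly_roots_finite finite_subset by blast
    then show "R' = R" by simp
  qed
  moreover have "coeff R e = coeff q (?m + p * e)"
    using e by (simp add: R_def coeff_sum)
  ultimately show ?thesis by simp
qed

theorem theorem7p7:
  fixes p t j :: nat and lam :: "nat list"
  assumes "p \<ge> 2" and "partition lam"
    and "j \<le> qsize p (p_quotient p t lam)"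
  shows "coeff (R_lam p lam) (qsize p (p_quotient p t lam) - j) =
    (- 1) ^ j * real (qsize p (p_quotient p t lam) choose j) *
    (\<Sum>mt \<in> {mt. is_ptuple p mt \<and> qle p mt (p_quotient p t lam) \<and>
                  qsize p mt + j = qsize p (p_quotient p t lam)}.
       (- 1) ^ ht_p p lam (lam_tilde p t lam mt) *
       (Fp_full p mt * Fp p (p_quotient p t lam) mt / Fp_full p (p_quotient p t lam)) *
       (H_nonpfold p lam / H_nonpfold p (lam_tilde p t lam mt)))"
proof -
  define M where "M = maya_shift t lam"
  define c where "c i = charge (maya_comp p M i)" for i
  have p: "p \<ge> 1" using assms(1) by simp
  interpret core_charges p c by unfold_locales (rule p)
  define mu where "mu = p_quotient p t lam"
  define N where "N = qsize p mu"
  let ?l = "length lam"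
  have M_eq: "M = maya_of lam (int ?l + int t)" by (simp add: M_def maya_shift_eq)
  have M: "mayaset M" unfolding M_eq by (rule mayaset_maya_of[OF assms(2)])
  have "C = charge M" unfolding C_def c_def by (rule charge_residues[OF p M, symmetric])
  also have "\<dots> = int ?l + int t" unfolding M_eq using assms(2) by simp
  finally have C: "C = int ?l + int t" .
  have Mi: "mayaset (maya_comp p M i)" for i by (rule mayaset_maya_comp[OF p M])
  have mu: "is_ptuple p mu"
    using partition_maya_partition[OF Mi] by (auto simp: is_ptuple_def mu_def p_quotient_def M_def)
  \<comment> \<open>The quotient keeps the partition of each runner and \<open>c\<close> its charge;
    together they recover the runner, and the runners recover \<open>M\<close>.\<close>
  have bead: "bead_set mu = M"
  proof (rule maya_comp_eqI[OF p])
    fix i assume i: "i < p"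
    then show "maya_comp p (bead_set mu) i = maya_comp p M i"
      using maya_of_maya_partition[OF Mi, of i]
      by (simp add: maya_comp_bead_set mu_def p_quotient_def c_def M_def)
  qed
  have lam: "to_part mu = lam" unfolding to_part_def bead M_eq using assms(2) by simp
  have tilde: "lam_tilde p t lam nu = to_part nu" for nu
    unfolding lam_tilde_def to_part_def bead_set_def combine_def c_def M_def ..
  have len: "length (to_part mu) \<le> ?l" by (simp add: lam)
  have core: "p_core p lam = to_part empty_tuple" using p_core_to_part[OF mu] by (simp add: lam)
  have size: "psize lam = psize (to_part empty_tuple) + p * N"
    using psize_to_part[OF mu] by (simp add: lam N_def)
  have j: "j \<le> N" using assms(3) by (simp add: N_def mu_def)
  have R: "coeff (R_lam p lam) (N - j) = q_coeff ?l mu (psize (to_part empty_tuple) + p * (N - j))"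
    unfolding q_coeff_def lam core[symmetric]
  proof (rule coeff_R_lam[OF q_lam_eq_poly[OF p assms(2)] p])
    fix d assume "coeff (q_norm p ?l (beta lam (int ?l))) d \<noteq> 0"
    then show "\<exists>e\<le>N. d = psize (p_core p lam) + p * e"
      using q_coeff_support[OF mu len, of d] unfolding q_coeff_def lam N_def core by blast
  qed simp
  have d: "psize (to_part empty_tuple) + p * (N - j) + p * j = psize (to_part mu)"
    using j by (simp add: lam size add_mult_distrib2[symmetric])
  have "coeff (R_lam p lam) (N - j) = (- 1) ^ j / (real p ^ j * fact j) *
    (\<Sum>nu\<in>below j mu. sgn_of mu ?l * sgn_of nu ?l * (hooks lam / hooks (to_part nu)) * Fp p mu nu)"
    unfolding R using q_coeff_eq[OF mu len d] j by (simp only: lam N_def)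
  also have "\<dots> = (\<Sum>nu\<in>below j mu. (- 1) ^ j * real (N choose j) *
       ((- 1) ^ ht_p p lam (to_part nu) * (Fp_full p nu * Fp p mu nu / Fp_full p mu) *
       (H_nonpfold p lam / H_nonpfold p (to_part nu))))"
    unfolding sum_distrib_left
  proof (rule sum.cong[OF HOL.refl])
    fix nu assume "nu \<in> below j mu"
    then have nu: "is_ptuple p nu" "qsize p nu + j = N" by (auto simp: below_def N_def)
    show "(- 1) ^ j / (real p ^ j * fact j) *
        (sgn_of mu ?l * sgn_of nu ?l * (hooks lam / hooks (to_part nu)) * Fp p mu nu) =
      (- 1) ^ j * real (N choose j) *
       ((- 1) ^ ht_p p lam (to_part nu) * (Fp_full p nu * Fp p mu nu / Fp_full p mu) *
       (H_nonpfold p lam / H_nonpfold p (to_part nu)))"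
    \<comment> \<open>If \<open>Fp\<close> vanishes, both summands are zero; so the sign has to be
      identified only where a chain of strips is known to exist.\<close>
    proof (cases "Fp p mu nu = 0")
      case False
      define s where "s = sgn_of mu ?l * sgn_of nu ?l"
      have s: "(- 1) ^ ht_p p lam (to_part nu) = s"
        using ht_p_sign[OF mu nu(1) len _ False] nu(2) by (simp add: lam N_def s_def)
      define Pm Pn where "Pm = (\<Prod>i<p. hooks (mu i))" and "Pn = (\<Prod>i<p. hooks (nu i))"
      have P: "Pm > 0" "Pn > 0"
        unfolding Pm_def Pn_def using mu nu(1) by (auto intro!: prod_pos hooks_pos simp: is_ptuple_def)
      have Fm: "Fp_full p mu = fact N / Pm" and Fn: "Fp_full p nu = fact (N - j) / Pn"
      proof -
        have "N - j = qsize p nu" using nu(2) by simp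
        then show "Fp_full p mu = fact N / Pm" "Fp_full p nu = fact (N - j) / Pn"
          using Fp_full_eq[OF mu] Fp_full_eq[OF nu(1)] P
          unfolding Pm_def[symmetric] Pn_def[symmetric] N_def[symmetric]
          by (simp_all add: nonzero_eq_divide_eq)
      qed
      \<comment> \<open>In the quotient of these two, the powers of \<open>p\<close> leave
        \<open>p^j\<close>, which cancels against the denominator. \<open>Pm / Pn\<close> is
        expressed by \<open>Fp_full\<close> and factorials, and these together with the factorial of
        \<open>j\<close> form the binomial coefficient.\<close>
      have h: "hooks lam = H_nonpfold p lam * real p ^ N * Pm"
        "hooks (to_part nu) = H_nonpfold p (to_part nu) * real p ^ (N - j) * Pn"
        using hooks_to_part[OF mu] hooks_to_part[OF nu(1)] nu(2) unfolding Pm_def Pn_def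
        by (auto simp: lam N_def[symmetric])
      have "H_nonpfold p (to_part nu) \<noteq> 0" using h(2) hooks_pos[OF to_part(1)[OF nu(1)]] by auto
      moreover have "real p ^ N = real p ^ (N - j) * real p ^ j" using j by (simp flip: power_add)
      moreover have "real (N choose j) = fact N / (fact j * fact (N - j))" by (rule binomial_fact[OF j])
      ultimately show ?thesis
        unfolding s s_def[symmetric] Fm Fn h using P p by (simp add: field_simps)
    qed simp
  qed
  finally show ?thesis
    unfolding mu_def[symmetric] N_def tilde below_def sum_distrib_left .
qed

end
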